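(* Let $u_h\in V^h$ solve the IPDG scheme $$a_h(u_h,v_h)-k^2(u_h,v_h)+\mathbf{i}k\langle u_h,v_h\rangle_{\Gamma_R}=(f,v_h)+\langle g,v_h\rangle_{\Gamma_R}\qquad\forall v_h\in V^h,$$ with $k>0$, $f\in L^2(\Omega)$, $g\in L^2(\Gamma_R)$, and suppose $\gamma_{0,e},\gamma_{1,e},\beta_{1,e}>0$ for all relevant edges/faces $e$. Define $M(f,g):=\|f\|_{L^2(\Omega)}+\|g\|_{L^2(\Gamma_R)}$. Then there exists a positive constant $C_{\rm sta}$ such that $$\|u_h\|_{L^2(\Omega)}+\frac1k\|u_h\|_{1,h}+\frac1k\Big(\sum_{e\in\mathcal{E}_h^R}\|\nabla u_h\|_{L^2(e)}^2\Big)^{1/2}+\frac1k\Big(\sum_{e\in\mathcal{E}_h^D}c_D\big(k^2\|u_h\|_{L^2(e)}^2+\|\nabla u_h\|_{L^2(e)}^2\big)\Big)^{1/2}\lesssim C_{\rm sta}\,M(f,g)$$ and $$C_{\rm sta}\le\frac1k+\frac1{k^2}+\frac1{k^2}\max_{e\in\mathcal{E}_h^D}\left(\frac1{\gamma_{0,e}}+\frac{\gamma_{0,e}}{h_e}+\sqrt{\frac{\gamma_{0,e}}{\beta_{1,e}}}+\frac1{\beta_{1,e}}\right)+\frac1{k^2}\max_{e\in\mathcal{E}_h^I}\left(\frac{k^2+1}{\gamma_{0,e}}+\frac1{h_e}\sqrt{\frac{\gamma_{0,e}}{\gamma_{1,e}}}+\sqrt{\frac{\gamma_{0,e}}{\b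eta_{1,e}}}+\frac1{\beta_{1,e}}\right).$$
   Context: Domain. $d\in\{2,3\}$; $\Omega_1\subset\mathbf{R}^d$ is a bounded polygonal/polyhedral domain, $D\subset\Omega_1$ is the scatterer (polygonal/polyhedral so that $\Omega$ can be triangulated; $D=\emptyset$ is allowed, then $\Gamma_D=\emptyset$), $\Omega:=\Omega_1\setminus D$, $\Gamma_R:=\partial\Omega_1$, $\Gamma_D:=\partial D$, so $\partial\Omega=\Gamma_R\cup\Gamma_D$. Standing assumption: there are a point $x_{\Omega_1}$ and constants $c_{\Omega_1}>0$, $c_D\ge0$ with $(x-x_{\Omega_1})\cdot n_\Omega\ge c_{\Omega_1}$ on $\Gamma_R$ and $(x-x_{\Omega_1})\cdot n_D\ge c_D$ on $\Gamma_D$, where $n_\Omega,n_D$ are the unit outward normals to $\Omega$ and $D$. Mesh. $\mathcal{T}_h$ is a family of triangulations of $\Omega$ into triangles/tetrahedra satisfying the minimal angle condition; $h_K=\mathrm{diam}(K)$, $h_e=\mathrm{diam}(e)$ for an edge/face $e$. $\mathcal{E}_h^I$, $\mathcal{E}_h^R$, $\mathcal{E}_h^D$ are the sets of interior edges/faces, those on $\Gamma_R$, those on $\Gamma_D$; $\mathcal{E}_h^{ID}=\mathcal{E}_h^I\cup\mathcal{E}_h^D$. For $e=\partial K\cap\partial K'\in\mathcal{E}_h^I$ with $K$ having the bigger global label: $[v]=v|_K-v|_{K'}$, $\{v\}=\frac12(v|_K+v|_{K'})$, $n_e$ = unit outward normal of $K$ on $e$. For $e\in\mathcal{E}_h^D$: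 $[v]=\{v\}=v$; for boundary $e$: $n_e=n_\Omega$. $\{\tau_e^j\}_{j=1}^{d-1}$ is an orthonormal frame tangent to $e$, $\partial v/\partial\tau_e^j=\nabla v\cdot\tau_e^j$. Forms (all functions complex-valued; $L^2$ inner products $(\cdot,\cdot)$ on $\Omega$ and $\langle\cdot,\cdot\rangle_\Sigma$ on $\Sigma$ are conjugate-linear in the second argument). $E=\prod_{K\in\mathcal{T}_h}H^2(K)$, $V^h=\prod_{K\in\mathcal{T}_h}P_1(K)$ with $P_1(K)$ the (complex) polynomials of degree $\le1$. With nonnegative real numbers $\gamma_{0,e},\gamma_{1,e},\beta_{1,e}$, $$a_h(u,v)=\sum_K(\nabla u,\nabla v)_K-\sum_{e\in\mathcal{E}_h^{ID}}\Big(\langle\{\tfrac{\partial u}{\partial n_e}\},[v]\rangle_e+\langle[u],\{\tfrac{\partial v}{\partial n_e}\}\rangle_e\Big)+\mathbf{i}\big(J_0(u,v)+J_1(u,v)+L_1(u,v)\big),$$ $$J_0(u,v)=\sum_{e\in\mathcal{E}_h^{ID}}\frac{\gamma_{0,e}}{h_e}\langle[u],[v]\rangle_e,\quad J_1(u,v)=\sum_{e\in\mathcal{E}_h^I}\gamma_{1,e}h_e\langle[\tfrac{\partial u}{\partial n_e}],[\tfrac{\partial v}{\partial n_e}]\rangle_e,\quad L_1(u,v)=\sum_{e\in\mathcal{E}_h^{ID}}\sum_{j=1}^{d-1}\frac{\beta_{1,e}}{h_e}\langle[\tfrac{\partial u}{\partial\tau_e^j}],[\tfrac{\partial v}{\partial\tau_e^j}]\rangle_e.$$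 Norm: $\|v\|_{1,h}^2=\sum_K\|\nabla v\|_{L^2(K)}^2+J_0(v,v)+J_1(v,v)+L_1(v,v)$. $A\lesssim B$ means $A\le CB$ with $C>0$ independent of $h$, $k$, the penalty parameters, $f$, $g$ (it may depend on the domain, $d$ and the minimal angle). A maximum over an empty set is $0$. *)

theory Defs
  imports "HOL-Analysis.Analysis"
begin

section \<open>Domains\<close>

definition polyhedral_set :: "(real^'n) set \<Rightarrow> bool" where
  "polyhedral_set S \<longleftrightarrow>
     (\<exists>F. finite F \<and> (\<forall>P\<in>F. polytope P \<and> interior P \<noteq> {}) \<and> S = \<Union>F)"

text \<open>The regularity condition \<open>interior (closure \<Omega>) = \<Omega>\<close> excludes slits and punctures.\<close>

definition polyhedral_domain :: "(real^'n) set \<Rightarrow> bool" where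
  "polyhedral_domain \<Omega> \<longleftrightarrow>
     open \<Omega> \<and> connected \<Omega> \<and> bounded \<Omega> \<and> \<Omega> \<noteq> {} \<and>
     interior (closure \<Omega>) = \<Omega> \<and> polyhedral_set (closure \<Omega>)"

text \<open>
  \<open>n\<close> is the unit outward normal to \<open>S\<close> at \<open>x\<close>. For polyhedral \<open>S\<close> it exists exactly at those
  boundary points near which \<open>S\<close> is, up to its boundary, a half space; that is, everywhere on the
  boundary except on a set of surface measure zero.
\<close>

definition outward_normal :: "(real^'n) set \<Rightarrow> real^'n \<Rightarrow> real^'n \<Rightarrow> bool" where
  "outward_normal S x n \<longleftrightarrow>
     norm n = 1 \<and> (\<exists>r>0. \<forall>y\<in>ball x r. y \<in> closure S \<longleftrightarrow> n \<bullet> (y - x) \<le> 0)"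

text \<open>
  The scatterer \<open>D\<close> is compact (possibly empty) and lies in the open set \<open>\<Omega>\<^sub>1\<close>, so \<open>\<Omega>\<^sub>1 - D\<close> is open
  and its boundary is the disjoint union of \<open>frontier \<Omega>\<^sub>1\<close> and \<open>frontier D\<close>.
\<close>

definition scattering_domain ::
    "(real^'n) set \<Rightarrow> (real^'n) set \<Rightarrow> real^'n \<Rightarrow> real \<Rightarrow> real \<Rightarrow> bool" where
  "scattering_domain \<Omega>\<^sub>1 D x\<^sub>0 c\<^sub>\<Omega> c\<^sub>D \<longleftrightarrow>
     polyhedral_domain \<Omega>\<^sub>1 \<and> polyhedral_set D \<and> D \<subseteq> \<Omega>\<^sub>1 \<and> c\<^sub>\<Omega> > 0 \<and> c\<^sub>D \<ge> 0 \<and>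
     (\<forall>x\<in>frontier \<Omega>\<^sub>1. \<forall>n. outward_normal (\<Omega>\<^sub>1 - D) x n \<longrightarrow> (x - x\<^sub>0) \<bullet> n \<ge> c\<^sub>\<Omega>) \<and>
     (\<forall>x\<in>frontier D. \<forall>n. outward_normal D x n \<longrightarrow> (x - x\<^sub>0) \<bullet> n \<ge> c\<^sub>D)"

section \<open>Meshes\<close>

definition mesh :: "(real^'n) set set \<Rightarrow> (real^'n) set \<Rightarrow> bool" where
  "mesh \<T> \<Omega> \<longleftrightarrow>
     triangulation \<T> \<and> (\<forall>K\<in>\<T>. (int CARD('n)) simplex K) \<and> \<Union>\<T> = closure \<Omega>"

definition outer_normal :: "(real^'n) set \<Rightarrow> (real^'n) set \<Rightarrow> real^'n" where
  "outer_normal K e = (THE n. norm n = 1 \<and> (\<forall>x\<in>e. \<forall>y\<in>K. n \<bullet> (y - x) \<le> 0))"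

definition angle_between :: "real^'n \<Rightarrow> real^'n \<Rightarrow> real" where
  "angle_between u v = arccos ((u \<bullet> v) / (norm u * norm v))"

text \<open>
  All angles of the simplex \<open>K\<close> are at least \<open>\<theta>\<close>: the plane angles at its vertices (for a
  tetrahedron, those of its triangular faces) and the interior dihedral angles between its
  facets. For a triangle the two families of angles coincide. For a tetrahedron both are needed,
  since either one alone can stay bounded below while the tetrahedron degenerates.
\<close>

definition min_angle :: "real \<Rightarrow> (real^'n) set \<Rightarrow> bool" where
  "min_angle \<theta> K \<longleftrightarrow>
     (\<forall>p q r. p extreme_point_of K \<and> q extreme_point_of K \<and> r extreme_point_of K \<and>
        p \<noteq> q \<and> p \<noteq> r \<and> q \<noteq> r \<longrightarrow> angle_between (q - p) (r - p) \<ge> \<theta>) \<and>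
     (\<forall>e e'. e facet_of K \<and> e' facet_of K \<and> e \<noteq> e' \<longrightarrow>
        pi - angle_between (outer_normal K e) (outer_normal K e') \<ge> \<theta>)"

definition interior_faces :: "(real^'n) set set \<Rightarrow> (real^'n) set set" where
  "interior_faces \<T> =
     {e. \<exists>K\<in>\<T>. \<exists>K'\<in>\<T>. K \<noteq> K' \<and> e = K \<inter> K' \<and> e facet_of K \<and> e facet_of K'}"

definition faces_on :: "(real^'n) set set \<Rightarrow> (real^'n) set \<Rightarrow> (real^'n) set set" where
  "faces_on \<T> \<Gamma> = {e. (\<exists>K\<in>\<T>. e facet_of K) \<and> e \<subseteq> \<Gamma>}"

text \<open>
  \<open>cell_hi\<close> and \<open>cell_lo\<close> are the cells with facet \<open>e\<close> of largest and of smallest label (\<open>lab\<close> is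
  the global labelling). There are two cells if \<open>e\<close> is interior; for a boundary face both
  functions give the only cell containing \<open>e\<close>, and \<open>face_normal\<close> is the outward normal
  of the domain.
\<close>

definition cell_hi ::
    "(real^'n) set set \<Rightarrow> ((real^'n) set \<Rightarrow> nat) \<Rightarrow> (real^'n) set \<Rightarrow> (real^'n) set" where
  "cell_hi \<T> lab e = arg_max_on lab {K\<in>\<T>. e facet_of K}"

definition cell_lo ::
    "(real^'n) set set \<Rightarrow> ((real^'n) set \<Rightarrow> nat) \<Rightarrow> (real^'n) set \<Rightarrow> (real^'n) set" where
  "cell_lo \<T> lab e = arg_min_on lab {K\<in>\<T>. e facet_of K}"

definition face_normal ::
    "(real^'n) set set \<Rightarrow> ((real^'n) set \<Rightarrow> nat) \<Rightarrow> (real^'n) set \<Rightarrow> real^'n" where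
  "face_normal \<T> lab e = outer_normal (cell_hi \<T> lab e) e"

definition tangent_frame :: "(real^'n) set \<Rightarrow> (nat \<Rightarrow> real^'n) \<Rightarrow> bool" where
  "tangent_frame e t \<longleftrightarrow>
     (\<forall>i\<in>{1..CARD('n)-1}. \<forall>j\<in>{1..CARD('n)-1}. t i \<bullet> t j = (if i = j then 1 else 0)) \<and>
     (\<forall>j\<in>{1..CARD('n)-1}. \<forall>x\<in>e. x + t j \<in> affine hull e)"

section \<open>Square-integrable functions on cells and faces\<close>

text \<open>
  Surface measure on a flat face \<open>e\<close>. Over \<open>e\<close> one erects the right cylinder of height 1, i.e. the
  points whose orthogonal projection to the hyperplane of \<open>e\<close> lies in \<open>e\<close> and whose distance from
  it is at most 1/2. Projecting the Lebesgue measure of the cylinder to the hyperplane gives, by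
  Fubini, the \<open>(d-1)\<close>-dimensional Lebesgue measure on \<open>e\<close>.
\<close>

definition face_measure :: "(real^'n) set \<Rightarrow> (real^'n) measure" where
  "face_measure e = completion (distr
     (restrict_space lborel
        {x. closest_point (affine hull e) x \<in> e \<and> dist x (closest_point (affine hull e) x) \<le> 1/2})
     borel (closest_point (affine hull e)))"

definition L2_fun :: "'a measure \<Rightarrow> ('a \<Rightarrow> complex) \<Rightarrow> bool" where
  "L2_fun M u \<longleftrightarrow> u \<in> borel_measurable M \<and> integrable M (\<lambda>x. (norm (u x))\<^sup>2)"

definition L2_inner :: "'a measure \<Rightarrow> ('a \<Rightarrow> complex) \<Rightarrow> ('a \<Rightarrow> complex) \<Rightarrow> complex" where
  "L2_inner M u v = (LINT x|M. u x * cnj (v x))"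

definition L2_inner_vec ::
    "'a measure \<Rightarrow> ('a \<Rightarrow> complex^'n) \<Rightarrow> ('a \<Rightarrow> complex^'n) \<Rightarrow> complex" where
  "L2_inner_vec M u v = (LINT x|M. (\<Sum>i\<in>UNIV. u x $ i * cnj (v x $ i)))"

definition L2_norm :: "'a measure \<Rightarrow> ('a \<Rightarrow> 'b::real_normed_vector) \<Rightarrow> real" where
  "L2_norm M u = sqrt (LINT x|M. (norm (u x))\<^sup>2)"

section \<open>Piecewise functions\<close>

text \<open>
  A piecewise function on \<open>\<T>\<close> is a family \<open>v\<close> with \<open>v K\<close> the piece on the cell \<open>K\<close>. The pieces
  used below are polynomials, stored as functions on the whole space, so that traces of \<open>v K\<close> and
  of its gradient on the faces of \<open>K\<close> are plain restrictions.
\<close>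

type_synonym 'n pw = "(real^'n) set \<Rightarrow> real^'n \<Rightarrow> complex"

definition P1 :: "(real^'n \<Rightarrow> complex) set" where
  "P1 = {p. \<exists>c a. p = (\<lambda>x. c + (\<Sum>i\<in>UNIV. a i * of_real (x $ i)))}"

definition Vh :: "(real^'n) set set \<Rightarrow> 'n pw set" where
  "Vh \<T> = {v. \<forall>K\<in>\<T>. v K \<in> P1}"

definition grad :: "(real^'n \<Rightarrow> complex) \<Rightarrow> real^'n \<Rightarrow> complex^'n" where
  "grad v x = (\<chi> i. frechet_derivative v (at x) (axis i 1))"

definition pw_deriv :: "real^'n \<Rightarrow> 'n pw \<Rightarrow> 'n pw" where
  "pw_deriv w v = (\<lambda>K x. \<Sum>i\<in>UNIV. grad (v K) x $ i * of_real (w $ i))"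

definition jump ::
    "(real^'n) set set \<Rightarrow> ((real^'n) set \<Rightarrow> nat) \<Rightarrow> 'n pw \<Rightarrow> (real^'n) set \<Rightarrow> real^'n \<Rightarrow> complex" where
  "jump \<T> lab v e =
     (if e \<in> interior_faces \<T> then (\<lambda>x. v (cell_hi \<T> lab e) x - v (cell_lo \<T> lab e) x)
      else v (cell_hi \<T> lab e))"

definition avg ::
    "(real^'n) set set \<Rightarrow> ((real^'n) set \<Rightarrow> nat) \<Rightarrow> 'n pw \<Rightarrow> (real^'n) set \<Rightarrow> real^'n \<Rightarrow> complex" where
  "avg \<T> lab v e =
     (if e \<in> interior_faces \<T> then (\<lambda>x. (v (cell_hi \<T> lab e) x + v (cell_lo \<T> lab e) x) / 2)
      else v (cell_hi \<T> lab e))"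

definition cells_inner :: "(real^'n) set set \<Rightarrow> 'n pw \<Rightarrow> 'n pw \<Rightarrow> complex" where
  "cells_inner \<T> u v = (\<Sum>K\<in>\<T>. L2_inner (lebesgue_on K) (u K) (v K))"

definition cells_norm :: "(real^'n) set set \<Rightarrow> 'n pw \<Rightarrow> real" where
  "cells_norm \<T> u = sqrt (\<Sum>K\<in>\<T>. (L2_norm (lebesgue_on K) (u K))\<^sup>2)"

text \<open>
  The \<open>L\<^sup>2\<close> structure on a boundary part \<open>\<Gamma>\<close>, which is tiled by the faces in \<open>faces_on \<T> \<Gamma>\<close>.
  \<open>bdry\<close> is the trace of a piecewise function; a single function \<open>g\<close> on \<open>\<Gamma>\<close> is the constant family
  \<open>\<lambda>_. g\<close>.
\<close>

definition bdry :: "(real^'n) set set \<Rightarrow> ((real^'n) set \<Rightarrow> nat) \<Rightarrow> 'n pw \<Rightarrow> 'n pw" where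
  "bdry \<T> lab v = (\<lambda>e. v (cell_hi \<T> lab e))"

definition bdry_L2 :: "(real^'n) set set \<Rightarrow> (real^'n) set \<Rightarrow> (real^'n \<Rightarrow> complex) \<Rightarrow> bool" where
  "bdry_L2 \<T> \<Gamma> g \<longleftrightarrow> (\<forall>e\<in>faces_on \<T> \<Gamma>. L2_fun (face_measure e) g)"

definition bdry_inner ::
    "(real^'n) set set \<Rightarrow> (real^'n) set \<Rightarrow> 'n pw \<Rightarrow> 'n pw \<Rightarrow> complex" where
  "bdry_inner \<T> \<Gamma> u v = (\<Sum>e\<in>faces_on \<T> \<Gamma>. L2_inner (face_measure e) (u e) (v e))"

definition bdry_norm :: "(real^'n) set set \<Rightarrow> (real^'n) set \<Rightarrow> (real^'n \<Rightarrow> complex) \<Rightarrow> real" where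
  "bdry_norm \<T> \<Gamma> g = sqrt (\<Sum>e\<in>faces_on \<T> \<Gamma>. (L2_norm (face_measure e) g)\<^sup>2)"

section \<open>The IPDG forms\<close>

text \<open>
  In what follows \<open>\<Gamma>D\<close> is the boundary of the scatterer, \<open>\<tau> e\<close> the tangent frame of the face \<open>e\<close>,
  and \<open>\<gamma>0\<close>, \<open>\<gamma>1\<close>, \<open>\<beta>1\<close> the penalty parameters.
\<close>

definition faces_ID :: "(real^'n) set set \<Rightarrow> (real^'n) set \<Rightarrow> (real^'n) set set" where
  "faces_ID \<T> \<Gamma>D = interior_faces \<T> \<union> faces_on \<T> \<Gamma>D"

definition J0 where
  "J0 \<T> lab \<Gamma>D (\<gamma>0 :: (real^'n::finite) set \<Rightarrow> real) (u :: 'n::finite pw) (v :: 'n pw) =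
     (\<Sum>e\<in>faces_ID \<T> \<Gamma>D. of_real (\<gamma>0 e / diameter e) *
        L2_inner (face_measure e) (jump \<T> lab u e) (jump \<T> lab v e))"

definition J1 where
  "J1 \<T> lab (\<gamma>1 :: (real^'n::finite) set \<Rightarrow> real) (u :: 'n::finite pw) (v :: 'n pw) =
     (\<Sum>e\<in>interior_faces \<T>. of_real (\<gamma>1 e * diameter e) *
        L2_inner (face_measure e)
          (jump \<T> lab (pw_deriv (face_normal \<T> lab e) u) e)
          (jump \<T> lab (pw_deriv (face_normal \<T> lab e) v) e))"

definition L1 where
  "L1 \<T> lab \<Gamma>D (\<tau> :: (real^'n::finite) set \<Rightarrow> nat \<Rightarrow> real^'n) \<beta>1 (u :: 'n::finite pw) (v :: 'n pw) =
     (\<Sum>e\<in>faces_ID \<T> \<Gamma>D. \<Sum>j\<in>{1..CARD('n)-1}. of_real (\<beta>1 e / diameter e) *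
        L2_inner (face_measure e)
          (jump \<T> lab (pw_deriv (\<tau> e j) u) e)
          (jump \<T> lab (pw_deriv (\<tau> e j) v) e))"

definition a_h where
  "a_h \<T> lab \<Gamma>D \<tau> \<gamma>0 \<gamma>1 \<beta>1 (u :: 'n::finite pw) (v :: 'n pw) =
     (\<Sum>K\<in>\<T>. L2_inner_vec (lebesgue_on K) (grad (u K)) (grad (v K)))
     - (\<Sum>e\<in>faces_ID \<T> \<Gamma>D.
          L2_inner (face_measure e)
            (avg \<T> lab (pw_deriv (face_normal \<T> lab e) u) e) (jump \<T> lab v e)
        + L2_inner (face_measure e)
            (jump \<T> lab u e) (avg \<T> lab (pw_deriv (face_normal \<T> lab e) v) e))
     + \<i> * (J0 \<T> lab \<Gamma>D \<gamma>0 u v + J1 \<T> lab \<gamma>1 u v + L1 \<T> lab \<Gamma>D \<tau> \<beta>1 u v)"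

definition norm_1h where
  "norm_1h \<T> lab \<Gamma>D \<tau> \<gamma>0 \<gamma>1 \<beta>1 (v :: 'n::finite pw) =
     sqrt ((\<Sum>K\<in>\<T>. (L2_norm (lebesgue_on K) (grad (v K)))\<^sup>2)
       + Re (J0 \<T> lab \<Gamma>D \<gamma>0 v v) + Re (J1 \<T> lab \<gamma>1 v v) + Re (L1 \<T> lab \<Gamma>D \<tau> \<beta>1 v v))"

text \<open>
  The IPDG scheme with impedance boundary \<open>\<Gamma>R\<close>. The source \<open>f\<close> is a function on \<open>\<Omega>\<close>, and
  \<open>(f, v\<^sub>h)\<close> is the sum of its contributions from the cells.
\<close>

definition ipdg_solution where
  "ipdg_solution \<T> lab \<Gamma>R \<Gamma>D \<tau> \<gamma>0 \<gamma>1 \<beta>1 k (f :: real^'n::finite \<Rightarrow> complex) (g :: real^'n \<Rightarrow> complex)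
      (u :: 'n::finite pw) \<longleftrightarrow>
     u \<in> Vh \<T> \<and>
     (\<forall>v\<in>Vh \<T>.
        a_h \<T> lab \<Gamma>D \<tau> \<gamma>0 \<gamma>1 \<beta>1 u v - of_real (k\<^sup>2) * cells_inner \<T> u v
          + \<i> * of_real k * bdry_inner \<T> \<Gamma>R (bdry \<T> lab u) (bdry \<T> lab v)
        = cells_inner \<T> (\<lambda>_. f) v + bdry_inner \<T> \<Gamma>R (\<lambda>_. g) (bdry \<T> lab v))"

definition max_over :: "'a set \<Rightarrow> ('a \<Rightarrow> real) \<Rightarrow> real" where
  "max_over A f = (if A = {} then 0 else Max (f ` A))"

end

theory Submission
  imports Defs
begin

text \<open>
  On each cell the discrete solution is affine, so its gradient is constant. The radial field
  \<open>v = (x - x\<^sub>0) \<bullet> \<nabla>u\<close> is therefore again piecewise affine: it is an admissible test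
  function, and \<open>\<nabla>v = \<nabla>u\<close> on every cell. The proof is Rellich's argument with this test
  function. Testing with \<open>u\<close> itself shows, in the imaginary part, that the data control the three
  penalty terms and \<open>k \<parallel>u\<parallel>\<^sup>2\<close> on the outer boundary, and, in the real part, that
  \<open>\<parallel>\<nabla>u\<parallel>\<^sup>2\<close> and \<open>k\<^sup>2 \<parallel>u\<parallel>\<^sup>2\<close> differ by consistency terms only (\<open>energy_identities\<close>). Testing
  with \<open>v\<close> and integrating by parts on each cell (\<open>cell_rellich\<close>) expresses the volume terms by
  integrals over faces. The outcome is \<open>rellich_inequality\<close>, which bounds \<open>k\<^sup>2 \<parallel>u\<parallel>\<^sup>2\<close>.
  
  The face integrals are of three kinds. On the two parts of the boundary the factor
  \<open>(x - x\<^sub>0) \<bullet> n\<close>, constant on each flat face, has a sign by the star-shape condition, and the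
  boundary terms of the estimate appear with a good sign. On an interior face the products of
  normal derivatives cancel (\<open>jump_flux_bound\<close>); every term that is left contains a jump of a
  tangential derivative, which \<open>L1\<close> penalises. All other terms are products of a trace and of a
  penalised jump. The trace inequality costs \<open>h\<^sup>-\<^sup>1\<^sup>/\<^sup>2\<close>, the penalty weight returns a power of \<open>h\<close>,
  and what remains are exactly the quotients of parameters in the bound for the constant. Since
  \<open>\<nabla>v = \<nabla>u\<close>, the forms \<open>J1\<close> and \<open>L1\<close> take real values at \<open>(u, v)\<close> and drop out of the real part.
  The resulting inequalities between a few real numbers are closed in \<open>energy_closure\<close>.
  
  Two facts about a simplex carry the analysis: the divergence theorem for \<open>|p|\<^sup>2\<close> times a radial
  field, and the trace inequality for affine \<open>p\<close>. Both follow from one formula for integrals over a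
  cone (\<open>integral_cone\<close>), applied to the simplex as a cone over one of its facets. It gives the
  divergence theorem for fields centred at a vertex, and both sides are affine in the centre. It gives
  the trace inequality with the height of the simplex over the facet, which the minimal angle
  condition compares with the diameter of the facet (\<open>height_ge_diameter\<close>).
  
  On the side of the mesh, each facet of a cell either separates exactly two cells, with opposite
  outward normals, or lies in exactly one of the two parts of the boundary
  (\<open>interior_face_cells\<close>, \<open>boundary_face_cases\<close>), where the outward normal of the cell is that of the
  domain.
\<close>

section \<open>Change of variables\<close>

text \<open>
  An orthogonal change of coordinates moves \<open>n\<close> to a coordinate axis. The matrix then differs from
  a multiple of the identity in a single column, and Cramer's rule gives its determinant.
\<close>

lemma det_scaling_plus_rank_one:
  fixes a n :: "real^'m::finite"
  assumes n: "norm n = 1" and c: "c \<noteq> 0"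
  shows "det (matrix (\<lambda>w. c *\<^sub>R w + (w \<bullet> n) *\<^sub>R a)) = c ^ (CARD('m) - 1) * (c + a \<bullet> n)"
proof -
  let ?f = "\<lambda>w. c *\<^sub>R w + (w \<bullet> n) *\<^sub>R a"
  obtain k :: 'm where True by simp
  obtain Q where Q: "orthogonal_transformation Q" "Q (axis k (1::real)) = n"
    using orthogonal_transformation_exists_1[of "axis k 1" n] n by auto
  define q where "q = inv Q"
  have bijQ: "bij Q" using Q(1) by (rule orthogonal_transformation_bij)
  have q: "orthogonal_transformation q" unfolding q_def using Q(1) by (rule orthogonal_transformation_inv)
  have Qq: "Q (q x) = x" "q (Q x) = x" for x
    using bijQ by (auto simp: q_def bij_is_surj surj_f_inv_f bij_is_inj)
  have linQ: "linear Q" "linear q" using Q(1) q by (auto intro: orthogonal_transformation_linear)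
  have linf: "linear ?f"
    by (auto intro!: linearI simp: algebra_simps inner_simps)
  define b where "b = q a"
  have Qdot: "Q x \<bullet> Q y = x \<bullet> y" for x y using Q(1) by (simp add: orthogonal_transformation_def)
  have conj: "(q \<circ> ?f \<circ> Q) w = c *\<^sub>R w + (w $ k) *\<^sub>R b" for w
  proof -
    have "Q w \<bullet> n = w \<bullet> axis k 1" using Q(2) Qdot by metis
    then have "Q w \<bullet> n = w $ k" by (simp add: inner_axis)
    then show ?thesis using linQ(2) by (simp add: linear_add linear_cmul Qq b_def)
  qed
  have linqf: "linear (q \<circ> ?f)" by (intro linear_compose linf linQ)
  have lin2: "linear (q \<circ> ?f \<circ> Q)" using linqf linQ(1) linear_compose by blast
  have "det (matrix (q \<circ> ?f \<circ> Q)) = det (matrix q) * det (matrix ?f) * det (matrix Q)"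
    using matrix_compose[OF linQ(1) linqf] matrix_compose[OF linf linQ(2)] by (simp add: det_mul)
  also have "\<dots> = det (matrix ?f) * det (matrix (q \<circ> Q))"
    using matrix_compose[OF linQ] by (simp add: det_mul)
  also have "q \<circ> Q = id" using Qq by auto
  finally have 1: "det (matrix ?f) = det (matrix (q \<circ> ?f \<circ> Q))" by (simp only: matrix_id_mat_1 det_I mult_1_right)
  define A :: "real^'m^'m" where "A = mat c"
  define x where "x = axis k 1 + (1/c) *\<^sub>R b"
  have "matrix (q \<circ> ?f \<circ> Q) = (\<chi> i j. if j = k then (A *v x) $ i else A $ i $ j)"
  proof -
    have "matrix (q \<circ> ?f \<circ> Q) $ i $ j = (\<chi> i j. if j = k then (A *v x) $ i else A $ i $ j) $ i $ j" for i j
    proof -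
      have Ax: "A *v x = c *\<^sub>R x"
        by (simp add: A_def vec_eq_iff matrix_vector_mult_def mat_def if_distrib if_distribR cong: if_cong)
      have "matrix (q \<circ> ?f \<circ> Q) $ i $ j = (q \<circ> ?f \<circ> Q) (axis j 1) $ i" by (simp add: matrix_def)
      also have "\<dots> = (c *\<^sub>R axis j 1 + (axis j 1 $ k) *\<^sub>R b) $ i" unfolding conj ..
      finally show ?thesis
        using c unfolding Ax by (auto simp: x_def A_def mat_def axis_def algebra_simps)
    qed
    then show ?thesis by (simp add: vec_eq_iff)
  qed
  then have "det (matrix (q \<circ> ?f \<circ> Q)) = x $ k * det A" using cramer_lemma[of k A x] by simp
  moreover have "det A = c ^ CARD('m)"
    by (simp add: A_def mat_def det_diagonal)
  moreover have "x $ k = 1 + (a \<bullet> n) / c"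
  proof -
    have "b $ k = b \<bullet> axis k 1" by (simp add: inner_axis)
    also have "\<dots> = Q b \<bullet> n" using Qdot Q(2) by metis
    finally show ?thesis by (simp add: x_def b_def Qq)
  qed
  moreover have "c ^ CARD('m) = c * c ^ (CARD('m) - 1)"
    by (metis One_nat_def Suc_pred power_Suc zero_less_card_finite)
  ultimately have "det (matrix ?f) = (1 + (a \<bullet> n) / c) * (c * c ^ (CARD('m) - 1))" using 1 by simp
  also have "\<dots> = c ^ (CARD('m) - 1) * (c + a \<bullet> n)" using c by (simp add: field_simps)
  finally show ?thesis .
qed

lemma real_change_of_variables:
  fixes f :: "real^'m::{finite,wellorder} \<Rightarrow> real" and g :: "real^'m::_ \<Rightarrow> real^'m::_"
  assumes "S \<in> sets lebesgue"
    and "\<And>x. x \<in> S \<Longrightarrow> (g has_derivative g' x) (at x within S)"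
    and "inj_on g S" and f: "f absolutely_integrable_on (g ` S)"
  shows "(\<lambda>x. \<bar>det (matrix (g' x))\<bar> * f (g x)) absolutely_integrable_on S"
    and "integral S (\<lambda>x. \<bar>det (matrix (g' x))\<bar> * f (g x)) = integral (g ` S) f"
proof -
  define F :: "real^'m::{finite,wellorder} \<Rightarrow> real^1" where "F = (\<lambda>x. vec (f x))"
  have bl: "bounded_linear (vec :: real \<Rightarrow> real^1)" 
    by (intro linear_conv_bounded_linear[THEN iffD1] linearI) (auto simp: vec_eq_iff)
  have bl2: "bounded_linear (\<lambda>x::real^1. x $ 1)" by (rule bounded_linear_vec_nth)
  have F: "F absolutely_integrable_on (g ` S)"
    using absolutely_integrable_linear[OF f bl] by (simp add: F_def o_def)
  from has_absolute_integral_change_of_variables[OF assms(1-3), of F "integral (g ` S) F"] F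
  have *: "(\<lambda>x. \<bar>det (matrix (g' x))\<bar> *\<^sub>R F (g x)) absolutely_integrable_on S"
     "integral S (\<lambda>x. \<bar>det (matrix (g' x))\<bar> *\<^sub>R F (g x)) = integral (g ` S) F" by auto
  show "(\<lambda>x. \<bar>det (matrix (g' x))\<bar> * f (g x)) absolutely_integrable_on S"
    using absolutely_integrable_linear[OF *(1) bl2] by (simp add: F_def o_def)
  have "integral S (\<lambda>x. \<bar>det (matrix (g' x))\<bar> * f (g x)) = integral S (\<lambda>x. \<bar>det (matrix (g' x))\<bar> *\<^sub>R F (g x)) $ 1"
    using integral_linear[OF set_lebesgue_integral_eq_integral(1)[OF *(1)] bl2] by (simp add: F_def o_def)
  also have "\<dots> = integral (g ` S) F $ 1" by (simp add: *(2))
  also have "\<dots> = integral (g ` S) f"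
    using integral_linear[OF set_lebesgue_integral_eq_integral(1)[OF F] bl2] by (simp add: F_def o_def)
  finally show "integral S (\<lambda>x. \<bar>det (matrix (g' x))\<bar> * f (g x)) = integral (g ` S) f" .
qed

section \<open>Integrals over a cone\<close>

definition hyper_proj :: "real^'n \<Rightarrow> real \<Rightarrow> real^'n \<Rightarrow> real^'n" where
  "hyper_proj n b x = x - (n \<bullet> x - b) *\<^sub>R n"

text \<open>
  For a face \<open>e\<close> in the hyperplane \<open>n \<bullet> x = b\<close> this is the cylinder from which
  \<open>face_measure e\<close> is projected (\<open>face_measure_hyperplane\<close>).
\<close>

definition unit_cylinder :: "real^'n \<Rightarrow> real \<Rightarrow> (real^'n) set \<Rightarrow> (real^'n) set" where
  "unit_cylinder n b e = {x. hyper_proj n b x \<in> e \<and> \<bar>n \<bullet> x - b\<bar> \<le> 1/2}"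

lemma hyper_proj_on:
  assumes "norm n = 1"
  shows "n \<bullet> hyper_proj n b x = b" "hyper_proj n b (hyper_proj n b x + c *\<^sub>R n) = hyper_proj n b x"
    "n \<bullet> (hyper_proj n b x + c *\<^sub>R n) = b + c"
    "hyper_proj n b x + (n \<bullet> x - b) *\<^sub>R n = x"
  using assms by (auto simp: hyper_proj_def inner_simps norm_eq_1 algebra_simps)

lemma continuous_on_hyper_proj [continuous_intros]:
  "continuous_on S f \<Longrightarrow> continuous_on S (\<lambda>x. hyper_proj n b (f x))"
  unfolding hyper_proj_def by (intro continuous_intros)

lemma has_derivative_hyper_proj:
  "(hyper_proj n b has_derivative (\<lambda>w. w - (n \<bullet> w) *\<^sub>R n)) (at x within S)"
  unfolding hyper_proj_def[abs_def] by (auto intro!: derivative_eq_intros)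

lemma compact_unit_cylinder:
  assumes n: "norm n = 1" and e: "compact e"
  shows "compact (unit_cylinder n b e)"
proof -
  have "closed (unit_cylinder n b e)"
  proof -
    have "unit_cylinder n b e = hyper_proj n b -` e \<inter> {x. \<bar>n \<bullet> x - b\<bar> \<le> 1/2}"
      by (auto simp: unit_cylinder_def)
    moreover have "closed (hyper_proj n b -` e)"
      by (intro closed_vimage compact_imp_closed e continuous_intros)
    moreover have "closed {x. \<bar>n \<bullet> x - b\<bar> \<le> 1/2}"
      by (intro closed_Collect_le continuous_intros)
    ultimately show ?thesis by auto
  qed
  moreover have "bounded (unit_cylinder n b e)"
  proof -
    obtain R where R: "\<And>x. x \<in> e \<Longrightarrow> norm x \<le> R" using compact_imp_bounded[OF e] bounded_iff by blast
    have "norm x \<le> R + 1/2" if "x \<in> unit_cylinder n b e" for x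
    proof -
      have "norm x \<le> norm (hyper_proj n b x) + norm ((n \<bullet> x - b) *\<^sub>R n)"
        by (metis hyper_proj_on(4)[OF n] norm_triangle_ineq)
      also have "\<dots> \<le> R + 1/2" using that R n by (intro add_mono) (auto simp: unit_cylinder_def)
      finally show ?thesis .
    qed
    then show ?thesis by (auto simp: bounded_iff)
  qed
  ultimately show ?thesis using compact_eq_bounded_closed by blast
qed

lemma absolutely_integrable_on_compact:
  fixes f :: "'a::euclidean_space \<Rightarrow> real"
  assumes "compact S" "continuous_on S f"
  shows "f absolutely_integrable_on S"
proof -
  have "integrable lborel (\<lambda>x. indicator S x *\<^sub>R f x)"
    using assms by (rule borel_integrable_compact)
  then show ?thesis unfolding set_integrable_def
    by (subst integrable_completion) (auto dest: borel_measurable_integrable)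
qed

text \<open>
  This stands in for Fubini's theorem in the direction \<open>n\<close>. Let \<open>s\<close> be the coordinate along \<open>n\<close>,
  shifted so that it runs from 0 to 1. Replacing \<open>s\<close> by its power \<open>s^(j+1)\<close>, with the projection to the
  hyperplane kept fixed, is a bijection of the cylinder up to a null set, and its Jacobian is
  \<open>(j+1) s^j\<close>.
\<close>

lemma unit_cylinder_moment:
  fixes e :: "(real^'m::{finite,wellorder}) set"
  assumes n: "norm n = 1" and e: "compact e" and g: "continuous_on UNIV g"
  shows "integral (unit_cylinder n b e) (\<lambda>x. (n \<bullet> x - b + 1/2) ^ j * g (hyper_proj n b x))
       = integral (unit_cylinder n b e) (\<lambda>x. g (hyper_proj n b x)) / real (j + 1)"
    (is "_ = integral ?C (?g::_\<Rightarrow>real) / _")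
proof -
  define s where "s = (\<lambda>x. n \<bullet> x - b + 1/2)"
  define S where "S = ?C \<inter> {x. s x > 0}"
  have contg: "continuous_on A ?g" for A
    by (intro continuous_on_compose2[OF g] continuous_intros) auto
  have conts: "continuous_on A s" for A unfolding s_def by (intro continuous_intros)
  have C: "?C \<in> sets lebesgue" using compact_unit_cylinder[OF n e] by (simp add: borel_compact)
  have "open {x. s x > 0}" by (intro open_Collect_less conts continuous_intros)
  then have Sleb: "S \<in> sets lebesgue" unfolding S_def using C by auto
  have neg: "negligible (?C - S)"
  proof (rule negligible_subset)
    show "negligible {x. n \<bullet> x = b - 1/2}"
      using n by (intro negligible_hyperplane) auto
    show "?C - S \<subseteq> {x. n \<bullet> x = b - 1/2}"
    proof
      fix x assume "x \<in> ?C - S"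
      then have "\<not> 0 < s x" "\<bar>n \<bullet> x - b\<bar> \<le> 1/2" by (auto simp: S_def unit_cylinder_def)
      then show "x \<in> {x. n \<bullet> x = b - 1/2}" by (simp add: s_def)
    qed
  qed
  have spike: "integral ?C f = integral S f" for f :: "_ \<Rightarrow> real"
    by (rule integral_spike_set; rule negligible_subset[OF neg]) (auto simp: S_def)
  define \<Phi> where "\<Phi> = (\<lambda>x. hyper_proj n b x + ((s x) ^ (j+1) - 1/2) *\<^sub>R n)"
  have \<Phi>: "hyper_proj n b (\<Phi> x) = hyper_proj n b x" "s (\<Phi> x) = s x ^ (j+1)" for x
    using hyper_proj_on[OF n] by (auto simp: \<Phi>_def s_def)
  have recov: "x = hyper_proj n b x + (s x - 1/2) *\<^sub>R n" for x
    by (simp add: s_def hyper_proj_def)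
  have s_range: "\<bar>n \<bullet> x - b\<bar> \<le> 1/2 \<and> 0 < s x \<longleftrightarrow> 0 < s x \<and> s x \<le> 1" for x
    unfolding s_def by arith
  have S_iff: "x \<in> S \<longleftrightarrow> hyper_proj n b x \<in> e \<and> 0 < s x \<and> s x \<le> 1" for x
    using s_range[of x] unfolding S_def unit_cylinder_def by blast
  have inj: "inj_on \<Phi> S"
  proof (rule inj_onI)
    fix x y assume xy: "x \<in> S" "y \<in> S" "\<Phi> x = \<Phi> y"
    then have "s x ^ (j+1) = s y ^ (j+1)" "hyper_proj n b x = hyper_proj n b y" using \<Phi> by metis+
    moreover have "s x = s y" using calculation(1) xy S_iff by (metis add_gr_0 less_imp_le power_eq_imp_eq_base zero_less_one)
    ultimately show "x = y" using recov by metis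
  qed
  have img: "\<Phi> ` S = S"
  proof
    show "\<Phi> ` S \<subseteq> S" by (auto simp: S_iff \<Phi> power_le_one mult_le_one simp del: power_Suc)
    show "S \<subseteq> \<Phi> ` S"
    proof
      fix x assume x: "x \<in> S"
      define y where "y = hyper_proj n b x + (root (j+1) (s x) - 1/2) *\<^sub>R n"
      have y: "hyper_proj n b y = hyper_proj n b x" "s y = root (j+1) (s x)"
        using hyper_proj_on[OF n] by (auto simp: y_def s_def)
      have "y \<in> S" using x by (auto simp: S_iff y)
      moreover have "\<Phi> y = x" using x by (subst (2) recov) (simp add: \<Phi>_def y S_iff real_root_pow_pos del: power_Suc)
      ultimately show "x \<in> \<Phi> ` S" by force
    qed
  qed
  define \<Phi>' where "\<Phi>' = (\<lambda>x w. 1 *\<^sub>R w + (w \<bullet> n) *\<^sub>R ((real (j+1) * s x ^ j - 1) *\<^sub>R n))"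
  have der: "(\<Phi> has_derivative \<Phi>' x) (at x within S)" for x
    unfolding \<Phi>_def \<Phi>'_def s_def
    by (rule derivative_eq_intros has_derivative_hyper_proj refl)+
       (auto simp: algebra_simps inner_commute)
  have det: "det (matrix (\<Phi>' x)) = real (j+1) * s x ^ j" for x
    unfolding \<Phi>'_def by (subst det_scaling_plus_rank_one) (use n in \<open>auto simp: norm_eq_1\<close>)
  have abs: "?g absolutely_integrable_on S"
    unfolding S_def by (rule set_integrable_subset[OF absolutely_integrable_on_compact[OF compact_unit_cylinder[OF n e] contg]])
       (use Sleb S_def in auto)
  have "integral S (\<lambda>x. \<bar>det (matrix (\<Phi>' x))\<bar> * ?g (\<Phi> x)) = integral (\<Phi> ` S) ?g"
    by (rule real_change_of_variables(2)[OF Sleb der inj]) (simp add: img abs)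
  moreover have "integral S (\<lambda>x. \<bar>det (matrix (\<Phi>' x))\<bar> * ?g (\<Phi> x)) = integral S (\<lambda>x. real (j+1) * (s x ^ j * ?g x))"
    by (rule integral_cong) (simp add: det \<Phi> S_iff abs_mult)
  ultimately have "real (j+1) * integral S (\<lambda>x. s x ^ j * ?g x) = integral S ?g"
    by (simp add: img)
  then show ?thesis unfolding spike by (simp add: s_def field_simps)
qed

text \<open>
  Let \<open>p\<close> be the projection of \<open>x\<close> to the hyperplane and \<open>s\<close> the coordinate along \<open>n\<close> as above. The map
  \<open>v + s (p - v)\<close> carries the cylinder over \<open>e\<close> to the cone with apex \<open>v\<close>, and its Jacobian is \<open>\<eta>\<close>
  times \<open>s\<close> to the power \<open>d - 1\<close>. The powers of \<open>s\<close> are then integrated by \<open>unit_cylinder_moment\<close>.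
\<close>

lemma integral_cone_wellorder:
  fixes e :: "(real^'m::{finite,wellorder}) set"
  assumes n: "norm n = 1" and e: "compact e" "convex e" "e \<noteq> {}" "e \<subseteq> {x. n \<bullet> x = b}"
    and v: "n \<bullet> v = b - \<eta>" "\<eta> > 0"
    and cont: "continuous_on UNIV G" "continuous_on UNIV g0" "continuous_on UNIV g1" "continuous_on UNIV g2"
    and G: "\<And>y t. y \<in> e \<Longrightarrow> 0 \<le> t \<Longrightarrow> t \<le> 1 \<Longrightarrow> G (v + t *\<^sub>R (y - v)) = g0 y + t * g1 y + t\<^sup>2 * g2 y"
  shows "integral (convex hull (insert v e)) G = \<eta> * integral (unit_cylinder n b e)
     (\<lambda>x. g0 (hyper_proj n b x) / CARD('m) + g1 (hyper_proj n b x) / (CARD('m) + 1) + g2 (hyper_proj n b x) / (CARD('m) + 2) :: real)"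
    (is "integral ?K _ = \<eta> * integral ?C _")
proof -
  define s where "s = (\<lambda>x. n \<bullet> x - b + 1/2)"
  define p where "p = hyper_proj n b"
  define S where "S = ?C \<inter> {x. s x > 0}"
  define d where "d = CARD('m) - 1"
  have card_d: "CARD('m) = d + 1" by (simp add: d_def Suc_leI)
  have conts: "continuous_on A s" for A unfolding s_def by (intro continuous_intros)
  have C: "?C \<in> sets lebesgue" using compact_unit_cylinder[OF n e(1)] by (simp add: borel_compact)
  have "open {x. s x > 0}" by (intro open_Collect_less conts continuous_intros)
  then have Sleb: "S \<in> sets lebesgue" unfolding S_def using C by auto
  have neg: "negligible (?C - S)"
  proof (rule negligible_subset)
    show "negligible {x. n \<bullet> x = b - 1/2}"
      using n by (intro negligible_hyperplane) auto
    show "?C - S \<subseteq> {x. n \<bullet> x = b - 1/2}"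
    proof
      fix x assume "x \<in> ?C - S"
      then have "\<not> 0 < s x" "\<bar>n \<bullet> x - b\<bar> \<le> 1/2" by (auto simp: S_def unit_cylinder_def)
      then show "x \<in> {x. n \<bullet> x = b - 1/2}" by (simp add: s_def)
    qed
  qed
  have spike: "integral ?C f = integral S f" for f :: "_ \<Rightarrow> real"
    by (rule integral_spike_set; rule negligible_subset[OF neg]) (auto simp: S_def)
  have s_range: "\<bar>n \<bullet> x - b\<bar> \<le> 1/2 \<and> 0 < s x \<longleftrightarrow> 0 < s x \<and> s x \<le> 1" for x
    unfolding s_def by arith
  have S_iff: "x \<in> S \<longleftrightarrow> p x \<in> e \<and> 0 < s x \<and> s x \<le> 1" for x
    using s_range[of x] unfolding S_def unit_cylinder_def p_def by blast
  define \<Phi> where "\<Phi> = (\<lambda>x. v + s x *\<^sub>R (p x - v))"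
  have n\<Phi>: "n \<bullet> \<Phi> x = b - \<eta> + s x * \<eta>" for x
    by (simp add: \<Phi>_def inner_add_right inner_diff_right p_def hyper_proj_on(1)[OF n] v(1))
  have recov: "x = p x + (s x - 1/2) *\<^sub>R n" for x
    by (simp add: s_def hyper_proj_def p_def)
  have inj: "inj_on \<Phi> S"
  proof (rule inj_onI)
    fix x y assume xy: "x \<in> S" "y \<in> S" "\<Phi> x = \<Phi> y"
    then have s: "s x = s y" using n\<Phi>[of x] n\<Phi>[of y] v(2) by simp
    then have "s x *\<^sub>R (p x - v) = s x *\<^sub>R (p y - v)" using xy(3) by (simp add: \<Phi>_def)
    then have "p x = p y" using xy(1) S_iff by simp
    then show "x = y" using s recov by metis
  qed
  have K: "?K = {v + t *\<^sub>R (y - v) | t y. 0 \<le> t \<and> t \<le> 1 \<and> y \<in> e}"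
  proof -
    have "?K = {u *\<^sub>R v + t *\<^sub>R y | u t y. 0 \<le> u \<and> 0 \<le> t \<and> u + t = 1 \<and> y \<in> e}"
      using e by (simp add: convex_hull_insert hull_same) blast
    also have "\<dots> = {v + t *\<^sub>R (y - v) | t y. 0 \<le> t \<and> t \<le> 1 \<and> y \<in> e}"
    proof (intro set_eqI iffI; clarsimp)
      fix u t :: real and y assume "0 \<le> u" "0 \<le> t" "u + t = 1" "y \<in> e"
      then show "\<exists>ta ya. u *\<^sub>R v + t *\<^sub>R y = v + ta *\<^sub>R (ya - v) \<and> 0 \<le> ta \<and> ta \<le> 1 \<and> ya \<in> e"
        by (intro exI[of _ t] exI[of _ y]) (auto simp: algebra_simps simp flip: scaleR_add_left)
    next
      fix t :: real and y assume "0 \<le> t" "t \<le> 1" "y \<in> e"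
      then show "\<exists>u ta ya. v + t *\<^sub>R (y - v) = u *\<^sub>R v + ta *\<^sub>R ya \<and> 0 \<le> u \<and> 0 \<le> ta \<and> u + ta = 1 \<and> ya \<in> e"
        by (intro exI[of _ "1 - t"] exI[of _ t] exI[of _ y]) (auto simp: algebra_simps)
    qed
    finally show ?thesis .
  qed
  have img: "\<Phi> ` S = ?K - {v}"
  proof
    show "\<Phi> ` S \<subseteq> ?K - {v}"
    proof
      fix z assume "z \<in> \<Phi> ` S"
      then obtain x where x: "x \<in> S" "z = \<Phi> x" by auto
      have "n \<bullet> z \<noteq> n \<bullet> v" using n\<Phi>[of x] x v S_iff by auto
      then have "z \<noteq> v" by auto
      moreover have "z \<in> ?K" unfolding K mem_Collect_eq
        by (intro exI[of _ "s x"] exI[of _ "p x"]) (use x S_iff[of x] in \<open>auto simp: \<Phi>_def\<close>)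
      ultimately show "z \<in> ?K - {v}" by auto
    qed
    show "?K - {v} \<subseteq> \<Phi> ` S"
    proof
      fix z assume z: "z \<in> ?K - {v}"
      then obtain t y where ty: "z = v + t *\<^sub>R (y - v)" "0 \<le> t" "t \<le> 1" "y \<in> e" unfolding K by auto
      then have "t > 0" using z by (cases "t = 0") auto
      define x where "x = y + (t - 1/2) *\<^sub>R n"
      have ny: "n \<bullet> y = b" using ty e by auto
      have "p y = y" using ny by (simp add: p_def hyper_proj_def)
      then have "p x = y" "s x = t" using hyper_proj_on(2)[OF n, of b y "t - 1/2"] ny n
        by (auto simp: x_def p_def s_def inner_simps norm_eq_1)
      then show "z \<in> \<Phi> ` S" using ty \<open>t > 0\<close> by (intro image_eqI[of _ _ x]) (auto simp: \<Phi>_def S_iff)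
    qed
  qed
  define \<Phi>' where "\<Phi>' = (\<lambda>x w. s x *\<^sub>R w + (w \<bullet> n) *\<^sub>R (p x - v - s x *\<^sub>R n))"
  have der: "(\<Phi> has_derivative \<Phi>' x) (at x within S)" for x
    unfolding \<Phi>_def \<Phi>'_def s_def p_def
    by (rule derivative_eq_intros has_derivative_hyper_proj refl)+
       (auto simp: algebra_simps inner_commute)
  have det: "\<bar>det (matrix (\<Phi>' x))\<bar> = s x ^ d * \<eta>" if "x \<in> S" for x
  proof -
    have "s x > 0" using that S_iff by auto
    moreover have "(p x - v - s x *\<^sub>R n) \<bullet> n = \<eta> - s x"
      using hyper_proj_on(1)[OF n, of b x] v n
      by (simp add: inner_simps p_def inner_commute norm_eq_1)
    ultimately show ?thesis unfolding \<Phi>'_def using v(2)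
      by (subst det_scaling_plus_rank_one) (use n in \<open>auto simp: abs_mult d_def\<close>)
  qed
  have Kc: "compact ?K" using e by (intro compact_convex_hull compact_insert)
  have absK: "G absolutely_integrable_on ?K"
    by (rule absolutely_integrable_on_compact[OF Kc continuous_on_subset[OF cont(1)]]) simp
  have abs: "G absolutely_integrable_on (\<Phi> ` S)"
    unfolding img by (rule set_integrable_subset[OF absK]) (use Kc in \<open>auto simp: borel_compact\<close>)
  have "integral ?K G = integral (\<Phi> ` S) G"
    by (rule integral_spike_set; rule negligible_subset[OF negligible_sing[of v]]) (auto simp: img)
  also have "\<dots> = integral S (\<lambda>x. \<bar>det (matrix (\<Phi>' x))\<bar> * G (\<Phi> x))"
    by (rule real_change_of_variables(2)[OF Sleb der inj abs, symmetric])
  also have "\<dots> = integral S (\<lambda>x. \<eta> * (s x ^ d * g0 (p x) + s x ^ (d+1) * g1 (p x) + s x ^ (d+2) * g2 (p x)))"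
  proof (rule integral_cong)
    fix x assume x: "x \<in> S"
    have "G (\<Phi> x) = g0 (p x) + s x * g1 (p x) + (s x)\<^sup>2 * g2 (p x)"
      unfolding \<Phi>_def by (rule G) (use x S_iff in auto)
    then show "\<bar>det (matrix (\<Phi>' x))\<bar> * G (\<Phi> x) = \<eta> * (s x ^ d * g0 (p x) + s x ^ (d+1) * g1 (p x) + s x ^ (d+2) * g2 (p x))"
      by (simp add: det[OF x] power_add power2_eq_square algebra_simps)
  qed
  also have "\<dots> = \<eta> * integral ?C (\<lambda>x. s x ^ d * g0 (p x) + s x ^ (d+1) * g1 (p x) + s x ^ (d+2) * g2 (p x))"
    by (simp add: spike)
  also have "integral ?C (\<lambda>x. s x ^ d * g0 (p x) + s x ^ (d+1) * g1 (p x) + s x ^ (d+2) * g2 (p x))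
     = integral ?C (\<lambda>x. s x ^ d * g0 (p x)) + integral ?C (\<lambda>x. s x ^ (d+1) * g1 (p x)) + integral ?C (\<lambda>x. s x ^ (d+2) * g2 (p x))"
  proof -
    have i: "(\<lambda>x. s x ^ j * g (p x)) integrable_on ?C" if "continuous_on UNIV g" for j and g :: "real^'m::{finite,wellorder} \<Rightarrow> real"
    proof -
      have "(\<lambda>x. s x ^ j * g (p x)) absolutely_integrable_on ?C"
        by (rule absolutely_integrable_on_compact[OF compact_unit_cylinder[OF n e(1)]])
          (auto intro!: continuous_intros conts continuous_on_compose2[OF that] simp: p_def)
      then show ?thesis by (rule set_lebesgue_integral_eq_integral(1))
    qed
    show ?thesis
      by (subst Henstock_Kurzweil_Integration.integral_add; (intro integrable_add i cont)?)+ simp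
  qed
  also have "\<dots> = integral ?C (\<lambda>x. g0 (p x)) / CARD('m) + integral ?C (\<lambda>x. g1 (p x)) / (CARD('m) + 1) + integral ?C (\<lambda>x. g2 (p x)) / (CARD('m) + 2)"
    using unit_cylinder_moment[OF n e(1) cont(2), of b d] unit_cylinder_moment[OF n e(1) cont(3), of b "d + 1"]
      unit_cylinder_moment[OF n e(1) cont(4), of b "d + 2"]
    by (simp add: s_def p_def card_d add_ac)
  also have "\<dots> = integral ?C (\<lambda>x. g0 (p x) / CARD('m) + g1 (p x) / (CARD('m) + 1) + g2 (p x) / (CARD('m) + 2))"
  proof -
    have i: "(\<lambda>x. g (p x) / c) integrable_on ?C" if "continuous_on UNIV g" for c and g :: "real^'m::{finite,wellorder} \<Rightarrow> real"
    proof -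
      have "(\<lambda>x. g (p x) / c) absolutely_integrable_on ?C"
        unfolding divide_inverse
        by (rule absolutely_integrable_on_compact[OF compact_unit_cylinder[OF n e(1)]])
          (auto intro!: continuous_intros conts continuous_on_compose2[OF that] simp: p_def)
      then show ?thesis by (rule set_lebesgue_integral_eq_integral(1))
    qed
    show ?thesis
      by (subst Henstock_Kurzweil_Integration.integral_add; (intro integrable_add i cont)?)+ simp
  qed
  finally show ?thesis by (simp add: p_def)
qed

section \<open>Renaming coordinates\<close>

text \<open>
  The order of the index type enters the change of variables theorem but not the cone formula: renaming
  the coordinates is an isometry and preserves Lebesgue measure, so the formula passes from the
  well-ordered index types \<open>2\<close> and \<open>3\<close> to every index type of the same size.
\<close>

definition reindex :: "('m \<Rightarrow> 'n) \<Rightarrow> real^'n \<Rightarrow> real^'m" where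
  "reindex \<sigma> x = (\<chi> i. x $ \<sigma> i)"

lemma reindex_inv:
  assumes "bij \<sigma>"
  shows "reindex (inv \<sigma>) (reindex \<sigma> x) = x" "reindex \<sigma> (reindex (inv \<sigma>) y) = y"
  using assms by (auto simp: reindex_def vec_eq_iff bij_is_surj surj_f_inv_f bij_is_inj)

lemma linear_reindex: "linear (reindex \<sigma>)"
  by (auto intro!: linearI simp: reindex_def vec_eq_iff)

lemma inner_reindex: "bij \<sigma> \<Longrightarrow> reindex \<sigma> x \<bullet> reindex \<sigma> y = x \<bullet> y"
  unfolding inner_vec_def reindex_def by (simp add: sum.reindex_bij_betw[of \<sigma> UNIV UNIV "\<lambda>i. x $ i * y $ i"])

lemma continuous_on_reindex: "continuous_on A (reindex \<sigma>)"
  by (rule linear_continuous_on[OF linear_conv_bounded_linear[THEN iffD1, OF linear_reindex]])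

lemma prod_Basis_vec: "(\<Prod>b\<in>Basis. x \<bullet> b) = (\<Prod>i\<in>UNIV. x $ i)" for x :: "real^'n"
proof -
  have B: "Basis = range (\<lambda>i::'n. axis i (1::real))" by (auto simp: Basis_vec_def)
  have "inj (\<lambda>i::'n. axis i (1::real))" by (auto simp: inj_def axis_eq_axis)
  then show ?thesis unfolding B by (subst prod.reindex) (auto simp: inner_axis)
qed

lemma lborel_reindex:
  fixes \<sigma> :: "'m::finite \<Rightarrow> 'n::finite"
  assumes bij: "bij \<sigma>"
  shows "distr lborel borel (reindex \<sigma>) = lborel"
proof (rule lborel_eqI[symmetric])
  have meas: "reindex \<sigma> \<in> borel_measurable lborel"
    using borel_measurable_continuous_onI[OF continuous_on_reindex] by simp
  fix l u :: "real^'m" assume lu: "\<And>b. b \<in> Basis \<Longrightarrow> l \<bullet> b \<le> u \<bullet> b"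
  then have lu': "l $ i \<le> u $ i" for i using lu[of "axis i 1"] by (simp add: inner_axis Basis_real_def)
  have "reindex \<sigma> -` box l u = box (reindex (inv \<sigma>) l) (reindex (inv \<sigma>) u)"
  proof (rule set_eqI)
    fix x
    have "(\<forall>i. l $ i < x $ \<sigma> i \<and> x $ \<sigma> i < u $ i) \<longleftrightarrow> (\<forall>j. l $ inv \<sigma> j < x $ j \<and> x $ j < u $ inv \<sigma> j)"
      (is "?L \<longleftrightarrow> ?R")
    proof (intro iffI allI)
      fix j assume ?L then show "l $ inv \<sigma> j < x $ j \<and> x $ j < u $ inv \<sigma> j"
        using surj_f_inv_f[OF bij_is_surj[OF bij], of j] by (auto dest: spec[of _ "inv \<sigma> j"])
    next
      fix i assume ?R then show "l $ i < x $ \<sigma> i \<and> x $ \<sigma> i < u $ i"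
        using inv_f_f[OF bij_is_inj[OF bij], of i] by (auto dest: spec[of _ "\<sigma> i"])
    qed
    then show "x \<in> reindex \<sigma> -` box l u \<longleftrightarrow> x \<in> box (reindex (inv \<sigma>) l) (reindex (inv \<sigma>) u)"
      by (simp add: mem_box_cart reindex_def)
  qed
  then have "emeasure (distr lborel borel (reindex \<sigma>)) (box l u) = emeasure lborel (box (reindex (inv \<sigma>) l) (reindex (inv \<sigma>) u))"
    by (subst emeasure_distr[OF meas]) auto
  also have "\<dots> = (\<Prod>b\<in>Basis. (reindex (inv \<sigma>) u - reindex (inv \<sigma>) l) \<bullet> b)"
    by (rule emeasure_lborel_box) (use lu' in \<open>auto simp: Basis_vec_def inner_axis reindex_def\<close>)
  also have "(\<Prod>b\<in>Basis. (reindex (inv \<sigma>) u - reindex (inv \<sigma>) l) \<bullet> b) = (\<Prod>i\<in>UNIV. (u - l) $ inv \<sigma> i)"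
    by (simp add: prod_Basis_vec reindex_def)
  also have "\<dots> = (\<Prod>i\<in>UNIV. (u - l) $ i)"
    by (rule prod.reindex_bij_betw) (rule bij_imp_bij_inv[OF bij])
  also have "\<dots> = (\<Prod>b\<in>Basis. (u - l) \<bullet> b)" by (simp only: prod_Basis_vec)
  finally show "emeasure (distr lborel borel (reindex \<sigma>)) (box l u) = (\<Prod>b\<in>Basis. (u - l) \<bullet> b)" .
qed simp

lemma integral_lborel_compact:
  fixes F :: "'a::euclidean_space \<Rightarrow> real"
  assumes "compact S" "continuous_on S F"
  shows "(LINT x|lborel. indicator S x * F x) = integral S F"
proof -
  have i: "integrable lborel (\<lambda>x. indicator S x *\<^sub>R F x)"
    using assms by (rule borel_integrable_compact)
  have "(LINT x|lborel. indicator S x *\<^sub>R F x) = (LINT x:S|lebesgue. F x)"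
    unfolding set_lebesgue_integral_def using i by (subst integral_completion) auto
  also have "\<dots> = integral S F"
    by (rule set_lebesgue_integral_eq_integral(2)[OF absolutely_integrable_on_compact[OF assms]])
  finally show ?thesis by simp
qed

lemma integral_reindex:
  fixes \<sigma> :: "'m::finite \<Rightarrow> 'n::finite" and F :: "real^'m \<Rightarrow> real"
  assumes bij: "bij \<sigma>" and S: "compact S" and F: "continuous_on UNIV F"
  shows "integral (reindex \<sigma> ` S) F = integral S (\<lambda>x. F (reindex \<sigma> x))"
proof -
  have SS: "compact (reindex \<sigma> ` S)" by (rule compact_continuous_image[OF continuous_on_reindex S])
  have inj: "reindex \<sigma> x \<in> reindex \<sigma> ` S \<longleftrightarrow> x \<in> S" for x
    by (rule inj_image_mem_iff[OF inj_on_inverseI[of _ "reindex (inv \<sigma>)"]]) (rule reindex_inv(1)[OF bij])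
  have "integral (reindex \<sigma> ` S) F = (LINT x|lborel. indicator (reindex \<sigma> ` S) x * F x)"
    by (rule integral_lborel_compact[symmetric]) (use SS continuous_on_subset[OF F, of "reindex \<sigma> ` S"] in auto)
  also have "\<dots> = (LINT x|distr lborel borel (reindex \<sigma>). indicator (reindex \<sigma> ` S) x * F x)"
    by (simp only: lborel_reindex[OF bij])
  also have "\<dots> = (LINT x|lborel. indicator (reindex \<sigma> ` S) (reindex \<sigma> x) * F (reindex \<sigma> x))"
  proof (rule integral_distr)
    show "reindex \<sigma> \<in> borel_measurable lborel"
      using borel_measurable_continuous_onI[OF continuous_on_reindex] by simp
    have [measurable]: "F \<in> borel_measurable borel" by (rule borel_measurable_continuous_onI[OF F])
    have [measurable]: "reindex \<sigma> ` S \<in> sets borel" using SS by (rule borel_compact)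
    show "(\<lambda>x. indicator (reindex \<sigma> ` S) x * F x) \<in> borel_measurable borel" by measurable
  qed
  also have "\<dots> = (LINT x|lborel. indicator S x * F (reindex \<sigma> x))"
    by (simp add: inj indicator_def)
  also have "\<dots> = integral S (\<lambda>x. F (reindex \<sigma> x))"
    by (rule integral_lborel_compact[OF S]) (auto intro!: continuous_on_compose2[OF F continuous_on_reindex])
  finally show ?thesis .
qed

lemma integral_cone_reindex:
  fixes \<sigma> :: "'m::{finite,wellorder} \<Rightarrow> 'n::finite" and e :: "(real^'n) set"
  assumes bij: "bij \<sigma>"
    and n: "norm n = 1" and e: "compact e" "convex e" "e \<noteq> {}" "e \<subseteq> {x. n \<bullet> x = b}"
    and v: "n \<bullet> v = b - \<eta>" "\<eta> > 0"
    and cont: "continuous_on UNIV G" "continuous_on UNIV g0" "continuous_on UNIV g1" "continuous_on UNIV g2"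
    and G: "\<And>y t. y \<in> e \<Longrightarrow> 0 \<le> t \<Longrightarrow> t \<le> 1 \<Longrightarrow> G (v + t *\<^sub>R (y - v)) = g0 y + t * g1 y + t\<^sup>2 * g2 y"
  shows "integral (convex hull (insert v e)) G = \<eta> * integral (unit_cylinder n b e)
     (\<lambda>x. g0 (hyper_proj n b x) / CARD('n) + g1 (hyper_proj n b x) / (CARD('n) + 1) + g2 (hyper_proj n b x) / (CARD('n) + 2) :: real)"
proof -
  define r where "r = reindex \<sigma>"
  define r' where "r' = reindex (inv \<sigma>)"
  have rr: "r' (r x) = x" "r (r' y) = y" for x y using reindex_inv[OF bij] by (auto simp: r_def r'_def)
  have injr: "r x \<in> r ` A \<longleftrightarrow> x \<in> A" for x A
    by (rule inj_image_mem_iff[OF inj_on_inverseI[of _ r']]) (rule rr(1))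
  have lin: "linear r" "linear r'" unfolding r_def r'_def by (rule linear_reindex)+
  have dot: "r x \<bullet> r y = x \<bullet> y" for x y unfolding r_def by (rule inner_reindex[OF bij])
  have cont': "continuous_on A r" for A unfolding r_def by (rule continuous_on_reindex)
  have contc: "continuous_on UNIV (\<lambda>x. h (r' x))" if "continuous_on UNIV h" for h :: "real^'n \<Rightarrow> real"
    unfolding r'_def by (rule continuous_on_compose2[OF that continuous_on_reindex]) simp
  have hp: "hyper_proj (r n) b (r x) = r (hyper_proj n b x)" for x
    using lin(1) by (simp add: hyper_proj_def dot linear_diff linear_cmul)
  have cyl: "unit_cylinder (r n) b (r ` e) = r ` unit_cylinder n b e"
  proof -
    have "x \<in> unit_cylinder (r n) b (r ` e) \<longleftrightarrow> r' x \<in> unit_cylinder n b e" for x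
    proof -
      have "hyper_proj (r n) b x = r (hyper_proj n b (r' x))" using hp[of "r' x"] by (simp only: rr)
      moreover have "r n \<bullet> x = n \<bullet> r' x" using dot[of n "r' x"] by (simp only: rr)
      ultimately show ?thesis unfolding unit_cylinder_def mem_Collect_eq by (simp only: injr)
    qed
    moreover have "x \<in> r ` unit_cylinder n b e \<longleftrightarrow> r' x \<in> unit_cylinder n b e" for x
      using injr[of "r' x" "unit_cylinder n b e"] by (simp only: rr)
    ultimately show ?thesis by blast
  qed
  have hull: "convex hull (insert (r v) (r ` e)) = r ` (convex hull (insert v e))"
    using convex_hull_linear_image[OF lin(1), of "insert v e"] by simp
  have card: "CARD('m) = CARD('n)" using bij bij_betw_same_card by blast
  have "integral (convex hull (insert (r v) (r ` e))) (\<lambda>x. G (r' x)) = \<eta> * integral (unit_cylinder (r n) b (r ` e))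
     (\<lambda>x. g0 (r' (hyper_proj (r n) b x)) / CARD('m) + g1 (r' (hyper_proj (r n) b x)) / (CARD('m) + 1) + g2 (r' (hyper_proj (r n) b x)) / (CARD('m) + 2))"
  proof (rule integral_cone_wellorder)
    show "norm (r n) = 1" using n dot by (simp add: norm_eq_sqrt_inner)
    show "compact (r ` e)" by (rule compact_continuous_image[OF cont' e(1)])
    show "convex (r ` e)" by (rule convex_linear_image[OF lin(1) e(2)])
    show "r ` e \<noteq> {}" using e(3) by simp
    show "r ` e \<subseteq> {x. r n \<bullet> x = b}" using e(4) dot by auto
    show "r n \<bullet> r v = b - \<eta>" using v dot by simp
    show "\<eta> > 0" by (rule v)
    show "G (r' (r v + t *\<^sub>R (y - r v))) = g0 (r' y) + t * g1 (r' y) + t\<^sup>2 * g2 (r' y)"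
      if "y \<in> r ` e" "0 \<le> t" "t \<le> 1" for y t
    proof -
      have "r' (r v + t *\<^sub>R (y - r v)) = v + t *\<^sub>R (r' y - v)"
        using lin(2) by (simp add: linear_diff linear_cmul linear_add rr)
      moreover have "r' y \<in> e" using that rr by auto
      ultimately show ?thesis using G that by simp
    qed
  qed (intro contc cont)+
  also have "integral (unit_cylinder (r n) b (r ` e))
     (\<lambda>x. g0 (r' (hyper_proj (r n) b x)) / CARD('m) + g1 (r' (hyper_proj (r n) b x)) / (CARD('m) + 1) + g2 (r' (hyper_proj (r n) b x)) / (CARD('m) + 2))
     = integral (unit_cylinder n b e)
     (\<lambda>x. g0 (hyper_proj n b x) / CARD('n) + g1 (hyper_proj n b x) / (CARD('n) + 1) + g2 (hyper_proj n b x) / (CARD('n) + 2))"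
  proof -
    define q where "q y = g0 y / CARD('n) + g1 y / (CARD('n) + 1) + g2 y / (CARD('n) + 2)" for y
    have "continuous_on UNIV q" unfolding q_def by (auto intro!: continuous_intros cont)
    then have "continuous_on UNIV (\<lambda>x. q (r' (hyper_proj (r n) b x)))"
      by (rule continuous_on_compose2[OF contc]) (auto intro!: continuous_intros)
    from integral_reindex[OF bij compact_unit_cylinder[OF n e(1)] this]
    show ?thesis unfolding cyl by (simp add: r_def[symmetric] hp rr q_def card)
  qed
  also have "integral (convex hull (insert (r v) (r ` e))) (\<lambda>x. G (r' x)) = integral (convex hull (insert v e)) G"
  proof -
    have "compact (convex hull (insert v e))" using e by (intro compact_convex_hull compact_insert)
    from integral_reindex[OF bij this contc[OF cont(1)]]
    show ?thesis unfolding hull by (simp add: r_def[symmetric] rr)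
  qed
  finally show ?thesis .
qed

section \<open>The surface measure of a flat face\<close>

lemma closest_point_hyperplane:
  fixes n :: "real^'n"
  assumes n: "norm n = 1"
  shows "closest_point {x. n \<bullet> x = b} x = hyper_proj n b x" "dist x (hyper_proj n b x) = \<bar>n \<bullet> x - b\<bar>"
proof -
  show d: "dist x (hyper_proj n b x) = \<bar>n \<bullet> x - b\<bar>"
    using n by (simp add: dist_norm hyper_proj_def)
  show "closest_point {x. n \<bullet> x = b} x = hyper_proj n b x"
  proof (rule closest_point_unique[symmetric])
    show "convex {x. n \<bullet> x = b}" "closed {x. n \<bullet> x = b}" by (rule convex_hyperplane closed_hyperplane)+
    show "hyper_proj n b x \<in> {x. n \<bullet> x = b}" using hyper_proj_on[OF n] by simp
    show "\<forall>z\<in>{x. n \<bullet> x = b}. dist x (hyper_proj n b x) \<le> dist x z"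
    proof
      fix z assume "z \<in> {x. n \<bullet> x = b}"
      then have "\<bar>n \<bullet> x - b\<bar> = \<bar>n \<bullet> (x - z)\<bar>" by (simp add: inner_simps)
      also have "\<dots> \<le> norm n * norm (x - z)" by (rule Cauchy_Schwarz_ineq2)
      finally show "dist x (hyper_proj n b x) \<le> dist x z" using n d by (simp add: dist_norm)
    qed
  qed
qed

lemma face_measure_hyperplane:
  assumes n: "norm n = 1" and hull: "affine hull e = {x. n \<bullet> x = b}"
  shows "face_measure e = completion (distr (restrict_space lborel (unit_cylinder n b e)) borel (hyper_proj n b))"
proof -
  have "closest_point (affine hull e) = hyper_proj n b"
    unfolding hull using closest_point_hyperplane(1)[OF n] by auto
  then show ?thesis unfolding face_measure_def unit_cylinder_def
    by (simp add: closest_point_hyperplane(2)[OF n])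
qed

lemma measurable_hyper_proj: "hyper_proj n b \<in> measurable (restrict_space lborel A) borel"
proof -
  have "hyper_proj n b \<in> borel_measurable borel"
    by (intro borel_measurable_continuous_onI continuous_intros)
  then show ?thesis by (simp add: measurable_restrict_space1)
qed

lemma face_integral_eq:
  fixes g :: "real^'n \<Rightarrow> real"
  assumes n: "norm n = 1" and hull: "affine hull e = {x. n \<bullet> x = b}" and e: "compact e"
    and g: "continuous_on UNIV g"
  shows "(LINT x|face_measure e. g x) = integral (unit_cylinder n b e) (\<lambda>x. g (hyper_proj n b x))"
proof -
  let ?C = "unit_cylinder n b e"
  have C: "?C \<in> sets lborel" using compact_unit_cylinder[OF n e] by (simp add: borel_compact)
  have gb: "g \<in> borel_measurable borel" by (rule borel_measurable_continuous_onI[OF g])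
  have "(LINT x|face_measure e. g x) = (LINT x|distr (restrict_space lborel ?C) borel (hyper_proj n b). g x)"
    unfolding face_measure_hyperplane[OF n hull] by (rule integral_completion) (use gb in simp)
  also have "\<dots> = (LINT x|restrict_space lborel ?C. g (hyper_proj n b x))"
    by (rule integral_distr[OF measurable_hyper_proj gb])
  also have "\<dots> = (LINT x|lborel. indicator ?C x * g (hyper_proj n b x))"
    using integral_restrict_space[of ?C lborel "\<lambda>x. g (hyper_proj n b x)"] C by simp
  also have "\<dots> = integral ?C (\<lambda>x. g (hyper_proj n b x))"
    by (rule integral_lborel_compact[OF compact_unit_cylinder[OF n e]])
       (auto intro!: continuous_on_compose2[OF g] continuous_intros)
  finally show ?thesis .
qed

lemma face_measure_finite:
  assumes n: "norm n = 1" and hull: "affine hull e = {x. n \<bullet> x = b}" and e: "compact e"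
  shows "finite_measure (face_measure e)"
proof
  let ?C = "unit_cylinder n b e"
  have C: "compact ?C" using compact_unit_cylinder[OF n e] .
  have "emeasure (face_measure e) (space (face_measure e)) = emeasure (restrict_space lborel ?C) (space (restrict_space lborel ?C))"
    unfolding face_measure_hyperplane[OF n hull]
    by (simp add: emeasure_distr[OF measurable_hyper_proj])
  also have "\<dots> = emeasure lborel ?C"
    using C by (simp add: emeasure_restrict_space space_restrict_space borel_compact)
  also have "\<dots> < \<infinity>" using emeasure_compact_finite[OF C] by simp
  finally show "emeasure (face_measure e) (space (face_measure e)) \<noteq> \<infinity>" by simp
qed

lemma face_measure_AE_in:
  assumes n: "norm n = 1" and hull: "affine hull e = {x. n \<bullet> x = b}" and e: "compact e"
  shows "AE x in face_measure e. x \<in> e"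
proof -
  let ?C = "unit_cylinder n b e"
  have C: "?C \<in> sets lborel" using compact_unit_cylinder[OF n e] by (simp add: borel_compact)
  have "{x \<in> space borel. x \<in> e} \<in> sets borel" using e by (simp add: borel_compact)
  then have "AE x in distr (restrict_space lborel ?C) borel (hyper_proj n b). x \<in> e"
    by (subst AE_distr_iff[OF measurable_hyper_proj])
       (auto simp: space_restrict_space unit_cylinder_def)
  then show ?thesis unfolding face_measure_hyperplane[OF n hull] by (rule AE_completion)
qed

lemma borel_measurable_face_measure:
  assumes "f \<in> borel_measurable borel"
  shows "f \<in> borel_measurable (face_measure e)"
  unfolding face_measure_def by (rule measurable_completion) (use assms in simp)

text \<open>
  The only property of the surface measure, besides its finiteness and its support, on which the
  estimates rest. It covers integrands that are quadratic polynomials on each ray from the apex.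
\<close>

lemma integral_cone:
  fixes e :: "(real^'n) set"
  assumes card: "CARD('n) = 2 \<or> CARD('n) = 3"
    and n: "norm n = 1" and e: "compact e" "convex e" "e \<noteq> {}" "affine hull e = {x. n \<bullet> x = b}"
    and v: "n \<bullet> v = b - \<eta>" "\<eta> > 0"
    and cont: "continuous_on UNIV G" "continuous_on UNIV g0" "continuous_on UNIV g1" "continuous_on UNIV g2"
    and G: "\<And>y t. y \<in> e \<Longrightarrow> 0 \<le> t \<Longrightarrow> t \<le> 1 \<Longrightarrow> G (v + t *\<^sub>R (y - v)) = g0 y + t * g1 y + t\<^sup>2 * g2 y"
  shows "(LINT x|lebesgue_on (convex hull (insert v e)). G x) = \<eta> * (LINT x|face_measure e.
      g0 x / CARD('n) + g1 x / (CARD('n) + 1) + g2 x / (CARD('n) + 2) :: real)"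
proof -
  have sub: "e \<subseteq> {x. n \<bullet> x = b}" using e(4) hull_subset[of e affine] by auto
  have K: "compact (convex hull (insert v e))" using e by (intro compact_convex_hull compact_insert)
  have "integral (convex hull (insert v e)) G = \<eta> * integral (unit_cylinder n b e)
     (\<lambda>x. g0 (hyper_proj n b x) / CARD('n) + g1 (hyper_proj n b x) / (CARD('n) + 1) + g2 (hyper_proj n b x) / (CARD('n) + 2))"
    using card
  proof
    assume "CARD('n) = 2"
    then obtain \<sigma> :: "2 \<Rightarrow> 'n" where "bij \<sigma>"
      using finite_same_card_bij[of "UNIV :: 2 set" "UNIV :: 'n set"] by auto
    from integral_cone_reindex[OF this n e(1-3) sub v cont G] show ?thesis .
  next
    assume "CARD('n) = 3"
    then obtain \<sigma> :: "3 \<Rightarrow> 'n" where "bij \<sigma>"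
      using finite_same_card_bij[of "UNIV :: 3 set" "UNIV :: 'n set"] by auto
    from integral_cone_reindex[OF this n e(1-3) sub v cont G] show ?thesis .
  qed
  also have "integral (unit_cylinder n b e)
     (\<lambda>x. g0 (hyper_proj n b x) / CARD('n) + g1 (hyper_proj n b x) / (CARD('n) + 1) + g2 (hyper_proj n b x) / (CARD('n) + 2))
     = (LINT x|face_measure e. g0 x / CARD('n) + g1 x / (CARD('n) + 1) + g2 x / (CARD('n) + 2))"
    by (rule face_integral_eq[OF n e(4,1), symmetric]) (auto intro!: continuous_intros cont)
  also have "integral (convex hull (insert v e)) G = (LINT x|lebesgue_on (convex hull (insert v e)). G x)"
  proof (rule lebesgue_integral_eq_integral[symmetric])
    show "convex hull (insert v e) \<in> sets lebesgue" using K by (simp add: borel_compact)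
    have "set_integrable lebesgue (convex hull (insert v e)) G"
      by (rule absolutely_integrable_on_compact[OF K continuous_on_subset[OF cont(1)]]) simp
    then show "integrable (lebesgue_on (convex hull (insert v e))) G"
      unfolding set_integrable_def using K by (subst integrable_restrict_space) (auto simp: borel_compact)
  qed
  finally show ?thesis .
qed

section \<open>Facets of a simplex\<close>

text \<open>
  The part of \<open>m\<close> orthogonal to \<open>n\<close> is a direction within the hyperplane, so \<open>m\<close> vanishes on it; hence
  this part is zero.
\<close>

lemma hyperplane_unit_normal:
  fixes n m :: "real^'n"
  assumes n: "norm n = 1" and m: "norm m = 1"
    and sub: "{x. n \<bullet> x = b} \<subseteq> {x. m \<bullet> x = b'}"
  shows "m = n \<or> m = - n"
proof -
  have nn: "n \<bullet> n = 1" "m \<bullet> m = 1" using n m by (simp_all add: norm_eq_1)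
  define w where "w = m - (m \<bullet> n) *\<^sub>R n"
  have nw: "n \<bullet> w = 0" by (simp add: w_def inner_diff_right inner_commute nn)
  have "b *\<^sub>R n \<in> {x. n \<bullet> x = b}" "b *\<^sub>R n + w \<in> {x. n \<bullet> x = b}" by (simp_all add: nn inner_add_right nw)
  then have "b *\<^sub>R n \<in> {x. m \<bullet> x = b'}" "b *\<^sub>R n + w \<in> {x. m \<bullet> x = b'}" using sub by blast+
  then have "m \<bullet> w = 0" by (simp add: inner_add_right)
  then have "w \<bullet> w = 0" using nw by (simp add: w_def inner_diff_left inner_diff_right inner_commute)
  then have m_eq: "m = (m \<bullet> n) *\<^sub>R n" by (simp add: w_def)
  have "(m \<bullet> n)\<^sup>2 = 1" using nn(2) by (subst (asm) (1 2) m_eq) (simp add: nn power2_eq_square)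
  then have "m \<bullet> n = 1 \<or> m \<bullet> n = -1" by (simp add: power2_eq_1_iff)
  then show ?thesis using m_eq by (metis scaleR_minus1_left scaleR_one)
qed

text \<open>
  A vector that satisfies the defining inequality is constant on \<open>e\<close>, hence on its hyperplane, and is
  \<open>n\<close> or \<open>- n\<close>. The vertex \<open>v\<close> decides the sign.
\<close>

lemma outer_normal_eq:
  fixes n :: "real^'n"
  assumes n: "norm n = 1" and hull: "affine hull e = {x. n \<bullet> x = b}"
    and K: "K = convex hull (insert v e)" and v: "n \<bullet> v < b" and ne: "e \<noteq> {}"
  shows "outer_normal K e = n"
  unfolding outer_normal_def
proof (rule the_equality)
  have sub: "n \<bullet> x = b" if "x \<in> e" for x using hull hull_subset[of e affine] that by auto
  have "K \<subseteq> {x. n \<bullet> x \<le> b}" unfolding K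
    by (rule hull_minimal) (use sub v in \<open>auto simp: convex_halfspace_le\<close>)
  then show "norm n = 1 \<and> (\<forall>x\<in>e. \<forall>y\<in>K. n \<bullet> (y - x) \<le> 0)"
    using n sub by (auto simp: inner_diff_right)
  fix m assume m: "norm m = 1 \<and> (\<forall>x\<in>e. \<forall>y\<in>K. m \<bullet> (y - x) \<le> 0)"
  obtain z where z: "z \<in> e" using ne by auto
  have eK: "e \<subseteq> K" "v \<in> K" unfolding K by (auto intro: hull_inc)
  have "m \<bullet> x = m \<bullet> z" if "x \<in> e" for x
    using m z that eK by (metis inner_diff_right diff_le_0_iff_le order_antisym subsetD)
  then have "affine hull e \<subseteq> {x. m \<bullet> x = m \<bullet> z}"
    by (intro hull_minimal affine_hyperplane) auto
  then have "{x. n \<bullet> x = b} \<subseteq> {x. m \<bullet> x = m \<bullet> z}" using hull by simp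
  then have "m = n \<or> m = - n" using hyperplane_unit_normal[OF n] m by blast
  moreover have "m \<noteq> - n"
  proof
    assume "m = - n"
    moreover have "m \<bullet> (v - z) \<le> 0" using m z eK by auto
    ultimately show False using v sub[OF z] by (simp add: inner_diff_right)
  qed
  ultimately show "m = n" by blast
qed

text \<open>
  The value of \<open>(y - x) \<bullet> n\<close> on the flat face \<open>e\<close> with outward normal \<open>n\<close>. It does not depend on the
  point \<open>y\<close> of \<open>e\<close>.
\<close>

definition facet_offset :: "(real^'n) set \<Rightarrow> (real^'n) set \<Rightarrow> real^'n \<Rightarrow> real" where
  "facet_offset K e x = outer_normal K e \<bullet> ((SOME y. y \<in> e) - x)"

locale full_simplex =
  fixes C :: "(real^'n) set"
  assumes indep: "\<not> affine_dependent C" and cardC: "card C = CARD('n) + 1"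
    and dim2: "CARD('n) \<ge> 2"
begin

definition cell where "cell = convex hull C"
definition opp_face where "opp_face c = convex hull (C - {c})"
definition nrm where "nrm c = outer_normal cell (opp_face c)"
definition lev where "lev c = nrm c \<bullet> (SOME y. y \<in> opp_face c)"
definition height where "height c = lev c - nrm c \<bullet> c"
text \<open>
  The barycentric coordinate that belongs to the vertex \<open>c\<close>, expressed by the distance to the opposite
  facet. In this form its gradient \<open>- nrm c / height c\<close> is visible.
\<close>

definition bary where "bary c x = (lev c - nrm c \<bullet> x) / height c"

lemma finC: "finite C" using indep aff_independent_finite by blast

lemma opp_face_nonempty: "opp_face c \<noteq> {}"
proof -
  have "\<not> C \<subseteq> {c}" using cardC dim2 card_mono[of "{c}" C] by auto
  then show ?thesis by (auto simp: opp_face_def)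
qed

lemma cell_eq: "c \<in> C \<Longrightarrow> cell = convex hull (insert c (opp_face c))"
proof -
  assume "c \<in> C"
  then have "C = insert c (C - {c})" by auto
  then show ?thesis unfolding cell_def opp_face_def
    using hull_insert[of convex c "C - {c}"] by simp
qed

lemma opp_face_props:
  assumes c: "c \<in> C"
  shows "norm (nrm c) = 1" "affine hull (opp_face c) = {x. nrm c \<bullet> x = lev c}" "nrm c \<bullet> c < lev c"
proof -
  have "aff_dim (C - {c}) = int CARD('n) - 1"
  proof -
    have "\<not> affine_dependent (C - {c})" using indep affine_independent_subset by blast
    then have "aff_dim (C - {c}) = int (card (C - {c})) - 1" by (simp add: aff_dim_affine_independent)
    then show ?thesis using c cardC finC by simp
  qed
  then obtain a b where a: "a \<noteq> 0" and ab: "affine hull (C - {c}) = {x. a \<bullet> x = b}"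
    using aff_dim_eq_hyperplane[of "C - {c}"] by auto
  have cn: "c \<notin> affine hull (C - {c})" using indep c unfolding affine_dependent_def by auto
  then have abc: "a \<bullet> c \<noteq> b" using ab by auto
  define s where "s = (if a \<bullet> c < b then 1 else -1) / norm a"
  define n where "n = s *\<^sub>R a"
  have s: "s \<noteq> 0" using a by (simp add: s_def)
  have n1: "norm n = 1" using a by (simp add: n_def s_def)
  have hull: "affine hull (opp_face c) = {x. n \<bullet> x = s * b}"
    unfolding opp_face_def affine_hull_convex_hull ab using s by (auto simp: n_def)
  have nc: "n \<bullet> c < s * b" using abc a by (auto simp: n_def s_def field_simps)
  have "nrm c = n" unfolding nrm_def
    by (rule outer_normal_eq[OF n1 hull cell_eq[OF c] nc opp_face_nonempty])
  moreover have "lev c = s * b"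
  proof -
    have "(SOME y. y \<in> opp_face c) \<in> opp_face c" using opp_face_nonempty by (simp add: some_in_eq)
    then show ?thesis unfolding lev_def \<open>nrm c = n\<close> using hull hull_subset[of "opp_face c" affine] by auto
  qed
  ultimately show "norm (nrm c) = 1" "affine hull (opp_face c) = {x. nrm c \<bullet> x = lev c}" "nrm c \<bullet> c < lev c"
    using n1 hull nc by auto
qed

lemma height_pos: "c \<in> C \<Longrightarrow> height c > 0"
  using opp_face_props(3) by (simp add: height_def)

lemma on_opp_face: "c \<in> C \<Longrightarrow> y \<in> opp_face c \<Longrightarrow> nrm c \<bullet> y = lev c"
  using opp_face_props(2)[of c] hull_subset[of "opp_face c" affine] by auto

lemma bary_self: "c \<in> C \<Longrightarrow> bary c c = 1"
  using height_pos[of c] by (simp add: bary_def height_def)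

lemma bary_on_face: "c \<in> C \<Longrightarrow> y \<in> opp_face c \<Longrightarrow> bary c y = 0"
  by (simp add: bary_def on_opp_face)

lemma vertex_in_opp_face: "c' \<in> C \<Longrightarrow> c' \<noteq> c \<Longrightarrow> c' \<in> opp_face c"
  by (simp add: opp_face_def hull_inc)

lemma bary_vertex: "c \<in> C \<Longrightarrow> c' \<in> C \<Longrightarrow> bary c c' = (if c = c' then 1 else 0)"
  using bary_self bary_on_face vertex_in_opp_face by auto

lemma bary_affine_comb:
  assumes "sum u A = 1" "finite A"
  shows "bary c (\<Sum>a\<in>A. u a *\<^sub>R a) = (\<Sum>a\<in>A. u a * bary c a)"
proof -
  have "bary c (\<Sum>a\<in>A. u a *\<^sub>R a) = (sum u A * lev c - (\<Sum>a\<in>A. u a * (nrm c \<bullet> a))) / height c"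
    using assms by (simp add: bary_def inner_sum_right)
  also have "\<dots> = (\<Sum>a\<in>A. u a * bary c a)"
    by (simp add: bary_def sum_distrib_right flip: sum_subtractf sum_divide_distrib) (simp add: right_diff_distrib)
  finally show ?thesis .
qed

lemma bary_of_comb:
  assumes "sum u C = 1" "c \<in> C"
  shows "bary c (\<Sum>a\<in>C. u a *\<^sub>R a) = u c"
proof -
  have "bary c (\<Sum>a\<in>C. u a *\<^sub>R a) = (\<Sum>a\<in>C. if a = c then u c else 0)"
    unfolding bary_affine_comb[OF assms(1) finC]
    by (rule sum.cong) (use assms(2) bary_vertex in auto)
  then show ?thesis using assms(2) finC by simp
qed

lemma bary_repr: "(\<Sum>c\<in>C. bary c x) = 1" "(\<Sum>c\<in>C. bary c x *\<^sub>R c) = x"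
proof -
  have "affine hull C = UNIV"
    by (rule affine_independent_span_eq[OF indep]) (simp add: cardC)
  then obtain u where u: "sum u C = 1" "(\<Sum>c\<in>C. u c *\<^sub>R c) = x"
    using affine_hull_finite[OF finC] by blast
  then have "bary c x = u c" if "c \<in> C" for c using bary_of_comb[OF u(1) that] by simp
  then show "(\<Sum>c\<in>C. bary c x) = 1" "(\<Sum>c\<in>C. bary c x *\<^sub>R c) = x" using u by simp_all
qed

lemma mem_cell: "x \<in> cell \<longleftrightarrow> (\<forall>c\<in>C. bary c x \<ge> 0)"
proof
  assume "x \<in> cell"
  then obtain u where u: "\<forall>c\<in>C. 0 \<le> u c" "sum u C = 1" "(\<Sum>c\<in>C. u c *\<^sub>R c) = x"
    unfolding cell_def convex_hull_finite[OF finC] by blast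
  show "\<forall>c\<in>C. bary c x \<ge> 0"
  proof
    fix c assume "c \<in> C"
    then show "bary c x \<ge> 0" using bary_of_comb[OF u(2)] u(1) unfolding u(3) by simp
  qed
next
  assume "\<forall>c\<in>C. bary c x \<ge> 0"
  then show "x \<in> cell" unfolding cell_def convex_hull_finite[OF finC]
    using bary_repr[of x] by (intro CollectI exI[of _ "\<lambda>c. bary c x"]) simp
qed

lemma rel_interior_opp_face:
  assumes c: "c \<in> C" and x: "x \<in> rel_interior (opp_face c)" and c': "c' \<in> C" "c' \<noteq> c"
  shows "bary c' x > 0"
proof -
  have "\<not> affine_dependent (C - {c})" using indep affine_independent_subset by blast
  from rel_interior_convex_hull_explicit[OF this] x
  obtain u where u: "\<forall>a\<in>C-{c}. 0 < u a" "sum u (C-{c}) = 1" "(\<Sum>a\<in>C-{c}. u a *\<^sub>R a) = x"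
    unfolding opp_face_def by blast
  have "bary c' x = (\<Sum>a\<in>C-{c}. u a * bary c' a)"
    using bary_affine_comb[OF u(2), of c'] finC u(3) by simp
  also have "\<dots> = (\<Sum>a\<in>C-{c}. if a = c' then u c' else 0)"
    by (rule sum.cong) (use c' bary_vertex in auto)
  also have "\<dots> = u c'" using finC c' by simp
  finally show ?thesis using u(1) c' by simp
qed

text \<open>
  Near a relative interior point of a facet the other barycentric coordinates stay positive, so only
  the inequality that belongs to this facet is active.
\<close>

lemma cell_half_ball:
  assumes c: "c \<in> C" and x: "x \<in> rel_interior (opp_face c)"
  shows "\<exists>r>0. \<forall>y\<in>ball x r. y \<in> cell \<longleftrightarrow> nrm c \<bullet> (y - x) \<le> 0"
proof -
  let ?U = "\<Inter>c'\<in>C-{c}. {y. bary c' y > 0}"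
  have "open ?U"
  proof (intro open_INT finC finite_Diff ballI)
    fix c'
    show "open {y. bary c' y > 0}" unfolding bary_def divide_inverse by (intro open_Collect_less continuous_intros)
  qed
  moreover have "x \<in> ?U" using rel_interior_opp_face[OF c x] by auto
  ultimately obtain r where r: "r > 0" "ball x r \<subseteq> ?U" using open_contains_ball by metis
  have nx: "nrm c \<bullet> x = lev c" using on_opp_face[OF c] x rel_interior_subset by auto
  have "y \<in> cell \<longleftrightarrow> nrm c \<bullet> (y - x) \<le> 0" if "y \<in> ball x r" for y
  proof -
    have "\<forall>c'\<in>C-{c}. bary c' y > 0" using that r by auto
    then have "y \<in> cell \<longleftrightarrow> bary c y \<ge> 0" unfolding mem_cell using c less_imp_le by blast
    also have "\<dots> \<longleftrightarrow> nrm c \<bullet> (y - x) \<le> 0"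
      using height_pos[OF c] by (simp add: bary_def inner_diff_right nx zero_le_divide_iff)
    finally show ?thesis .
  qed
  then show ?thesis using r(1) by blast
qed

lemma opp_face_inj: "inj_on opp_face C"
proof (rule inj_onI)
  fix c c' assume *: "c \<in> C" "c' \<in> C" "opp_face c = opp_face c'"
  show "c = c'"
  proof (rule ccontr)
    assume "c \<noteq> c'"
    then have "c \<in> opp_face c" using * vertex_in_opp_face by blast
    then show False using bary_self bary_on_face * by fastforce
  qed
qed

lemma facets_of_cell: "{e. e facet_of cell} = opp_face ` C"
  unfolding cell_def facet_of_convex_hull_affine_independent[OF indep]
  using opp_face_nonempty by (auto simp: opp_face_def[symmetric])

lemma compact_cell: "compact cell" unfolding cell_def by (intro compact_convex_hull finite_imp_compact finC)
lemma compact_opp_face: "compact (opp_face c)" "convex (opp_face c)"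
  unfolding opp_face_def by (intro compact_convex_hull finite_imp_compact finite_Diff finC) (rule convex_convex_hull)

lemma facet_offset_opp: "facet_offset cell (opp_face c) x = lev c - nrm c \<bullet> x"
  unfolding facet_offset_def lev_def nrm_def by (simp add: inner_diff_right)

end

lemma full_simplex_ex:
  fixes K :: "(real^'n) set"
  assumes "(int CARD('n)) simplex K" "CARD('n) \<ge> 2"
  obtains C where "full_simplex C" "K = full_simplex.cell C"
proof -
  obtain C where C: "\<not> affine_dependent C" "int (card C) = int CARD('n) + 1" "K = convex hull C"
    using assms(1) unfolding simplex_def by blast
  then have "full_simplex C" using assms(2) by unfold_locales auto
  then show ?thesis using C(3) full_simplex.cell_def[of C] that by auto
qed

lemma facet_normal_props:
  fixes K :: "(real^'n) set"
  assumes "(int CARD('n)) simplex K" "CARD('n) \<ge> 2" "e facet_of K"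
  shows "norm (outer_normal K e) = 1"
    "affine hull e = {x. outer_normal K e \<bullet> x = outer_normal K e \<bullet> (SOME y. y \<in> e)}"
    "compact e" "convex e" "e \<noteq> {}"
    "x \<in> e \<Longrightarrow> outer_normal K e \<bullet> (x - x\<^sub>0) = facet_offset K e x\<^sub>0"
    "x \<in> rel_interior e \<Longrightarrow> \<exists>r>0. \<forall>y\<in>ball x r. y \<in> K \<longleftrightarrow> outer_normal K e \<bullet> (y - x) \<le> 0"
proof -
  obtain C where "full_simplex C" and K: "K = full_simplex.cell C"
    using full_simplex_ex[OF assms(1,2)] .
  interpret full_simplex C by fact
  obtain c where c: "c \<in> C" and e: "e = opp_face c" using assms(3) facets_of_cell K by blast
  show "norm (outer_normal K e) = 1"
    "affine hull e = {x. outer_normal K e \<bullet> x = outer_normal K e \<bullet> (SOME y. y \<in> e)}"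
    using opp_face_props[OF c] by (simp_all add: K e nrm_def lev_def)
  show "compact e" "convex e" "e \<noteq> {}" using compact_opp_face opp_face_nonempty e by auto
  show "x \<in> e \<Longrightarrow> outer_normal K e \<bullet> (x - x\<^sub>0) = facet_offset K e x\<^sub>0"
    using on_opp_face[OF c] by (simp add: K e facet_offset_opp inner_diff_right nrm_def[symmetric])
  show "x \<in> rel_interior e \<Longrightarrow> \<exists>r>0. \<forall>y\<in>ball x r. y \<in> K \<longleftrightarrow> outer_normal K e \<bullet> (y - x) \<le> 0"
    using cell_half_ball[OF c] by (simp add: K e nrm_def)
qed

lemma card_facets_simplex:
  fixes K :: "(real^'n) set"
  assumes "(int CARD('n)) simplex K" "CARD('n) \<ge> 2"
  shows "finite {e. e facet_of K}" "card {e. e facet_of K} \<le> CARD('n) + 1"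
proof -
  obtain C where "full_simplex C" and K: "K = full_simplex.cell C"
    using full_simplex_ex[OF assms(1,2)] .
  interpret full_simplex C by fact
  show "finite {e. e facet_of K}" "card {e. e facet_of K} \<le> CARD('n) + 1"
    unfolding K facets_of_cell using finC card_image_le[OF finC, of opp_face] cardC by auto
qed

section \<open>Affine functions\<close>

text \<open>
  The derivative in the real direction \<open>w\<close> of a function with complex gradient \<open>a\<close>; bilinear, without
  complex conjugation.
\<close>

definition cdot :: "complex^'n \<Rightarrow> real^'n \<Rightarrow> complex" where
  "cdot a w = (\<Sum>i\<in>UNIV. a $ i * of_real (w $ i))"

lemma cdot_linear: "cdot a (v + w) = cdot a v + cdot a w" "cdot a (v - w) = cdot a v - cdot a w"
  "cdot a (r *\<^sub>R w) = of_real r * cdot a w" "cdot a (- w) = - cdot a w"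
  "cdot (a - b) w = cdot a w - cdot b w" "cdot a 0 = 0"
  by (auto simp: cdot_def algebra_simps sum.distrib sum_subtractf sum_distrib_left sum_negf)

lemma cdot_sum: "cdot a (\<Sum>i\<in>A. f i) = (\<Sum>i\<in>A. cdot a (f i))"
  by (induction A rule: infinite_finite_induct) (auto simp: cdot_linear)

lemma norm_cdot_le: "cmod (cdot a w) \<le> norm a * norm w"
proof -
  have "cmod (cdot a w) \<le> (\<Sum>i\<in>UNIV. \<bar>cmod (a $ i)\<bar> * \<bar>w $ i\<bar>)"
    unfolding cdot_def by (rule order.trans[OF norm_sum]) (simp add: norm_mult)
  also have "\<dots> \<le> L2_set (\<lambda>i. cmod (a $ i)) UNIV * L2_set (\<lambda>i. w $ i) UNIV"
    by (rule L2_set_mult_ineq)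
  also have "\<dots> = norm a * norm w" by (simp add: norm_vec_def L2_set_def)
  finally show ?thesis .
qed

lemma continuous_on_cdot [continuous_intros]: "continuous_on S f \<Longrightarrow> continuous_on S (\<lambda>x. cdot a (f x))"
  unfolding cdot_def by (intro continuous_intros)

lemma P1_iff: "p \<in> P1 \<longleftrightarrow> (\<exists>c a. p = (\<lambda>x. c + cdot a x))"
proof
  assume "p \<in> P1"
  then obtain c a where "p = (\<lambda>x. c + (\<Sum>i\<in>UNIV. a i * of_real (x $ i)))" by (auto simp: P1_def)
  then have "p = (\<lambda>x. c + cdot (\<chi> i. a i) x)" by (simp add: cdot_def)
  then show "\<exists>c a. p = (\<lambda>x. c + cdot a x)" by blast
qed (auto simp: P1_def cdot_def)

lemma has_derivative_cdot: "((\<lambda>x. c + cdot a x) has_derivative cdot a) (at x)"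
proof -
  have "bounded_linear (cdot a)"
    by (rule linear_conv_bounded_linear[THEN iffD1]) (auto intro!: linearI simp: cdot_linear scaleR_conv_of_real[where 'a=complex])
  then have "(cdot a has_derivative cdot a) (at x)" by (rule bounded_linear_imp_has_derivative)
  from has_derivative_add[OF has_derivative_const[of c] this] show ?thesis by simp
qed

lemma grad_P1: "grad (\<lambda>x. c + cdot a x) x = a"
proof -
  have "frechet_derivative (\<lambda>x. c + cdot a x) (at x) = cdot a"
    by (rule frechet_derivative_at[OF has_derivative_cdot, symmetric])
  moreover have "cdot a (axis i 1) = a $ i" for i
    unfolding cdot_def axis_def by (simp add: if_distrib cong: if_cong)
  ultimately show ?thesis by (simp add: grad_def vec_eq_iff)
qed

lemma P1_affine:
  assumes "p \<in> P1"
  shows "p x = p y + cdot (grad p 0) (x - y)" "grad p x = grad p 0"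
proof -
  obtain c a where p: "p = (\<lambda>x. c + cdot a x)" using assms P1_iff by blast
  then show "p x = p y + cdot (grad p 0) (x - y)" "grad p x = grad p 0"
    by (simp_all add: grad_P1 cdot_linear)
qed

lemma P1_continuous: "p \<in> P1 \<Longrightarrow> continuous_on S p"
  by (auto simp: P1_iff intro!: continuous_intros)

lemma P1_const: "(\<lambda>_. c) \<in> P1"
  unfolding P1_iff by (intro exI[of _ c] exI[of _ 0]) (simp add: cdot_def)

text \<open>
  The function \<open>p x - p y\<close> is the radial derivative \<open>(x - y) \<bullet> \<nabla>p\<close>. That it is affine with the same
  gradient as \<open>p\<close> makes it usable as a test function.
\<close>

lemma P1_radial: "p \<in> P1 \<Longrightarrow> (\<lambda>x. p x - p y) \<in> P1" "p \<in> P1 \<Longrightarrow> grad (\<lambda>x. p x - p y) x = grad p 0"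
proof -
  assume "p \<in> P1"
  then obtain c a where p: "p = (\<lambda>x. c + cdot a x)" using P1_iff by blast
  then have *: "(\<lambda>x. p x - p y) = (\<lambda>x. (- cdot a y) + cdot a x)" by auto
  then show "(\<lambda>x. p x - p y) \<in> P1" unfolding P1_iff by blast
  show "grad (\<lambda>x. p x - p y) x = grad p 0" by (simp only: *) (simp only: p grad_P1)
qed

lemma integrable_on_compact:
  fixes f :: "'a::euclidean_space \<Rightarrow> 'b::euclidean_space"
  assumes K: "compact K" and f: "continuous_on UNIV f"
  shows "integrable (lebesgue_on K) f"
proof -
  have "integrable lborel (\<lambda>x. indicator K x *\<^sub>R f x)"
    by (rule borel_integrable_compact[OF K continuous_on_subset[OF f]]) simp
  then have "integrable lebesgue (\<lambda>x. indicator K x *\<^sub>R f x)"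
    by (subst integrable_completion) auto
  then show ?thesis using K by (subst integrable_restrict_space) (auto simp: borel_compact)
qed

section \<open>Divergence theorem and trace inequality on a simplex\<close>

context full_simplex
begin

lemma cone_opp_face:
  assumes card: "CARD('n) = 2 \<or> CARD('n) = 3" and c: "c \<in> C"
    and "continuous_on UNIV G" "continuous_on UNIV g0" "continuous_on UNIV g1" "continuous_on UNIV g2"
    and "\<And>y t. y \<in> opp_face c \<Longrightarrow> 0 \<le> t \<Longrightarrow> t \<le> 1 \<Longrightarrow> G (c + t *\<^sub>R (y - c)) = g0 y + t * g1 y + t\<^sup>2 * g2 y"
  shows "(LINT x|lebesgue_on cell. G x) = height c * (LINT x|face_measure (opp_face c).
      g0 x / real CARD('n) + g1 x / (real CARD('n) + 1) + g2 x / (real CARD('n) + 2))"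
proof -
  have "nrm c \<bullet> c = lev c - height c" by (simp add: height_def)
  from integral_cone[OF card opp_face_props(1)[OF c] compact_opp_face opp_face_nonempty opp_face_props(2)[OF c] this height_pos[OF c] assms(3-7)]
  show ?thesis unfolding cell_eq[OF c] by (simp add: add.commute)
qed

lemma P1_cone:
  assumes "p \<in> P1"
  shows "p (c + t *\<^sub>R (y - c)) = p c + of_real t * (p y - p c)"
  using P1_affine(1)[OF assms, of "c + t *\<^sub>R (y - c)" c] P1_affine(1)[OF assms, of y c]
  by (simp add: cdot_linear)

text \<open>
  The field \<open>(x - c) |p|\<^sup>2\<close> is tangential to all facets through \<open>c\<close>, and on the opposite facet the
  normal component of \<open>x - c\<close> is the height. So this is the divergence theorem for this field.
\<close>

lemma vertex_divergence:
  assumes card: "CARD('n) = 2 \<or> CARD('n) = 3" and c: "c \<in> C" and p: "p \<in> P1"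
  shows "height c * (LINT x|face_measure (opp_face c). (cmod (p x))\<^sup>2)
       = (LINT x|lebesgue_on cell. CARD('n) * (cmod (p x))\<^sup>2 + 2 * Re (cnj (p x) * (p x - p c)))"
proof -
  let ?d = "real CARD('n)"
  have d: "?d > 0" by simp
  note cont = P1_continuous[OF p]
  have "(LINT x|lebesgue_on cell. ?d * (cmod (p x))\<^sup>2 + 2 * Re (cnj (p x) * (p x - p c)))
      = height c * (LINT x|face_measure (opp_face c). (?d * (cmod (p c))\<^sup>2) / ?d
          + ((?d + 1) * (2 * Re (p c * cnj (p x - p c)))) / (?d + 1) + ((?d + 2) * (cmod (p x - p c))\<^sup>2) / (?d + 2))"
  proof (rule cone_opp_face[OF card c])
    fix y t
    show "?d * (cmod (p (c + t *\<^sub>R (y - c))))\<^sup>2 + 2 * Re (cnj (p (c + t *\<^sub>R (y - c))) * (p (c + t *\<^sub>R (y - c)) - p c))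
      = ?d * (cmod (p c))\<^sup>2 + t * ((?d + 1) * (2 * Re (p c * cnj (p y - p c)))) + t\<^sup>2 * ((?d + 2) * (cmod (p y - p c))\<^sup>2)"
      unfolding P1_cone[OF p]
      by (simp add: cmod_power2) (simp add: algebra_simps power2_eq_square)
  qed (auto intro!: continuous_intros cont)
  also have "(\<lambda>x. (?d * (cmod (p c))\<^sup>2) / ?d
          + ((?d + 1) * (2 * Re (p c * cnj (p x - p c)))) / (?d + 1) + ((?d + 2) * (cmod (p x - p c))\<^sup>2) / (?d + 2))
      = (\<lambda>x. (cmod (p x))\<^sup>2)"
  proof
    fix x
    have "?d + 1 \<noteq> 0" "?d + 2 \<noteq> 0" "?d \<noteq> 0" using d by linarith+
    then have "(?d * (cmod (p c))\<^sup>2) / ?d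
          + ((?d + 1) * (2 * Re (p c * cnj (p x - p c)))) / (?d + 1) + ((?d + 2) * (cmod (p x - p c))\<^sup>2) / (?d + 2)
        = (cmod (p c))\<^sup>2 + 2 * Re (p c * cnj (p x - p c)) + (cmod (p x - p c))\<^sup>2"
      by (simp only: nonzero_mult_div_cancel_left not_False_eq_True)
    also have "\<dots> = (cmod (p x))\<^sup>2"
      by (simp add: cmod_power2) (simp add: algebra_simps power2_eq_square)
    finally show "(?d * (cmod (p c))\<^sup>2) / ?d
          + ((?d + 1) * (2 * Re (p c * cnj (p x - p c)))) / (?d + 1) + ((?d + 2) * (cmod (p x - p c))\<^sup>2) / (?d + 2) = (cmod (p x))\<^sup>2" .
  qed
  finally show ?thesis by simp
qed

text \<open>
  The difference of the two sides is a perfect square. The lemma is the trace inequality on a single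
  ray, where \<open>a\<close> is the value at the apex and \<open>a + b\<close> the value on the facet.
\<close>

lemma trace_quadratic:
  fixes a b d :: real
  assumes d: "d > 0"
  shows "(a + b)\<^sup>2 / (2 * (d + 1)) \<le> a\<^sup>2 / d + 2 * a * b / (d + 1) + b\<^sup>2 / (d + 2)"
proof -
  have "a\<^sup>2 / d + 2 * a * b / (d + 1) + b\<^sup>2 / (d + 2) - (a + b)\<^sup>2 / (2 * (d + 1))
     = ((d + 2) * a + d * b)\<^sup>2 / (2 * (d + 1) * d * (d + 2))"
    using d by (simp add: divide_simps) (simp add: algebra_simps power2_eq_square)
  moreover have "\<dots> \<ge> 0" using d by simp
  ultimately show ?thesis by linarith
qed

lemma face_integrable:
  fixes f :: "real^'n \<Rightarrow> 'b::euclidean_space"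
  assumes c: "c \<in> C" and f: "continuous_on UNIV f"
  shows "integrable (face_measure (opp_face c)) f"
proof -
  interpret M: finite_measure "face_measure (opp_face c)"
    by (rule face_measure_finite[OF opp_face_props(1,2)[OF c] compact_opp_face(1)])
  have "bounded (f ` opp_face c)"
    by (intro compact_imp_bounded compact_continuous_image compact_opp_face continuous_on_subset[OF f]) simp
  then obtain B where B: "\<And>x. x \<in> opp_face c \<Longrightarrow> norm (f x) \<le> B" unfolding bounded_iff by blast
  show ?thesis
  proof (rule M.integrable_const_bound[of _ B])
    show "AE x in face_measure (opp_face c). norm (f x) \<le> B"
      using face_measure_AE_in[OF opp_face_props(1,2)[OF c] compact_opp_face(1)] by eventually_elim (rule B)
    show "f \<in> borel_measurable (face_measure (opp_face c))"
      by (intro borel_measurable_face_measure borel_measurable_continuous_onI f)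
  qed
qed

lemma vertex_trace:
  assumes card: "CARD('n) = 2 \<or> CARD('n) = 3" and c: "c \<in> C" and p: "p \<in> P1"
  shows "height c * (LINT x|face_measure (opp_face c). (cmod (p x))\<^sup>2)
       \<le> 2 * (CARD('n) + 1) * (LINT x|lebesgue_on cell. (cmod (p x))\<^sup>2)"
proof -
  let ?d = "real CARD('n)"
  have d: "?d > 0" by simp
  note cont = P1_continuous[OF p]
  have E: "(LINT x|lebesgue_on cell. (cmod (p x))\<^sup>2)
      = height c * (LINT x|face_measure (opp_face c). (cmod (p c))\<^sup>2 / ?d
          + (2 * Re (p c * cnj (p x - p c))) / (?d + 1) + (cmod (p x - p c))\<^sup>2 / (?d + 2))"
  proof (rule cone_opp_face[OF card c])
    fix y t
    show "(cmod (p (c + t *\<^sub>R (y - c))))\<^sup>2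
      = (cmod (p c))\<^sup>2 + t * (2 * Re (p c * cnj (p y - p c))) + t\<^sup>2 * (cmod (p y - p c))\<^sup>2"
      unfolding P1_cone[OF p]
      by (simp add: cmod_power2) (simp add: algebra_simps power2_eq_square)
  qed (auto intro!: continuous_intros cont)
  have M: "(LINT x|face_measure (opp_face c). (cmod (p x))\<^sup>2 / (2 * (?d + 1))) \<le> (LINT x|face_measure (opp_face c). (cmod (p c))\<^sup>2 / ?d
          + (2 * Re (p c * cnj (p x - p c))) / (?d + 1) + (cmod (p x - p c))\<^sup>2 / (?d + 2))"
  proof (rule integral_mono)
    show "integrable (face_measure (opp_face c)) (\<lambda>x. (cmod (p x))\<^sup>2 / (2 * (?d + 1)))"
      "integrable (face_measure (opp_face c)) (\<lambda>x. (cmod (p c))\<^sup>2 / ?d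
          + (2 * Re (p c * cnj (p x - p c))) / (?d + 1) + (cmod (p x - p c))\<^sup>2 / (?d + 2))"
      using d by (auto intro!: face_integrable[OF c] continuous_intros cont)
    fix x
    define r1 i1 r2 i2 where "r1 = Re (p c)" and "i1 = Im (p c)" and "r2 = Re (p x) - Re (p c)" and "i2 = Im (p x) - Im (p c)"
    note rdefs = r1_def r2_def i1_def i2_def
    have "(cmod (p x))\<^sup>2 = (r1 + r2)\<^sup>2 + (i1 + i2)\<^sup>2" by (simp add: cmod_power2 rdefs)
    moreover have "(cmod (p c))\<^sup>2 = r1\<^sup>2 + i1\<^sup>2" by (simp add: cmod_power2 rdefs)
    moreover have "(cmod (p x - p c))\<^sup>2 = r2\<^sup>2 + i2\<^sup>2" by (simp add: cmod_power2 rdefs)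
    moreover have "2 * Re (p c * cnj (p x - p c)) = 2 * r1 * r2 + 2 * i1 * i2" by (simp add: rdefs algebra_simps)
    ultimately show "(cmod (p x))\<^sup>2 / (2 * (?d + 1)) \<le> (cmod (p c))\<^sup>2 / ?d
          + (2 * Re (p c * cnj (p x - p c))) / (?d + 1) + (cmod (p x - p c))\<^sup>2 / (?d + 2)"
      using trace_quadratic[OF d, of r1 r2] trace_quadratic[OF d, of i1 i2]
      by (simp only: add_divide_distrib)
  qed
  have "height c * (LINT x|face_measure (opp_face c). (cmod (p x))\<^sup>2 / (2 * (?d + 1))) \<le> (LINT x|lebesgue_on cell. (cmod (p x))\<^sup>2)"
    unfolding E by (rule mult_left_mono[OF M]) (use height_pos[OF c] in simp)
  then have "height c * (LINT x|face_measure (opp_face c). (cmod (p x))\<^sup>2) / (2 * (?d + 1)) \<le> (LINT x|lebesgue_on cell. (cmod (p x))\<^sup>2)"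
    by simp
  then show ?thesis by (simp add: field_simps)
qed

text \<open>
  Both sides are affine in the centre \<open>x\<^sub>0\<close> of the radial field. The general case is the combination
  of the cases where the centre is a vertex, weighted by the barycentric coordinates of \<open>x\<^sub>0\<close>.
\<close>

lemma divergence:
  assumes card: "CARD('n) = 2 \<or> CARD('n) = 3" and p: "p \<in> P1"
  shows "(\<Sum>c\<in>C. (lev c - nrm c \<bullet> x\<^sub>0) * (LINT x|face_measure (opp_face c). (cmod (p x))\<^sup>2))
       = (LINT x|lebesgue_on cell. CARD('n) * (cmod (p x))\<^sup>2 + 2 * Re (cnj (p x) * (p x - p x\<^sub>0)))"
proof -
  note cont = P1_continuous[OF p]
  let ?f = "\<lambda>c x. CARD('n) * (cmod (p x))\<^sup>2 + 2 * Re (cnj (p x) * (p x - p c))"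
  have "(\<Sum>c\<in>C. (lev c - nrm c \<bullet> x\<^sub>0) * (LINT x|face_measure (opp_face c). (cmod (p x))\<^sup>2))
      = (\<Sum>c\<in>C. bary c x\<^sub>0 * (LINT x|lebesgue_on cell. ?f c x))"
  proof (rule sum.cong[OF refl])
    fix c assume c: "c \<in> C"
    have "lev c - nrm c \<bullet> x\<^sub>0 = bary c x\<^sub>0 * height c" using height_pos[OF c] by (simp add: bary_def)
    then show "(lev c - nrm c \<bullet> x\<^sub>0) * (LINT x|face_measure (opp_face c). (cmod (p x))\<^sup>2) = bary c x\<^sub>0 * (LINT x|lebesgue_on cell. ?f c x)"
      using vertex_divergence[OF card c p] by (simp add: mult.assoc)
  qed
  also have "\<dots> = (LINT x|lebesgue_on cell. (\<Sum>c\<in>C. bary c x\<^sub>0 * ?f c x))"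
    by (subst Bochner_Integration.integral_sum)
       (auto intro!: integrable_on_compact compact_cell continuous_intros cont)
  also have "(\<lambda>x. \<Sum>c\<in>C. bary c x\<^sub>0 * ?f c x) = ?f x\<^sub>0"
  proof
    fix x
    have px0: "p x\<^sub>0 = (\<Sum>c\<in>C. of_real (bary c x\<^sub>0) * p c)"
    proof -
      have "(\<Sum>c\<in>C. of_real (bary c x\<^sub>0) * p c) = (\<Sum>c\<in>C. of_real (bary c x\<^sub>0) * p 0 + cdot (grad p 0) (bary c x\<^sub>0 *\<^sub>R c))"
        by (rule sum.cong[OF refl]) (subst P1_affine(1)[OF p, of _ 0], simp add: cdot_linear algebra_simps)
      also have "\<dots> = of_real (\<Sum>c\<in>C. bary c x\<^sub>0) * p 0 + (\<Sum>c\<in>C. cdot (grad p 0) (bary c x\<^sub>0 *\<^sub>R c))"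
        by (simp add: sum.distrib sum_distrib_right)
      also have "(\<Sum>c\<in>C. cdot (grad p 0) (bary c x\<^sub>0 *\<^sub>R c)) = cdot (grad p 0) (\<Sum>c\<in>C. bary c x\<^sub>0 *\<^sub>R c)"
        by (rule cdot_sum[symmetric])
      finally show ?thesis using P1_affine(1)[OF p, of x\<^sub>0 0] by (simp add: bary_repr)
    qed
    define s where "s c = bary c x\<^sub>0" for c
    have s1: "(\<Sum>c\<in>C. s c) = 1" by (simp add: s_def bary_repr)
    have px0': "p x\<^sub>0 = (\<Sum>c\<in>C. of_real (s c) * p c)" unfolding s_def by (rule px0)
    have "(\<Sum>c\<in>C. s c * ?f c x) = (\<Sum>c\<in>C. s c * (CARD('n) * (cmod (p x))\<^sup>2 + 2 * Re (cnj (p x) * p x)) - 2 * Re (cnj (p x) * (of_real (s c) * p c)))"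
      by (rule sum.cong[OF refl]) (simp add: algebra_simps)
    also have "\<dots> = (\<Sum>c\<in>C. s c) * (CARD('n) * (cmod (p x))\<^sup>2 + 2 * Re (cnj (p x) * p x)) - 2 * Re (cnj (p x) * (\<Sum>c\<in>C. of_real (s c) * p c))"
      unfolding sum_subtractf sum_distrib_right sum_distrib_left Re_sum ..
    finally show "(\<Sum>c\<in>C. bary c x\<^sub>0 * ?f c x) = ?f x\<^sub>0 x"
      unfolding s1 px0'[symmetric] s_def[symmetric] by (simp add: right_diff_distrib algebra_simps)
  qed
  finally show ?thesis .
qed

end

lemma simplex_divergence:
  fixes K :: "(real^'n) set"
  assumes card: "CARD('n) = 2 \<or> CARD('n) = 3" and K: "(int CARD('n)) simplex K" and p: "p \<in> P1"
  shows "(\<Sum>e | e facet_of K. facet_offset K e x\<^sub>0 * (LINT x|face_measure e. (cmod (p x))\<^sup>2))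
       = (LINT x|lebesgue_on K. CARD('n) * (cmod (p x))\<^sup>2 + 2 * Re (cnj (p x) * (p x - p x\<^sub>0)))"
proof -
  have "CARD('n) \<ge> 2" using card by auto
  then obtain C where "full_simplex C" and K: "K = full_simplex.cell C"
    using full_simplex_ex[OF K] by metis
  interpret full_simplex C by fact
  have "(\<Sum>e | e facet_of K. facet_offset K e x\<^sub>0 * (LINT x|face_measure e. (cmod (p x))\<^sup>2))
      = (\<Sum>c\<in>C. (lev c - nrm c \<bullet> x\<^sub>0) * (LINT x|face_measure (opp_face c). (cmod (p x))\<^sup>2))"
    unfolding K facets_of_cell by (subst sum.reindex[OF opp_face_inj]) (simp add: facet_offset_opp)
  then show ?thesis using divergence[OF card p] K by simp
qed

section \<open>The minimal angle condition\<close>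

lemma angle_between_ge:
  fixes u v :: "real^'n"
  assumes a: "angle_between u v \<ge> \<theta>" and \<theta>: "0 \<le> \<theta>"
  shows "u \<bullet> v \<le> cos \<theta> * (norm u * norm v)"
proof (cases "u = 0 \<or> v = 0")
  case False
  let ?X = "(u \<bullet> v) / (norm u * norm v)"
  have "\<bar>u \<bullet> v\<bar> \<le> norm u * norm v" by (rule Cauchy_Schwarz_ineq2)
  then have X: "- 1 \<le> ?X" "?X \<le> 1" using False by (auto simp: field_simps abs_le_iff)
  have "cos (arccos ?X) \<le> cos \<theta>"
    using a \<theta> arccos_ubound[OF X] by (intro cos_monotone_0_pi_le) (auto simp: angle_between_def)
  then have "?X \<le> cos \<theta>" using X by simp
  then show ?thesis using False by (simp add: field_simps)
qed auto

text \<open>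
  The point \<open>y\<close> is the foot of the perpendicular from \<open>f\<close> to the line through \<open>q\<close> and \<open>r\<close>. In the
  right triangle \<open>f, y, q\<close> the angle at \<open>q\<close> is at least \<open>\<theta>\<close>.
\<close>

lemma foot_distance:
  fixes f q r y :: "real^'n"
  assumes y: "y = q + s *\<^sub>R (r - q)" and perp: "(f - y) \<bullet> (r - q) = 0" and s: "s \<ge> 0"
    and ang: "angle_between (f - q) (r - q) \<ge> \<theta>" and \<theta>: "0 < \<theta>" "\<theta> \<le> pi / 2" and rq: "r \<noteq> q"
  shows "dist y q * sin \<theta> \<le> dist f y"
proof -
  let ?L = "norm (r - q)" and ?H = "norm (f - y)"
  have L: "?L > 0" using rq by simp
  have c: "cos \<theta> \<ge> 0" using \<theta> by (intro cos_ge_zero) auto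
  have sn: "sin \<theta> \<ge> 0" using \<theta> by (intro sin_ge_zero) auto
  have fq: "f - q = (f - y) + s *\<^sub>R (r - q)" by (simp add: y)
  have "(f - q) \<bullet> (r - q) = s * ?L\<^sup>2"
    unfolding fq inner_add_left inner_scaleR_left perp by (simp add: power2_norm_eq_inner)
  then have "s * ?L\<^sup>2 \<le> cos \<theta> * (norm (f - q) * ?L)" using angle_between_ge[OF ang] \<theta> by simp
  then have 1: "s * ?L \<le> cos \<theta> * norm (f - q)" using L by (simp add: power2_eq_square)
  have 2: "(norm (f - q))\<^sup>2 = ?H\<^sup>2 + (s * ?L)\<^sup>2"
  proof -
    have "(norm (f - q))\<^sup>2 = ?H\<^sup>2 + (norm (s *\<^sub>R (r - q)))\<^sup>2"
      unfolding fq by (rule norm_add_Pythagorean) (simp add: orthogonal_def perp)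
    then show ?thesis by (simp add: power_mult_distrib)
  qed
  have "(s * ?L)\<^sup>2 \<le> (cos \<theta>)\<^sup>2 * (?H\<^sup>2 + (s * ?L)\<^sup>2)"
    unfolding 2[symmetric] power_mult_distrib[symmetric] using 1 s L by (intro power_mono) auto
  then have "(s * ?L)\<^sup>2 * (1 - (cos \<theta>)\<^sup>2) \<le> (cos \<theta>)\<^sup>2 * ?H\<^sup>2" by (simp add: algebra_simps)
  also have "\<dots> \<le> 1 * ?H\<^sup>2" using c by (intro mult_right_mono power_le_one) auto
  finally have "(s * ?L * sin \<theta>)\<^sup>2 \<le> ?H\<^sup>2" by (simp add: sin_squared_eq[symmetric] power_mult_distrib)
  then have "s * ?L * sin \<theta> \<le> ?H" by (rule power2_le_imp_le) simp
  then show ?thesis using s by (simp add: y dist_norm)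
qed

context full_simplex
begin

lemma vertex_extreme: "c \<in> C \<Longrightarrow> c extreme_point_of cell"
  unfolding cell_def using extreme_point_of_convex_hull_affine_independent[OF indep] by simp

text \<open>
  Project \<open>c\<close> to the hyperplane of the opposite facet. The barycentric coordinates of the projection
  add up to 1, so one of them, that of a vertex \<open>f\<close>, is at least \<open>1/d\<close>. Hence the dihedral angle between
  the facets opposite to \<open>c\<close> and to \<open>f\<close> is acute; being at least \<open>\<theta>\<close>, it makes the height of \<open>c\<close>
  comparable to the distance, within the facet, from \<open>f\<close> to the ridge that the two facets share. The
  plane angles of the facet compare this distance with the diameter (\<open>foot_distance\<close>). In the plane the
  ridge is a point and the last step is trivial.
\<close>

lemma height_ge_diameter:
  assumes card: "CARD('n) = 2 \<or> CARD('n) = 3" and ma: "min_angle \<theta> cell"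
    and \<theta>: "0 < \<theta>" "\<theta> \<le> pi / 2" and c: "c \<in> C"
  shows "height c \<ge> (sin \<theta>)\<^sup>2 / (2 * CARD('n)) * diameter (opp_face c)"
proof -
  let ?d = "real CARD('n)"
  have d0: "?d > 0" by simp
  have sn: "0 < sin \<theta>" "sin \<theta> \<le> 1" using \<theta> by (auto intro!: sin_gt_zero)
  \<comment> \<open>the projection of \<open>c\<close> to the hyperplane of the opposite facet\<close>
  define p where "p = c + height c *\<^sub>R nrm c"
  have nn: "nrm a \<bullet> nrm a = 1" if "a \<in> C" for a using opp_face_props(1)[OF that] by (simp add: norm_eq_1)
  have "bary c p = 0" using height_pos[OF c] nn[OF c] by (simp add: bary_def p_def inner_add_right height_def)
  then have sum1: "(\<Sum>a\<in>C-{c}. bary a p) = 1"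
    using bary_repr(1)[of p] finC c by (simp add: sum.remove)
  have cardc: "card (C - {c}) = CARD('n)" using c cardC finC by simp
  have "C - {c} \<noteq> {}" using cardc by (metis card.empty zero_less_card_finite less_irrefl)
  have "\<exists>f\<in>C-{c}. bary f p \<ge> 1 / ?d"
  proof (rule ccontr)
    assume "\<not> ?thesis"
    then have "(\<Sum>a\<in>C-{c}. bary a p) < (\<Sum>a\<in>C-{c}. 1 / ?d)"
      using \<open>C - {c} \<noteq> {}\<close> finC by (intro sum_strict_mono) (auto simp: not_le)
    then show False using sum1 cardc by simp
  qed
  then obtain f where f: "f \<in> C" "f \<noteq> c" "bary f p \<ge> 1 / ?d" by auto
  \<comment> \<open>the cosine of the dihedral angle between the facets opposite to \<open>c\<close> and to \<open>f\<close>\<close>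
  define \<gamma> where "\<gamma> = - (nrm f \<bullet> nrm c)"
  have hf: "height f > 0" using f height_pos by auto
  have "bary f p = height c * \<gamma> / height f"
  proof -
    have "bary f c = 0" using bary_vertex[OF f(1) c] f by simp
    then have "lev f = nrm f \<bullet> c" using hf by (simp add: bary_def)
    then show ?thesis by (simp add: bary_def p_def inner_add_right \<gamma>_def)
  qed
  then have "height c * \<gamma> = height f * bary f p" using hf by simp
  then have hc: "height c * \<gamma> \<ge> height f / ?d" using mult_left_mono[OF f(3), of "height f"] hf by simp
  have "height c * \<gamma> > 0" using hc hf d0 by (smt (verit) divide_pos_pos)
  then have \<gamma>0: "\<gamma> > 0" using height_pos[OF c] by (simp add: zero_less_mult_iff)
  have \<gamma>c: "\<gamma> \<le> cos \<theta>"
  proof -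
    have "opp_face c facet_of cell" "opp_face f facet_of cell" "opp_face c \<noteq> opp_face f"
      using facets_of_cell c f opp_face_inj by (auto simp: inj_on_def)
    then have "pi - angle_between (nrm c) (nrm f) \<ge> \<theta>" using ma unfolding min_angle_def nrm_def by blast
    then have a: "arccos (- \<gamma>) \<le> pi - \<theta>" using opp_face_props(1) c f
      by (simp add: angle_between_def \<gamma>_def inner_commute)
    have "\<bar>nrm f \<bullet> nrm c\<bar> \<le> norm (nrm f) * norm (nrm c)" by (rule Cauchy_Schwarz_ineq2)
    then have g1: "\<gamma> \<le> 1" using opp_face_props(1) c f by (auto simp: \<gamma>_def)
    have "cos (pi - \<theta>) \<le> cos (arccos (- \<gamma>))"
      using a \<theta> g1 \<gamma>0 by (intro cos_monotone_0_pi_le) (auto intro: arccos_lbound)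
    then show ?thesis using g1 \<gamma>0 by simp
  qed
  have \<gamma>1: "\<gamma> \<le> 1" using \<gamma>c cos_le_one[of \<theta>] by linarith
  have g2: "1 - \<gamma>\<^sup>2 \<ge> (sin \<theta>)\<^sup>2"
    using power_mono[OF \<gamma>c, of 2] \<gamma>0 by (simp add: sin_squared_eq)
  have g2pos: "1 - \<gamma>\<^sup>2 > 0" using g2 sn by (smt (verit) zero_less_power)
  \<comment> \<open>the component of \<open>nrm f\<close> within the hyperplane opposite to \<open>c\<close>; along it \<open>y\<close> is the foot of the perpendicular from \<open>f\<close> to the ridge\<close>
  define t where "t = nrm f + \<gamma> *\<^sub>R nrm c"
  define y where "y = f + (height f / (1 - \<gamma>\<^sup>2)) *\<^sub>R t"
  have nfc: "nrm f \<bullet> nrm c = - \<gamma>" "nrm c \<bullet> nrm f = - \<gamma>" by (simp_all add: \<gamma>_def inner_commute)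
  have tt: "nrm c \<bullet> t = 0" "nrm f \<bullet> t = 1 - \<gamma>\<^sup>2"
    using nn[OF c] nn[OF f(1)] by (simp_all add: t_def inner_add_right nfc power2_eq_square)
  have "t \<bullet> t = 1 - \<gamma>\<^sup>2"
    using nn[OF c] nn[OF f(1)] by (simp add: t_def inner_add_left inner_add_right nfc power2_eq_square)
  have lf: "nrm f \<bullet> f = lev f - height f" by (simp add: height_def)
  have lc: "nrm c \<bullet> f = lev c" using on_opp_face[OF c vertex_in_opp_face[OF f(1,2)]] .
  have yf: "nrm f \<bullet> y = lev f" using g2pos by (simp add: y_def inner_add_right tt lf)
  have yc: "nrm c \<bullet> y = lev c" by (simp add: y_def inner_add_right tt lc)
  define H where "H = dist f y"
  have "H\<^sup>2 = (height f)\<^sup>2 / (1 - \<gamma>\<^sup>2)"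
  proof -
    have "H\<^sup>2 = (norm ((height f / (1 - \<gamma>\<^sup>2)) *\<^sub>R t))\<^sup>2" by (simp add: H_def y_def dist_norm)
    also have "\<dots> = (height f / (1 - \<gamma>\<^sup>2))\<^sup>2 * (t \<bullet> t)" unfolding power2_norm_eq_inner by (simp add: power2_eq_square)
    finally show ?thesis using g2pos \<open>t \<bullet> t = 1 - \<gamma>\<^sup>2\<close> by (simp add: power2_eq_square)
  qed
  then have "H\<^sup>2 * (1 - \<gamma>\<^sup>2) = (height f)\<^sup>2" using g2pos by simp
  moreover have "H\<^sup>2 * (sin \<theta>)\<^sup>2 \<le> H\<^sup>2 * (1 - \<gamma>\<^sup>2)" using g2 by (intro mult_left_mono) auto
  ultimately have "(H * sin \<theta>)\<^sup>2 \<le> (height f)\<^sup>2" by (simp add: power_mult_distrib)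
  then have Hh: "H * sin \<theta> \<le> height f" by (rule power2_le_imp_le) (use hf in simp)
  have perp: "(f - y) \<bullet> (r - q) = 0" if "r \<in> C - {c,f}" "q \<in> C - {c,f}" for r q
  proof -
    have "nrm c \<bullet> r = lev c" "nrm c \<bullet> q = lev c" "nrm f \<bullet> r = lev f" "nrm f \<bullet> q = lev f"
      using that on_opp_face vertex_in_opp_face c f by auto
    then have "t \<bullet> (r - q) = 0" by (simp add: t_def inner_add_left inner_diff_right)
    then show ?thesis by (simp add: y_def)
  qed
  have bf: "bary f y = 0" "bary c y = 0" by (simp_all add: bary_def yf yc)
  have yrep: "(\<Sum>a\<in>C-{c,f}. bary a y) = 1" "(\<Sum>a\<in>C-{c,f}. bary a y *\<^sub>R a) = y"
  proof -
    have "(\<Sum>a\<in>C-{c,f}. bary a y) = (\<Sum>a\<in>C. bary a y)" "(\<Sum>a\<in>C-{c,f}. bary a y *\<^sub>R a) = (\<Sum>a\<in>C. bary a y *\<^sub>R a)"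
      using bf finC by (auto intro!: sum.mono_neutral_left)
    then show "(\<Sum>a\<in>C-{c,f}. bary a y) = 1" "(\<Sum>a\<in>C-{c,f}. bary a y *\<^sub>R a) = y" using bary_repr by auto
  qed
  have card2: "card (C - {c,f}) = CARD('n) - 1"
    using c f cardC finC by (simp add: card_Diff_subset)
  have H0: "H \<ge> 0" by (simp add: H_def)
  have near: "dist y a * sin \<theta> \<le> H" if a: "a \<in> C - {c,f}" for a
    using card
  proof
    assume "CARD('n) = 2"
    then obtain q where q: "C - {c,f} = {q}" using card2 card_1_singletonE by auto
    then have "y = q" using yrep by simp
    then show ?thesis using a q H0 by simp
  next
    assume "CARD('n) = 3"
    then have "card (C - {c,f} - {a}) = 1" using card2 a finC by simp
    then obtain r where r: "C - {c,f} - {a} = {r}" using card_1_singletonE by auto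
    then have Cr: "C - {c,f} = {a, r}" "a \<noteq> r" using a by auto
    define s where "s = bary r y"
    have sa: "bary a y = 1 - s" using yrep(1) Cr by (simp add: s_def)
    have y1: "y = a + s *\<^sub>R (r - a)"
      using yrep(2) Cr by (simp add: sa s_def[symmetric] algebra_simps)
    have y2: "y = r + (1 - s) *\<^sub>R (a - r)"
    proof -
      have "(1 - s) *\<^sub>R (a - r) = (a - r) - s *\<^sub>R (a - r)" by (simp add: scaleR_left_diff_distrib)
      moreover have "s *\<^sub>R (r - a) = - (s *\<^sub>R (a - r))" by (simp add: scaleR_right_diff_distrib)
      ultimately show ?thesis unfolding y1 by simp
    qed
    have ang: "angle_between (q' - p') (r' - p') \<ge> \<theta>"
      if "p' \<in> C" "q' \<in> C" "r' \<in> C" "p' \<noteq> q'" "p' \<noteq> r'" "q' \<noteq> r'" for p' q' r'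
      by (rule ma[unfolded min_angle_def, THEN conjunct1, rule_format]) (use that vertex_extreme in simp)
    have in_C: "a \<in> C" "r \<in> C" "f \<noteq> a" "f \<noteq> r" using Cr by auto
    have 1: "dist y a * sin \<theta> \<le> H" if "s \<ge> 0"
      unfolding H_def
      by (rule foot_distance[OF y1 perp that ang \<theta>]) (use Cr in_C f in auto)
    have 2: "dist y r * sin \<theta> \<le> H" if "1 - s \<ge> 0"
      unfolding H_def
      by (rule foot_distance[OF y2 perp that ang \<theta>]) (use Cr in_C f in auto)
    show ?thesis
    proof (cases "s \<ge> 0")
      case False
      have "dist y a = \<bar>s\<bar> * norm (r - a)" by (simp add: y1 dist_norm)
      moreover have "dist y r = \<bar>1 - s\<bar> * norm (r - a)" by (simp add: y2 dist_norm norm_minus_commute)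
      moreover have "\<bar>s\<bar> * norm (r - a) \<le> \<bar>1 - s\<bar> * norm (r - a)" using False by (intro mult_right_mono) auto
      ultimately have "dist y a * sin \<theta> \<le> dist y r * sin \<theta>" using sn by (intro mult_right_mono) auto
      then show ?thesis using 2 False by linarith
    qed (use 1 in simp)
  qed
  define B where "B = 2 * H / sin \<theta>"
  have HB: "H / sin \<theta> + H / sin \<theta> = B" by (simp add: B_def)
  have Hs: "H \<le> H / sin \<theta>" using sn H0 by (simp add: le_divide_eq mult_left_le)
  have near': "dist y a \<le> H / sin \<theta>" if "a \<in> C - {c,f}" for a
    using near[OF that] sn by (simp add: le_divide_eq)
  have pair: "dist a a' \<le> B" if "a \<in> C - {c}" "a' \<in> C - {c}" for a a'
  proof -
    have *: "dist y a \<le> H / sin \<theta>" if "a \<in> C - {c}" for a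
      using that near'[of a] Hs by (cases "a = f") (auto simp: H_def dist_commute)
    have "dist a a' \<le> dist y a + dist y a'" by (metis dist_commute dist_triangle)
    then show ?thesis using *[OF that(1)] *[OF that(2)] HB by linarith
  qed
  have "diameter (opp_face c) \<le> B"
  proof (rule diameter_le)
    show "opp_face c \<noteq> {} \<or> 0 \<le> B" using opp_face_nonempty by simp
    fix x z assume "x \<in> opp_face c" "z \<in> opp_face c"
    then obtain u v where "u \<in> C - {c}" "v \<in> C - {c}" "norm (x - z) \<le> norm (u - v)"
      unfolding opp_face_def using simplex_extremal_le_exists[of "C - {c}" x z] finC by blast
    then show "norm (x - z) \<le> B" using pair[of u v] by (simp add: dist_norm)
  qed
  then have "(sin \<theta>)\<^sup>2 / (2 * ?d) * diameter (opp_face c) \<le> (sin \<theta>)\<^sup>2 / (2 * ?d) * B"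
    by (intro mult_left_mono) auto
  also have "\<dots> = H * sin \<theta> / ?d" using sn by (simp add: B_def power2_eq_square)
  also have "\<dots> \<le> height f / ?d" using Hh by (intro divide_right_mono) auto
  also have "\<dots> \<le> height c * \<gamma>" by (rule hc)
  also have "\<dots> \<le> height c" using \<gamma>1 \<gamma>0 height_pos[OF c] by (simp add: mult_left_le)
  finally show ?thesis by simp
qed

end

lemma facet_trace:
  fixes K :: "(real^'n) set"
  assumes card: "CARD('n) = 2 \<or> CARD('n) = 3" and K: "(int CARD('n)) simplex K"
    and ma: "min_angle \<theta> K" and \<theta>: "0 < \<theta>" "\<theta> \<le> pi / 2" and e: "e facet_of K" and p: "p \<in> P1"
  shows "diameter e > 0"
    "(LINT x|face_measure e. (cmod (p x))\<^sup>2)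
      \<le> (4 * CARD('n) * (CARD('n) + 1) / (sin \<theta>)\<^sup>2) / diameter e * (LINT x|lebesgue_on K. (cmod (p x))\<^sup>2)"
proof -
  have "CARD('n) \<ge> 2" using card by auto
  then obtain C where "full_simplex C" and KC: "K = full_simplex.cell C"
    using full_simplex_ex[OF K] by metis
  interpret full_simplex C by fact
  obtain c where c: "c \<in> C" and ec: "e = opp_face c" using e facets_of_cell KC by blast
  have sn: "sin \<theta> > 0" using \<theta> by (intro sin_gt_zero) auto
  show diam: "diameter e > 0"
  proof -
    have "card (C - {c}) \<ge> 2" using c cardC finC dim2 by simp
    then obtain a b where "a \<in> C - {c}" "b \<in> C - {c}" "a \<noteq> b"
      by (metis card_le_Suc0_iff_eq finC finite_Diff not_less_eq_eq numeral_2_eq_2)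
    then have "dist a b \<le> diameter e"
      unfolding ec by (intro diameter_bounded_bound compact_imp_bounded compact_opp_face vertex_in_opp_face) auto
    then show ?thesis using \<open>a \<noteq> b\<close> by (smt (verit) zero_less_dist_iff)
  qed
  let ?I = "LINT x|face_measure e. (cmod (p x))\<^sup>2"
  have h: "(sin \<theta>)\<^sup>2 / (2 * CARD('n)) * diameter e \<le> height c"
    unfolding ec by (rule height_ge_diameter[OF card ma[unfolded KC] \<theta> c])
  have "?I \<ge> 0" by simp
  then have "(sin \<theta>)\<^sup>2 / (2 * CARD('n)) * diameter e * ?I \<le> height c * ?I" by (rule mult_right_mono[OF h])
  also have "\<dots> \<le> 2 * (CARD('n) + 1) * (LINT x|lebesgue_on K. (cmod (p x))\<^sup>2)"
    unfolding ec KC by (rule vertex_trace[OF card c p])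
  finally have "(sin \<theta>)\<^sup>2 * diameter e * ?I \<le> 4 * CARD('n) * (CARD('n) + 1) * (LINT x|lebesgue_on K. (cmod (p x))\<^sup>2)"
    by (simp add: field_simps)
  then show "?I \<le> (4 * CARD('n) * (CARD('n) + 1) / (sin \<theta>)\<^sup>2) / diameter e * (LINT x|lebesgue_on K. (cmod (p x))\<^sup>2)"
    using sn diam by (simp add: field_simps)
qed

section \<open>Faces of a simplicial mesh\<close>

locale simplicial_mesh =
  fixes \<T> :: "(real^'n) set set" and lab :: "(real^'n) set \<Rightarrow> nat"
  assumes dim: "CARD('n) = 2 \<or> CARD('n) = 3"
    and tri: "triangulation \<T>" and simplices: "\<And>K. K \<in> \<T> \<Longrightarrow> (int CARD('n)) simplex K"
    and inj_lab: "inj_on lab \<T>"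
begin

lemma dim2: "CARD('n) \<ge> 2" using dim by auto

lemma finite_mesh: "finite \<T>" using tri by (simp add: triangulation_def)

lemma cell_compact_convex: "K \<in> \<T> \<Longrightarrow> compact K" "K \<in> \<T> \<Longrightarrow> convex K" "K \<in> \<T> \<Longrightarrow> K \<noteq> {}"
proof -
  assume "K \<in> \<T>"
  then obtain C where "\<not> affine_dependent C" "int (card C) = int CARD('n) + 1" "K = convex hull C"
    using simplices unfolding simplex_def by blast
  moreover have "finite C" "C \<noteq> {}" using calculation aff_independent_finite by auto
  ultimately show "compact K" "convex K" "K \<noteq> {}" by (auto intro: compact_convex_hull finite_imp_compact)
qed

lemma aff_dim_cell: "K \<in> \<T> \<Longrightarrow> aff_dim K = int CARD('n)"
  using simplices aff_dim_simplex by blast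

lemma facet_rel_interior: "K \<in> \<T> \<Longrightarrow> e facet_of K \<Longrightarrow> \<exists>x. x \<in> rel_interior e"
  using facet_normal_props(4,5)[OF simplices dim2] rel_interior_eq_empty by blast

text \<open>
  The intersection of two cells is a face of both. Once it contains a relative interior point of \<open>e\<close>, it
  contains \<open>e\<close>, and for reasons of dimension it is not larger.
\<close>

lemma shared_facet:
  assumes K: "K \<in> \<T>" and K': "K' \<in> \<T>" and neq: "K \<noteq> K'" and e: "e facet_of K"
    and x: "x \<in> rel_interior e" "x \<in> K'"
  shows "e = K \<inter> K'" "e facet_of K'"
proof -
  have F1: "K \<inter> K' face_of K" and F2: "K \<inter> K' face_of K'"
    using tri K K' unfolding triangulation_def by (blast, metis Int_commute)
  have eK: "e \<subseteq> K" using e facet_of_imp_subset by blast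
  have "x \<in> e" using x rel_interior_subset by auto
  then have "(K \<inter> K') \<inter> rel_interior e \<noteq> {}" using x eK by auto
  then have sub: "e \<subseteq> K \<inter> K'" using subset_of_face_of[OF F1 eK] by blast
  have neqK: "K \<inter> K' \<noteq> K"
  proof
    assume "K \<inter> K' = K"
    then have "aff_dim K < aff_dim K'" using face_of_aff_dim_lt[OF cell_compact_convex(2)[OF K'] F2] neq by metis
    then show False using aff_dim_cell K K' by simp
  qed
  have "aff_dim (K \<inter> K') < aff_dim K" using face_of_aff_dim_lt[OF cell_compact_convex(2)[OF K] F1 neqK] .
  moreover have "aff_dim e = aff_dim K - 1" using e by (simp add: facet_of_def)
  moreover have "aff_dim e \<le> aff_dim (K \<inter> K')" by (rule aff_dim_subset[OF sub])
  ultimately have ad: "aff_dim e = aff_dim (K \<inter> K')" by linarith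
  have "e face_of K \<inter> K'" using e sub by (meson facet_of_imp_face_of face_of_subset inf_le1)
  then show eq: "e = K \<inter> K'"
    using face_of_aff_dim_lt[OF convex_Int[OF cell_compact_convex(2)[OF K] cell_compact_convex(2)[OF K']]] ad by force
  show "e facet_of K'"
    using F2 e ad aff_dim_cell K K' unfolding facet_of_def eq by auto
qed

text \<open>
  Two cells with the same outward normal at \<open>e\<close> would contain a common half ball, but they meet only
  in \<open>e\<close>.
\<close>

lemma opposite_normals:
  assumes K: "K \<in> \<T>" and K': "K' \<in> \<T>" and neq: "K \<noteq> K'" and e: "e facet_of K" "e facet_of K'"
  shows "outer_normal K' e = - outer_normal K e"
proof -
  note P = facet_normal_props[OF simplices[OF K] dim2 e(1)]
  note P' = facet_normal_props[OF simplices[OF K'] dim2 e(2)]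
  obtain x where x: "x \<in> rel_interior e" using facet_rel_interior[OF K e(1)] by auto
  have xe: "x \<in> e" using x rel_interior_subset by auto
  have "outer_normal K' e = outer_normal K e \<or> outer_normal K' e = - outer_normal K e"
    by (rule hyperplane_unit_normal[OF P(1) P'(1)]) (rule equalityD1[OF trans[OF P(2)[symmetric] P'(2)]])
  moreover have "outer_normal K' e \<noteq> outer_normal K e"
  proof
    assume same: "outer_normal K' e = outer_normal K e"
    let ?n = "outer_normal K e"
    obtain r r' where r: "r > 0" "\<forall>y\<in>ball x r. y \<in> K \<longleftrightarrow> ?n \<bullet> (y - x) \<le> 0"
      and r': "r' > 0" "\<forall>y\<in>ball x r'. y \<in> K' \<longleftrightarrow> ?n \<bullet> (y - x) \<le> 0"
      using P(7)[OF x] P'(7)[OF x] same by auto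
    define s where "s = min r r' / 2"
    have s: "s > 0" "s < r" "s < r'" using r(1) r'(1) by (auto simp: s_def min_def)
    define y where "y = x - s *\<^sub>R ?n"
    have nn: "?n \<bullet> ?n = 1" using P(1) by (simp add: norm_eq_1)
    have "y \<in> ball x r" "y \<in> ball x r'" using s P(1) by (auto simp: y_def dist_norm)
    moreover have ny: "?n \<bullet> (y - x) = - s" by (simp add: y_def nn)
    ultimately have "y \<in> K" "y \<in> K'" using r(2) r'(2) s(1) by auto
    then have "y \<in> e"
      using shared_facet(1)[OF K K' neq e(1) x] e(2) xe facet_of_imp_subset by blast
    then have "?n \<bullet> (y - x) = 0" using P(6)[of y x] P(6)[of x x] xe by simp
    then show False using ny s by simp
  qed
  ultimately show ?thesis by blast
qed

definition cells_at :: "(real^'n) set \<Rightarrow> (real^'n) set set" where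
  "cells_at e = {K \<in> \<T>. e facet_of K}"

lemma finite_cells_at: "finite (cells_at e)" using finite_mesh by (simp add: cells_at_def)

lemma cell_hi_lo_in:
  assumes "cells_at e \<noteq> {}"
  shows "cell_hi \<T> lab e \<in> cells_at e" "cell_lo \<T> lab e \<in> cells_at e"
    "\<And>K. K \<in> cells_at e \<Longrightarrow> lab (cell_lo \<T> lab e) \<le> lab K \<and> lab K \<le> lab (cell_hi \<T> lab e)"
proof -
  obtain K where K: "K \<in> cells_at e" using assms by auto
  obtain b where "\<forall>y. y \<in> cells_at e \<longrightarrow> lab y < b"
  proof
    show "\<forall>y. y \<in> cells_at e \<longrightarrow> lab y < Suc (Max (lab ` cells_at e))"
      using finite_cells_at by (auto simp: less_Suc_eq_le)
  qed
  note b = this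
  show "cell_hi \<T> lab e \<in> cells_at e"
    unfolding cell_hi_def cells_at_def[symmetric] arg_max_on_def
    by (rule arg_max_natI[of "\<lambda>x. x \<in> cells_at e", OF K b])
  show "cell_lo \<T> lab e \<in> cells_at e"
    unfolding cell_lo_def cells_at_def[symmetric]
    by (rule arg_min_if_finite(1)[OF finite_cells_at assms])
  fix K' assume K': "K' \<in> cells_at e"
  have "lab K' \<le> lab (cell_hi \<T> lab e)"
    unfolding cell_hi_def cells_at_def[symmetric] arg_max_on_def
    by (rule arg_max_nat_le[of "\<lambda>x. x \<in> cells_at e", OF K' b])
  moreover have "lab (cell_lo \<T> lab e) \<le> lab K'"
    unfolding cell_lo_def cells_at_def[symmetric]
    using arg_min_if_finite(2)[OF finite_cells_at assms, of lab] K' by (auto simp: not_less)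
  ultimately show "lab (cell_lo \<T> lab e) \<le> lab K' \<and> lab K' \<le> lab (cell_hi \<T> lab e)" by simp
qed

lemma interior_face_iff: "e \<in> interior_faces \<T> \<longleftrightarrow> (\<exists>K\<in>cells_at e. \<exists>K'\<in>cells_at e. K \<noteq> K')"
proof
  assume "\<exists>K\<in>cells_at e. \<exists>K'\<in>cells_at e. K \<noteq> K'"
  then obtain K K' where KK: "K \<in> \<T>" "K' \<in> \<T>" "e facet_of K" "e facet_of K'" "K \<noteq> K'"
    by (auto simp: cells_at_def)
  obtain x where x: "x \<in> rel_interior e" using facet_rel_interior KK by blast
  then have "x \<in> K'" using rel_interior_subset facet_of_imp_subset[OF KK(4)] by blast
  then have "e = K \<inter> K'" using shared_facet(1) KK x by blast
  then show "e \<in> interior_faces \<T>" using KK unfolding interior_faces_def by blast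
qed (auto simp: interior_faces_def cells_at_def)

text \<open>
  Of three cells with a common facet, two would have the same outward normal there.
\<close>

lemma interior_face_cells:
  assumes e: "e \<in> interior_faces \<T>"
  shows "cells_at e = {cell_hi \<T> lab e, cell_lo \<T> lab e}" "cell_hi \<T> lab e \<noteq> cell_lo \<T> lab e"
    "outer_normal (cell_lo \<T> lab e) e = - outer_normal (cell_hi \<T> lab e) e"
proof -
  obtain K K' where KK: "K \<in> cells_at e" "K' \<in> cells_at e" "K \<noteq> K'" using e interior_face_iff by auto
  then have ne: "cells_at e \<noteq> {}" by auto
  note hl = cell_hi_lo_in[OF ne]
  show neq: "cell_hi \<T> lab e \<noteq> cell_lo \<T> lab e"
  proof
    assume "cell_hi \<T> lab e = cell_lo \<T> lab e"
    then have "lab K = lab K'" using hl(3)[OF KK(1)] hl(3)[OF KK(2)] by simp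
    then show False using KK inj_lab by (auto simp: cells_at_def inj_on_def)
  qed
  have mem: "A \<in> \<T>" "e facet_of A" if "A \<in> cells_at e" for A using that by (auto simp: cells_at_def)
  have opp: "outer_normal B e = - outer_normal A e" if "A \<in> cells_at e" "B \<in> cells_at e" "A \<noteq> B" for A B
    by (rule opposite_normals[OF mem(1)[OF that(1)] mem(1)[OF that(2)] that(3) mem(2)[OF that(1)] mem(2)[OF that(2)]])
  show "outer_normal (cell_lo \<T> lab e) e = - outer_normal (cell_hi \<T> lab e) e" using opp hl neq by blast
  have "A = cell_hi \<T> lab e \<or> A = cell_lo \<T> lab e" if A: "A \<in> cells_at e" for A
  proof (rule ccontr)
    assume "\<not> ?thesis"
    then have "outer_normal A e = - outer_normal (cell_hi \<T> lab e) e" "outer_normal A e = - outer_normal (cell_lo \<T> lab e) e"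
      "outer_normal (cell_lo \<T> lab e) e = - outer_normal (cell_hi \<T> lab e) e"
      using opp[of "cell_hi \<T> lab e" A] opp[of "cell_lo \<T> lab e" A] opp[of "cell_hi \<T> lab e" "cell_lo \<T> lab e"] A hl neq by auto
    then have "outer_normal A e = 0" by (simp add: eq_neg_iff_add_eq_0 flip: scaleR_2)
    then show False using facet_normal_props(1)[OF simplices dim2, of A e] mem[OF A] by simp
  qed
  then show "cells_at e = {cell_hi \<T> lab e, cell_lo \<T> lab e}" using hl by auto
qed

lemma boundary_face_cells:
  assumes "e \<notin> interior_faces \<T>" "K \<in> \<T>" "e facet_of K"
  shows "cells_at e = {cell_hi \<T> lab e}" "K = cell_hi \<T> lab e"
proof -
  have K: "K \<in> cells_at e" using assms by (simp add: cells_at_def)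
  then have "cell_hi \<T> lab e \<in> cells_at e" using cell_hi_lo_in by blast
  moreover have "A = K" if "A \<in> cells_at e" for A using that K assms(1) interior_face_iff by blast
  ultimately show "cells_at e = {cell_hi \<T> lab e}" "K = cell_hi \<T> lab e" using K by auto
qed

text \<open>
  No other cell contains \<open>x\<close>, so near \<open>x\<close> the mesh consists of \<open>K\<close> alone.
\<close>

lemma boundary_half_ball:
  assumes e: "e \<notin> interior_faces \<T>" and K: "K \<in> \<T>" "e facet_of K" and x: "x \<in> rel_interior e"
  shows "\<exists>r>0. \<forall>y\<in>ball x r. y \<in> \<Union>\<T> \<longleftrightarrow> outer_normal K e \<bullet> (y - x) \<le> 0"
proof -
  have cl: "closed (\<Union>(\<T> - {K}))"
    using finite_mesh cell_compact_convex(1) compact_imp_closed by (intro closed_Union) auto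
  have "x \<notin> \<Union>(\<T> - {K})"
  proof
    assume "x \<in> \<Union>(\<T> - {K})"
    then obtain K' where K': "K' \<in> \<T>" "K \<noteq> K'" "x \<in> K'" by auto
    then have "e facet_of K'" using shared_facet(2)[OF K(1) K'(1,2) K(2) x] by simp
    then have "e \<in> interior_faces \<T>" unfolding interior_face_iff cells_at_def using K K' by blast
    then show False using e by simp
  qed
  then obtain r1 where r1: "r1 > 0" "ball x r1 \<subseteq> - \<Union>(\<T> - {K})"
    using open_contains_ball[THEN iffD1, OF open_Compl[OF cl]] by (metis ComplI)
  obtain r where r: "r > 0" "\<forall>y\<in>ball x r. y \<in> K \<longleftrightarrow> outer_normal K e \<bullet> (y - x) \<le> 0"
    using facet_normal_props(7)[OF simplices[OF K(1)] dim2 K(2) x] by blast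
  have "y \<in> \<Union>\<T> \<longleftrightarrow> outer_normal K e \<bullet> (y - x) \<le> 0" if "y \<in> ball x (min r r1)" for y
  proof -
    have y: "y \<in> ball x r" "y \<in> ball x r1" using that by auto
    then have "y \<in> \<Union>\<T> \<longleftrightarrow> y \<in> K" using r1(2) K(1) by blast
    then show ?thesis using r(2) y by blast
  qed
  then show ?thesis using r(1) r1(1) by (intro exI[of _ "min r r1"]) auto
qed

lemma interior_face_interior:
  assumes e: "e \<in> interior_faces \<T>" and x: "x \<in> rel_interior e"
  shows "x \<in> interior (\<Union>\<T>)"
proof -
  obtain K K' where KK: "K \<in> \<T>" "K' \<in> \<T>" "K \<noteq> K'" "e facet_of K" "e facet_of K'"
    using e by (auto simp: interior_faces_def)
  obtain r r' where r: "r > 0" "\<forall>y\<in>ball x r. y \<in> K \<longleftrightarrow> outer_normal K e \<bullet> (y - x) \<le> 0"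
    and r': "r' > 0" "\<forall>y\<in>ball x r'. y \<in> K' \<longleftrightarrow> outer_normal K' e \<bullet> (y - x) \<le> 0"
    using facet_normal_props(7)[OF simplices[OF KK(1)] dim2 KK(4) x]
      facet_normal_props(7)[OF simplices[OF KK(2)] dim2 KK(5) x] by blast
  have "ball x (min r r') \<subseteq> \<Union>\<T>"
  proof
    fix y assume "y \<in> ball x (min r r')"
    then have y: "y \<in> ball x r" "y \<in> ball x r'" by auto
    have "outer_normal K e \<bullet> (y - x) \<le> 0 \<or> outer_normal K' e \<bullet> (y - x) \<le> 0"
      using opposite_normals[OF KK] by auto
    then show "y \<in> \<Union>\<T>" using r r' y KK by blast
  qed
  then show ?thesis using r(1) r'(1) by (meson interior_maximal open_ball centre_in_ball min_less_iff_conj subsetD)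
qed

end

section \<open>The mesh and the boundary of the domain\<close>

locale scattering_mesh = simplicial_mesh \<T> lab
  for \<T> :: "(real^'n) set set" and lab +
  fixes \<Omega>\<^sub>1 D :: "(real^'n) set" and x\<^sub>0 c\<^sub>\<Omega> c\<^sub>D
  assumes dom: "scattering_domain \<Omega>\<^sub>1 D x\<^sub>0 c\<^sub>\<Omega> c\<^sub>D" and cover: "\<Union>\<T> = closure (\<Omega>\<^sub>1 - D)"
begin

abbreviation "\<I> \<equiv> interior_faces \<T>"
abbreviation "\<R> \<equiv> faces_on \<T> (frontier \<Omega>\<^sub>1)"
abbreviation "\<D> \<equiv> faces_on \<T> (frontier D)"

lemma domain_facts: "open \<Omega>\<^sub>1" "interior (closure \<Omega>\<^sub>1) = \<Omega>\<^sub>1" "D \<subseteq> \<Omega>\<^sub>1" "bounded \<Omega>\<^sub>1"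
  using dom by (auto simp: scattering_domain_def polyhedral_domain_def)

lemma scatterer_closed: "closed D" and scatterer_regular: "D \<subseteq> closure (interior D)"
proof -
  obtain F where F: "finite F" "\<And>P. P \<in> F \<Longrightarrow> polytope P \<and> interior P \<noteq> {}" "D = \<Union>F"
    using dom unfolding scattering_domain_def polyhedral_set_def by blast
  show "closed D" unfolding F(3) using F(1,2) polytope_imp_closed by (intro closed_Union) auto
  show "D \<subseteq> closure (interior D)"
  proof
    fix x assume "x \<in> D"
    then obtain P where P: "P \<in> F" "x \<in> P" using F(3) by auto
    have "closure (interior P) = closure P" using F(2)[OF P(1)] polytope_imp_convex convex_closure_interior by blast
    then have "x \<in> closure (interior P)" using P closure_subset by blast
    moreover have "interior P \<subseteq> interior D" using P F(3) by (intro interior_mono) auto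
    ultimately show "x \<in> closure (interior D)" using closure_mono by blast
  qed
qed

lemma open_domain: "open (\<Omega>\<^sub>1 - D)" using domain_facts scatterer_closed by auto

lemma closure_disjoint: "closure (\<Omega>\<^sub>1 - D) \<inter> interior D = {}"
  using interior_subset[of D] open_Int_closure_eq_empty[of "interior D" "\<Omega>\<^sub>1 - D"] by (auto simp: Int_commute)

text \<open>
  A point of \<open>D\<close> is a limit of interior points of \<open>D\<close>, and these are not in the closure of the domain.
  So taking the closure does not add interior points.
\<close>

lemma interior_closure_domain: "interior (closure (\<Omega>\<^sub>1 - D)) = \<Omega>\<^sub>1 - D"
proof
  show "\<Omega>\<^sub>1 - D \<subseteq> interior (closure (\<Omega>\<^sub>1 - D))"
    by (rule interior_maximal[OF closure_subset open_domain])
  show "interior (closure (\<Omega>\<^sub>1 - D)) \<subseteq> \<Omega>\<^sub>1 - D"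
  proof
    fix y assume y: "y \<in> interior (closure (\<Omega>\<^sub>1 - D))"
    have "interior (closure (\<Omega>\<^sub>1 - D)) \<subseteq> interior (closure \<Omega>\<^sub>1)" by (intro interior_mono closure_mono) auto
    then have "y \<in> \<Omega>\<^sub>1" using y domain_facts by auto
    moreover have "y \<notin> D"
    proof
      assume "y \<in> D"
      then have "y \<in> closure (interior D)" using scatterer_regular by auto
      then have "interior (closure (\<Omega>\<^sub>1 - D)) \<inter> interior D \<noteq> {}"
        using y open_Int_closure_eq_empty[OF open_interior] by blast
      then show False using closure_disjoint interior_subset by blast
    qed
    ultimately show "y \<in> \<Omega>\<^sub>1 - D" by simp
  qed
qed

lemma frontier_disjoint: "frontier \<Omega>\<^sub>1 \<inter> frontier D = {}" "frontier \<Omega>\<^sub>1 \<inter> \<Omega>\<^sub>1 = {}" "frontier D \<subseteq> D"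
  using domain_facts scatterer_closed frontier_subset_closed frontier_disjoint_eq by blast+

lemma faces_on_boundary:
  assumes "e \<in> \<R> \<or> e \<in> \<D>"
  shows "e \<notin> \<I>"
proof
  assume e: "e \<in> \<I>"
  obtain K where K: "K \<in> \<T>" "e facet_of K" using assms by (auto simp: faces_on_def)
  then obtain x where x: "x \<in> rel_interior e" using facet_rel_interior by blast
  then have "x \<in> \<Omega>\<^sub>1 - D" using interior_face_interior[OF e x] by (simp add: cover interior_closure_domain)
  moreover have "x \<in> e" using x rel_interior_subset by auto
  ultimately show False using assms frontier_disjoint by (auto simp: faces_on_def)
qed

lemma faces_R_D_disjoint: "\<R> \<inter> \<D> = {}"
proof -
  have "e \<noteq> {}" if "e \<in> \<R>" for e using that facet_normal_props(5)[OF simplices dim2] by (auto simp: faces_on_def)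
  then show ?thesis using frontier_disjoint(1) unfolding faces_on_def by blast
qed

text \<open>
  The relative interior of \<open>e\<close> is connected and lies in the union of the two boundary parts, which are
  closed and disjoint.
\<close>

lemma boundary_face_cases:
  assumes e: "e \<notin> \<I>" and K: "K \<in> \<T>" "e facet_of K"
  shows "e \<in> \<R> \<or> e \<in> \<D>"
proof -
  note P = facet_normal_props[OF simplices[OF K(1)] dim2 K(2)]
  have pt: "x \<in> frontier \<Omega>\<^sub>1 \<union> frontier D" if x: "x \<in> rel_interior e" for x
  proof -
    let ?n = "outer_normal K e"
    obtain r where r: "r > 0" "\<forall>y\<in>ball x r. y \<in> closure (\<Omega>\<^sub>1 - D) \<longleftrightarrow> ?n \<bullet> (y - x) \<le> 0"
      using boundary_half_ball[OF e K x] by (auto simp: cover)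
    have xc: "x \<in> closure (\<Omega>\<^sub>1 - D)" using r by auto
    have "x \<notin> interior (closure (\<Omega>\<^sub>1 - D))"
    proof
      assume "x \<in> interior (closure (\<Omega>\<^sub>1 - D))"
      then obtain s where s: "s > 0" "ball x s \<subseteq> closure (\<Omega>\<^sub>1 - D)" using mem_interior by blast
      define t where "t = min r s / 2"
      have t: "t > 0" "t < r" "t < s" using r(1) s(1) by (auto simp: t_def min_def)
      have nn: "?n \<bullet> ?n = 1" using P(1) by (simp add: norm_eq_1)
      have "x + t *\<^sub>R ?n \<in> ball x r" "x + t *\<^sub>R ?n \<in> ball x s" using t P(1) by (auto simp: dist_norm)
      then have "?n \<bullet> ((x + t *\<^sub>R ?n) - x) \<le> 0" using r(2) s(2) by blast
      then show False using t nn by simp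
    qed
    then have xn: "x \<notin> \<Omega>\<^sub>1 - D" by (simp add: interior_closure_domain)
    have x1: "x \<in> closure \<Omega>\<^sub>1" using xc closure_mono[of "\<Omega>\<^sub>1 - D" \<Omega>\<^sub>1] by auto
    show ?thesis
    proof (cases "x \<in> \<Omega>\<^sub>1")
      case True
      then have "x \<in> D" using xn by simp
      moreover have "x \<notin> interior D" using xc closure_disjoint by auto
      ultimately show ?thesis using scatterer_closed by (simp add: frontier_def closure_closed)
    next
      case False
      then show ?thesis using x1 domain_facts(1) by (simp add: frontier_def interior_open)
    qed
  qed
  have conn: "connected (rel_interior e)" by (intro convex_connected convex_rel_interior P(4))
  have sub: "rel_interior e \<subseteq> frontier \<Omega>\<^sub>1 \<union> frontier D" using pt by auto
  have "frontier \<Omega>\<^sub>1 \<inter> frontier D \<inter> rel_interior e = {}" using frontier_disjoint(1) by blast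
  then have "frontier \<Omega>\<^sub>1 \<inter> rel_interior e = {} \<or> frontier D \<inter> rel_interior e = {}"
    by (rule connected_closedD[OF conn]) (use sub in auto)
  then have "rel_interior e \<subseteq> frontier D \<or> rel_interior e \<subseteq> frontier \<Omega>\<^sub>1" using pt by blast
  moreover have "closure (rel_interior e) = e"
    using convex_closure_rel_interior[OF P(4)] P(3) compact_imp_closed closure_closed by metis
  ultimately have "e \<subseteq> frontier D \<or> e \<subseteq> frontier \<Omega>\<^sub>1" by (metis closure_minimal frontier_closed)
  then show ?thesis using K by (auto simp: faces_on_def)
qed

lemma outer_boundary_offset:
  assumes e: "e \<in> \<R>"
  shows "facet_offset (cell_hi \<T> lab e) e x\<^sub>0 \<ge> c\<^sub>\<Omega>"
proof -
  obtain K where K: "K \<in> \<T>" "e facet_of K" "e \<subseteq> frontier \<Omega>\<^sub>1" using e by (auto simp: faces_on_def)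
  have eI: "e \<notin> \<I>" using faces_on_boundary e by blast
  have KK: "K = cell_hi \<T> lab e" using boundary_face_cells[OF eI K(1,2)] by simp
  note P = facet_normal_props[OF simplices[OF K(1)] dim2 K(2)]
  obtain x where x: "x \<in> rel_interior e" using facet_rel_interior K by blast
  have xe: "x \<in> e" using x rel_interior_subset by auto
  obtain r where r: "r > 0" "\<forall>y\<in>ball x r. y \<in> closure (\<Omega>\<^sub>1 - D) \<longleftrightarrow> outer_normal K e \<bullet> (y - x) \<le> 0"
    using boundary_half_ball[OF eI K(1,2) x] by (auto simp: cover)
  then have "outward_normal (\<Omega>\<^sub>1 - D) x (outer_normal K e)" using P(1) unfolding outward_normal_def by blast
  then have "(x - x\<^sub>0) \<bullet> outer_normal K e \<ge> c\<^sub>\<Omega>"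
    using dom xe K(3) unfolding scattering_domain_def by blast
  then show ?thesis using P(6)[OF xe] KK by (simp add: inner_commute)
qed

text \<open>
  Near a relative interior point of \<open>e\<close> the scatterer is the half space complementary to the domain, so
  its outward normal is the negative of that of the cell.
\<close>

lemma scatterer_offset:
  assumes e: "e \<in> \<D>"
  shows "- facet_offset (cell_hi \<T> lab e) e x\<^sub>0 \<ge> c\<^sub>D"
proof -
  obtain K where K: "K \<in> \<T>" "e facet_of K" "e \<subseteq> frontier D" using e by (auto simp: faces_on_def)
  have eI: "e \<notin> \<I>" using faces_on_boundary e by blast
  have KK: "K = cell_hi \<T> lab e" using boundary_face_cells[OF eI K(1,2)] by simp
  note P = facet_normal_props[OF simplices[OF K(1)] dim2 K(2)]
  let ?n = "outer_normal K e"
  obtain x where x: "x \<in> rel_interior e" using facet_rel_interior K by blast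
  have xe: "x \<in> e" using x rel_interior_subset by auto
  obtain r where r: "r > 0" "\<forall>y\<in>ball x r. y \<in> closure (\<Omega>\<^sub>1 - D) \<longleftrightarrow> ?n \<bullet> (y - x) \<le> 0"
    using boundary_half_ball[OF eI K(1,2) x] by (auto simp: cover)
  have "x \<in> \<Omega>\<^sub>1" using xe K(3) frontier_disjoint(3) domain_facts by auto
  then obtain s where s: "s > 0" "ball x s \<subseteq> \<Omega>\<^sub>1" using domain_facts(1) open_contains_ball by blast
  define t where "t = min r s"
  have t: "t > 0" "ball x t \<subseteq> ball x r" "ball x t \<subseteq> \<Omega>\<^sub>1" using r(1) s by (auto simp: t_def)
  have pos: "y \<in> D" if y: "y \<in> ball x t" "?n \<bullet> (y - x) > 0" for y
  proof -
    have "y \<notin> closure (\<Omega>\<^sub>1 - D)" using y t(2) r(2) by force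
    then show ?thesis using y t(3) closure_subset by blast
  qed
  have "y \<in> closure D \<longleftrightarrow> (- ?n) \<bullet> (y - x) \<le> 0" if y: "y \<in> ball x t" for y
  proof
    assume "y \<in> closure D"
    then have "y \<in> closure (interior D)" using scatterer_regular scatterer_closed by auto
    show "(- ?n) \<bullet> (y - x) \<le> 0"
    proof (rule ccontr)
      assume "\<not> ?thesis"
      then have "?n \<bullet> (y - x) < 0" by simp
      moreover have "open {z. ?n \<bullet> (z - x) < 0}" by (intro open_Collect_less continuous_intros)
      ultimately have "open (ball x t \<inter> {z. ?n \<bullet> (z - x) < 0})" "y \<in> ball x t \<inter> {z. ?n \<bullet> (z - x) < 0}" using y by auto
      then have "(ball x t \<inter> {z. ?n \<bullet> (z - x) < 0}) \<inter> interior D \<noteq> {}"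
        using open_Int_closure_eq_empty \<open>y \<in> closure (interior D)\<close> by blast
      then obtain z where "z \<in> ball x t" "?n \<bullet> (z - x) < 0" "z \<in> interior D" by blast
      moreover have "z \<in> closure (\<Omega>\<^sub>1 - D)" using calculation t(2) r(2) by force
      ultimately show False using closure_disjoint by blast
    qed
  next
    assume le: "(- ?n) \<bullet> (y - x) \<le> 0"
    show "y \<in> closure D"
    proof (rule closure_approachable[THEN iffD2], intro allI impI)
      fix \<epsilon> :: real assume eps: "\<epsilon> > 0"
      define q where "q = min \<epsilon> (t - dist x y) / 2"
      have q: "q > 0" "q < \<epsilon>" "dist x y + q < t" using eps y by (auto simp: q_def min_def field_simps)
      have nn: "?n \<bullet> ?n = 1" using P(1) by (simp add: norm_eq_1)
      have d: "dist (y + q *\<^sub>R ?n) y = q" using q(1) P(1) by (simp add: dist_norm)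
      have "dist x (y + q *\<^sub>R ?n) < t" using dist_triangle[of x "y + q *\<^sub>R ?n" y] d q by (simp add: dist_commute)
      moreover have "?n \<bullet> ((y + q *\<^sub>R ?n) - x) > 0" using le q nn by (simp add: inner_diff_right inner_add_right)
      ultimately have "y + q *\<^sub>R ?n \<in> D" using pos by simp
      then show "\<exists>z\<in>D. dist z y < \<epsilon>" using d q by (intro bexI[of _ "y + q *\<^sub>R ?n"]) auto
    qed
  qed
  then have "outward_normal D x (- ?n)" using P(1) t(1) unfolding outward_normal_def by (auto intro!: exI[of _ t])
  then have "(x - x\<^sub>0) \<bullet> (- ?n) \<ge> c\<^sub>D"
    using dom xe K(3) unfolding scattering_domain_def by blast
  then show ?thesis using P(6)[OF xe] KK by (simp add: inner_commute)
qed

end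

section \<open>Cauchy-Schwarz inequalities\<close>

lemma integrable_L2_product:
  assumes u: "L2_fun M u" and v: "L2_fun M v"
  shows "integrable M (\<lambda>x. u x * cnj (v x))" "integrable M (\<lambda>x. cmod (u x) * cmod (v x))"
proof -
  have m: "u \<in> borel_measurable M" "v \<in> borel_measurable M" using u v by (auto simp: L2_fun_def)
  have cm: "(\<lambda>x. cnj (v x)) \<in> borel_measurable M"
    by (rule borel_measurable_continuous_on[OF continuous_on_cnj[OF continuous_on_id] m(2)])
  have i: "integrable M (\<lambda>x. (cmod (u x))\<^sup>2 + (cmod (v x))\<^sup>2)" using u v by (auto simp: L2_fun_def)
  have le: "cmod (u x) * cmod (v x) \<le> norm ((cmod (u x))\<^sup>2 + (cmod (v x))\<^sup>2)" for x
  proof -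
    have "2 * (cmod (u x) * cmod (v x)) \<le> (cmod (u x))\<^sup>2 + (cmod (v x))\<^sup>2" "0 \<le> cmod (u x) * cmod (v x)"
      using sum_squares_bound[of "cmod (u x)" "cmod (v x)"] by auto
    then have "cmod (u x) * cmod (v x) \<le> (cmod (u x))\<^sup>2 + (cmod (v x))\<^sup>2" by linarith
    then show ?thesis by simp
  qed
  show "integrable M (\<lambda>x. u x * cnj (v x))"
  proof (rule Bochner_Integration.integrable_bound[OF i])
    show "(\<lambda>x. u x * cnj (v x)) \<in> borel_measurable M" by (intro borel_measurable_times m cm)
    show "AE x in M. norm (u x * cnj (v x)) \<le> norm ((cmod (u x))\<^sup>2 + (cmod (v x))\<^sup>2)"
      using le by (intro AE_I2) (simp add: norm_mult)
  qed
  show "integrable M (\<lambda>x. cmod (u x) * cmod (v x))"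
  proof (rule Bochner_Integration.integrable_bound[OF i])
    show "(\<lambda>x. cmod (u x) * cmod (v x)) \<in> borel_measurable M" using m by measurable
    show "AE x in M. norm (cmod (u x) * cmod (v x)) \<le> norm ((cmod (u x))\<^sup>2 + (cmod (v x))\<^sup>2)"
      using le by (intro AE_I2) (simp add: norm_mult)
  qed
qed

text \<open>
  The best choice is \<open>t = sqrt B / sqrt A\<close>; if \<open>A\<close> or \<open>B\<close> vanishes, \<open>t\<close> is taken large or small.
\<close>

lemma real_cauchy_schwarz_from_squares:
  fixes I A B :: real
  assumes "A \<ge> 0" "B \<ge> 0" and h: "\<And>t. t > 0 \<Longrightarrow> 2 * I \<le> t * A + B / t"
  shows "I \<le> sqrt A * sqrt B"
proof (cases "A = 0 \<or> B = 0")
  case False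
  then have AB: "A > 0" "B > 0" using assms by auto
  define a b where "a = sqrt A" and "b = sqrt B"
  have ab: "a > 0" "b > 0" "A = a * a" "B = b * b" using AB by (simp_all add: a_def b_def)
  have "2 * I \<le> (b / a) * A + B / (b / a)" using h[of "b / a"] ab by simp
  also have "\<dots> = 2 * (a * b)" unfolding ab(3,4) using ab(1,2) by simp
  finally show ?thesis by (simp add: a_def b_def)
next
  case True
  have "I \<le> 0"
  proof (rule ccontr)
    assume "\<not> I \<le> 0"
    then have I: "I > 0" by simp
    show False
    proof (cases "A = 0")
      case True
      have "2 * I \<le> B / ((B + 1) / I)" using h[of "(B + 1) / I"] True I assms by simp
      also have "\<dots> = I * (B / (B + 1))" by simp
      also have "\<dots> \<le> I * 1" using assms I by (intro mult_left_mono) (auto simp: field_simps)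
      finally show False using I by simp
    next
      case False
      then have "B = 0" "A > 0" using \<open>A = 0 \<or> B = 0\<close> assms by auto
      then have "2 * I \<le> (I / A) * A" using h[of "I / A"] I by simp
      then show False using \<open>A > 0\<close> I by simp
    qed
  qed
  then show ?thesis using True by auto
qed

lemma L2_norm_sq: "(L2_norm M u)\<^sup>2 = (LINT x|M. (norm (u x))\<^sup>2)"
  by (simp add: L2_norm_def)

lemma L2_norm_nonneg [simp]: "L2_norm M u \<ge> 0" by (simp add: L2_norm_def)

lemma L2_cauchy_schwarz_abs:
  assumes u: "L2_fun M u" and v: "L2_fun M v"
  shows "(LINT x|M. cmod (u x) * cmod (v x)) \<le> L2_norm M u * L2_norm M v"
  unfolding L2_norm_def
proof (rule real_cauchy_schwarz_from_squares)
  fix t :: real assume t: "t > 0"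
  have iu: "integrable M (\<lambda>x. (cmod (u x))\<^sup>2)" and iv: "integrable M (\<lambda>x. (cmod (v x))\<^sup>2)"
    using u v by (auto simp: L2_fun_def)
  have "2 * (LINT x|M. cmod (u x) * cmod (v x)) = (LINT x|M. 2 * (cmod (u x) * cmod (v x)))" by simp
  also have "\<dots> \<le> (LINT x|M. t * (cmod (u x))\<^sup>2 + (cmod (v x))\<^sup>2 / t)"
  proof (rule integral_mono)
    fix x
    have "0 \<le> (t * cmod (u x) - cmod (v x))\<^sup>2 / t" using t by simp
    also have "\<dots> = t * (cmod (u x))\<^sup>2 + (cmod (v x))\<^sup>2 / t - 2 * (cmod (u x) * cmod (v x))"
      using t by (simp add: field_simps power2_eq_square)
    finally show "2 * (cmod (u x) * cmod (v x)) \<le> t * (cmod (u x))\<^sup>2 + (cmod (v x))\<^sup>2 / t" by linarith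
  qed (use integrable_L2_product[OF u v] iu iv in auto)
  also have "\<dots> = t * (LINT x|M. (cmod (u x))\<^sup>2) + (LINT x|M. (cmod (v x))\<^sup>2) / t"
    using iu iv by simp
  finally show "2 * (LINT x|M. cmod (u x) * cmod (v x)) \<le> t * (LINT x|M. (cmod (u x))\<^sup>2) + (LINT x|M. (cmod (v x))\<^sup>2) / t" .
qed auto

lemma L2_cauchy_schwarz:
  assumes u: "L2_fun M u" and v: "L2_fun M v"
  shows "cmod (L2_inner M u v) \<le> L2_norm M u * L2_norm M v"
proof -
  have "cmod (L2_inner M u v) \<le> (LINT x|M. cmod (u x * cnj (v x)))"
    unfolding L2_inner_def by (rule integral_norm_bound)
  also have "\<dots> = (LINT x|M. cmod (u x) * cmod (v x))" by (simp add: norm_mult)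
  finally show ?thesis using L2_cauchy_schwarz_abs[OF u v] by linarith
qed

lemma sum_le_sqrt_mult_sqrt:
  fixes x P Q :: "'a \<Rightarrow> real"
  assumes "\<And>e. e \<in> A \<Longrightarrow> x e \<le> sqrt (P e) * sqrt (Q e)" "\<And>e. e \<in> A \<Longrightarrow> P e \<ge> 0" "\<And>e. e \<in> A \<Longrightarrow> Q e \<ge> 0"
  shows "sum x A \<le> sqrt (sum P A) * sqrt (sum Q A)"
proof -
  have "sum x A \<le> (\<Sum>e\<in>A. \<bar>sqrt (P e)\<bar> * \<bar>sqrt (Q e)\<bar>)"
    using assms by (intro sum_mono) simp
  also have "\<dots> \<le> L2_set (\<lambda>e. sqrt (P e)) A * L2_set (\<lambda>e. sqrt (Q e)) A" by (rule L2_set_mult_ineq)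
  also have "\<dots> = sqrt (sum P A) * sqrt (sum Q A)"
    using assms by (simp add: L2_set_def)
  finally show ?thesis .
qed

section \<open>A system of scalar inequalities\<close>

lemma absorb: 
  fixes x y c :: real
  assumes "c > 0"
  shows "x * y \<le> c * x\<^sup>2 + y\<^sup>2 / (4 * c)"
proof -
  have "0 \<le> (2 * c * x - y)\<^sup>2 / (4 * c)" using assms by simp
  also have "\<dots> = c * x\<^sup>2 + y\<^sup>2 / (4 * c) - x * y" using assms by (simp add: field_simps power2_eq_square)
  finally show ?thesis by linarith
qed

text \<open>
  The letters have the following meaning: \<open>w\<close>, \<open>g\<close> are the norms of \<open>k u\<close> and \<open>\<nabla>u\<close> on the domain, \<open>\<mu>\<close>, \<open>r\<close>
  those on the outer boundary, \<open>q\<close> is a weighted norm of both on the scatterer, \<open>J\<close> is the sum of the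
  penalties, \<open>M\<close> the norm of the data, \<open>\<phi>\<close> the modulus of the load applied to \<open>u\<close>, and \<open>\<Lambda>\<close> the maximum of
  the quotients of penalty parameters.
\<close>

definition energy_bound :: "real \<Rightarrow> real \<Rightarrow> real \<Rightarrow> bool" where
  "energy_bound c C K \<longleftrightarrow> (\<forall>w g r q j J \<mu> M \<phi> \<Lambda> k :: real.
     w \<ge> 0 \<and> g \<ge> 0 \<and> r \<ge> 0 \<and> q \<ge> 0 \<and> j \<ge> 0 \<and> J \<ge> 0 \<and> \<mu> \<ge> 0 \<and> M \<ge> 0 \<and> \<phi> \<ge> 0 \<and> \<Lambda> \<ge> 0 \<and> k > 0 \<and>
     2 * w\<^sup>2 + c * r\<^sup>2 + q\<^sup>2 \<le> C * (g * j + w * j + j\<^sup>2 + \<mu>\<^sup>2 + \<mu> * r + \<phi> + M * (g + r)) \<and>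
     g\<^sup>2 \<le> w\<^sup>2 + C * (g * j + \<phi>) \<and> k * \<phi> \<le> M * (w + \<mu>) \<and> J + \<mu>\<^sup>2 / k \<le> \<phi> \<and> j\<^sup>2 = \<Lambda> * J
     \<longrightarrow> (let b = K * ((1 + (1 + \<Lambda>) / k) * M) in w \<le> b \<and> g \<le> b \<and> r \<le> b \<and> q \<le> b \<and> sqrt J \<le> b))"

text \<open>
  Put \<open>Y\<^sup>2 = w\<^sup>2 + g\<^sup>2 + r\<^sup>2 + q\<^sup>2\<close>. Young's inequality absorbs into \<open>Y\<^sup>2\<close> all products on the right-hand
  sides; there remain multiples of \<open>j\<^sup>2\<close>, \<open>\<mu>\<^sup>2\<close>, \<open>\<phi>\<close> and \<open>M\<^sup>2\<close>. The first two are at most \<open>\<Lambda> \<phi>\<close> and \<open>k \<phi>\<close>, and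
  \<open>k \<phi>\<close> is at most \<open>2 M Y + M\<^sup>2\<close>, which is linear in \<open>Y\<close> and can be absorbed as well.
\<close>

lemma energy_closure:
  fixes c C :: real
  assumes c: "c > 0" and C: "C \<ge> 1"
  shows "\<exists>K>0. energy_bound c C K"
proof -
  define c0 where "c0 = min c 1"
  have c0: "c0 > 0" "c0 \<le> c" "c0 \<le> 1" using c by (auto simp: c0_def)
  \<comment> \<open>\<open>K1\<close> collects the constants of Young's inequality with weight \<open>c0 / 8\<close>; \<open>K2\<close>, \<open>K3\<close> those of the two absorptions; the square roots in \<open>K\<close> bound \<open>Y\<close> and \<open>sqrt J\<close>\<close>
  define K1 where "K1 = C + 2 * C + 9 * C\<^sup>2 * (2 / c0) + C\<^sup>2 * (2 / c0) + 4 * C\<^sup>2 * (2 / c0)"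
  define K2 where "K2 = K1 * (8 / (5 * c0))"
  define K3 where "K3 = 4 * K2\<^sup>2 + 4 * K2"
  define K where "K = sqrt K3 + sqrt (2 * sqrt K3 + 1)"
  have K1: "K1 > 0" using C c0 unfolding K1_def by (intro add_pos_nonneg) auto
  have K2: "K2 > 0" using K1 c0 by (simp add: K2_def)
  have K3: "K3 > 0" using K2 by (simp add: K3_def add_pos_pos)
  have K: "K > 0" using K3 by (simp add: K_def add_pos_pos)
  show ?thesis
    unfolding energy_bound_def
  proof (intro exI[of _ K] conjI K allI impI)
    fix w g r q j J \<mu> M \<phi> \<Lambda> k :: real
    assume "w \<ge> 0 \<and> g \<ge> 0 \<and> r \<ge> 0 \<and> q \<ge> 0 \<and> j \<ge> 0 \<and> J \<ge> 0 \<and> \<mu> \<ge> 0 \<and> M \<ge> 0 \<and> \<phi> \<ge> 0 \<and> \<Lambda> \<ge> 0 \<and> k > 0 \<and>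
     2 * w\<^sup>2 + c * r\<^sup>2 + q\<^sup>2 \<le> C * (g * j + w * j + j\<^sup>2 + \<mu>\<^sup>2 + \<mu> * r + \<phi> + M * (g + r)) \<and>
     g\<^sup>2 \<le> w\<^sup>2 + C * (g * j + \<phi>) \<and> k * \<phi> \<le> M * (w + \<mu>) \<and> J + \<mu>\<^sup>2 / k \<le> \<phi> \<and> j\<^sup>2 = \<Lambda> * J"
    then have pos: "w \<ge> 0" "g \<ge> 0" "r \<ge> 0" "q \<ge> 0" "j \<ge> 0" "J \<ge> 0" "\<mu> \<ge> 0" "M \<ge> 0" "\<phi> \<ge> 0" "\<Lambda> \<ge> 0" "k > 0"
      and H1: "2 * w\<^sup>2 + c * r\<^sup>2 + q\<^sup>2 \<le> C * (g * j + w * j + j\<^sup>2 + \<mu>\<^sup>2 + \<mu> * r + \<phi> + M * (g + r))"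
      and H2: "g\<^sup>2 \<le> w\<^sup>2 + C * (g * j + \<phi>)" and H3: "k * \<phi> \<le> M * (w + \<mu>)"
      and H4: "J + \<mu>\<^sup>2 / k \<le> \<phi>" and H5: "j\<^sup>2 = \<Lambda> * J" by auto
    define s where "s = 1 + (1 + \<Lambda>) / k"
    \<comment> \<open>the constant of the stability estimate is \<open>s / k\<close>\<close>
    have s: "s \<ge> 1" "s * k = k + 1 + \<Lambda>" "1 / k \<le> s" using pos by (auto simp: s_def field_simps)
    define Y where "Y = sqrt (w\<^sup>2 + g\<^sup>2 + r\<^sup>2 + q\<^sup>2)"
    have Y2: "Y\<^sup>2 = w\<^sup>2 + g\<^sup>2 + r\<^sup>2 + q\<^sup>2" and Y0: "Y \<ge> 0" by (auto simp: Y_def)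
    have wY: "w \<le> Y" and gY: "g \<le> Y" and rY: "r \<le> Y" and qY: "q \<le> Y"
      unfolding Y_def by (rule real_le_rsqrt; simp)+
    have "c0 * Y\<^sup>2 \<le> w\<^sup>2 + g\<^sup>2 + c * r\<^sup>2 + q\<^sup>2"
    proof -
      have "c0 * w\<^sup>2 \<le> 1 * w\<^sup>2" "c0 * g\<^sup>2 \<le> 1 * g\<^sup>2" "c0 * r\<^sup>2 \<le> c * r\<^sup>2" "c0 * q\<^sup>2 \<le> 1 * q\<^sup>2"
        using c0 by (intro mult_right_mono; simp)+
      then show ?thesis unfolding Y2 by (simp add: distrib_left)
    qed
    also have "\<dots> \<le> C * (g * j + w * j + j\<^sup>2 + \<mu>\<^sup>2 + \<mu> * r + \<phi> + M * (g + r)) + C * (g * j + \<phi>)"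
      using H1 H2 by linarith
    also have "\<dots> = C * (2 * (g * j) + w * j + j\<^sup>2 + \<mu>\<^sup>2 + \<mu> * r + 2 * \<phi> + M * (g + r))"
      by (simp add: algebra_simps)
    also have "\<dots> \<le> C * (2 * (Y * j) + Y * j + j\<^sup>2 + \<mu>\<^sup>2 + \<mu> * Y + 2 * \<phi> + M * (Y + Y))"
      using pos C wY gY rY by (intro mult_left_mono add_mono mult_right_mono mult_mono order_refl) auto
    also have "\<dots> = Y * (3 * C * j) + Y * (C * \<mu>) + Y * (2 * C * M) + C * (j\<^sup>2 + \<mu>\<^sup>2 + 2 * \<phi>)"
      by (simp add: algebra_simps)
    also have "\<dots> \<le> (c0/8 * Y\<^sup>2 + 9 * C\<^sup>2 * (2 / c0) * j\<^sup>2) + (c0/8 * Y\<^sup>2 + C\<^sup>2 * (2 / c0) * \<mu>\<^sup>2)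
        + (c0/8 * Y\<^sup>2 + 4 * C\<^sup>2 * (2 / c0) * M\<^sup>2) + C * (j\<^sup>2 + \<mu>\<^sup>2 + 2 * \<phi>)"
    proof -
      have "(3 * C * j)\<^sup>2 / (4 * (c0/8)) = 9 * C\<^sup>2 * (2 / c0) * j\<^sup>2" "(C * \<mu>)\<^sup>2 / (4 * (c0/8)) = C\<^sup>2 * (2 / c0) * \<mu>\<^sup>2"
        "(2 * C * M)\<^sup>2 / (4 * (c0/8)) = 4 * C\<^sup>2 * (2 / c0) * M\<^sup>2"
        using c0 by (simp_all add: power_mult_distrib field_simps)
      then show ?thesis
        using absorb[of "c0/8" Y "3 * C * j"] absorb[of "c0/8" Y "C * \<mu>"] absorb[of "c0/8" Y "2 * C * M"] c0 by simp
    qed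
    finally have "c0 * Y\<^sup>2 \<le> (c0/8 * Y\<^sup>2 + 9 * C\<^sup>2 * (2 / c0) * j\<^sup>2) + (c0/8 * Y\<^sup>2 + C\<^sup>2 * (2 / c0) * \<mu>\<^sup>2)
        + (c0/8 * Y\<^sup>2 + 4 * C\<^sup>2 * (2 / c0) * M\<^sup>2) + C * (j\<^sup>2 + \<mu>\<^sup>2 + 2 * \<phi>)" .
    then have "5/8 * (c0 * Y\<^sup>2) \<le> 9 * C\<^sup>2 * (2 / c0) * j\<^sup>2 + C\<^sup>2 * (2 / c0) * \<mu>\<^sup>2 + 4 * C\<^sup>2 * (2 / c0) * M\<^sup>2 + C * j\<^sup>2 + C * \<mu>\<^sup>2 + 2 * C * \<phi>"
      by (simp only: distrib_left)
    also have "\<dots> \<le> K1 * j\<^sup>2 + K1 * \<mu>\<^sup>2 + K1 * M\<^sup>2 + K1 * \<phi>"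
    proof -
      have E: "C\<^sup>2 * (2 / c0) \<ge> 0" using c0 by simp
      have "9 * C\<^sup>2 * (2 / c0) + C \<le> K1" "C\<^sup>2 * (2 / c0) + C \<le> K1" "4 * C\<^sup>2 * (2 / c0) \<le> K1" "2 * C \<le> K1"
        using C E unfolding K1_def mult.assoc by linarith+
      then have "(9 * C\<^sup>2 * (2 / c0) + C) * j\<^sup>2 \<le> K1 * j\<^sup>2" "(C\<^sup>2 * (2 / c0) + C) * \<mu>\<^sup>2 \<le> K1 * \<mu>\<^sup>2"
        "4 * C\<^sup>2 * (2 / c0) * M\<^sup>2 \<le> K1 * M\<^sup>2" "2 * C * \<phi> \<le> K1 * \<phi>"
        using pos by (intro mult_right_mono; simp)+
      then show ?thesis by (simp add: distrib_right)
    qed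
    finally have "Y\<^sup>2 \<le> K2 * (j\<^sup>2 + \<mu>\<^sup>2 + M\<^sup>2 + \<phi>)"
      using c0 by (simp add: K2_def field_simps)
    also have "\<dots> \<le> K2 * (s * (k * \<phi>) + M\<^sup>2)"
    proof -
      have "J \<le> \<phi>" "\<mu>\<^sup>2 / k \<le> \<phi>" using H4 pos by (smt (verit) divide_nonneg_pos zero_le_power2)+
      then have "j\<^sup>2 \<le> \<Lambda> * \<phi>" using pos H5 by (simp only: mult_left_mono)
      moreover have "\<mu>\<^sup>2 \<le> k * \<phi>" using \<open>\<mu>\<^sup>2 / k \<le> \<phi>\<close> pos by (simp add: field_simps)
      moreover have "s * (k * \<phi>) = k * \<phi> + \<phi> + \<Lambda> * \<phi>" using s(2) by (metis (no_types) distrib_right mult.assoc mult_1)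
      ultimately show ?thesis using K2 by (intro mult_left_mono) linarith+
    qed
    finally have Y1: "Y\<^sup>2 \<le> K2 * (s * (k * \<phi>) + M\<^sup>2)" .
    have k\<phi>: "k * \<phi> \<le> 2 * M * Y + M\<^sup>2"
    proof -
      have "\<mu>\<^sup>2 / k \<le> \<phi>" using H4 pos by linarith
      then have "\<mu>\<^sup>2 \<le> k * \<phi>" using pos by (simp add: field_simps)
      moreover have "M * \<mu> \<le> M\<^sup>2 / 2 + \<mu>\<^sup>2 / 2" using sum_squares_bound[of M \<mu>] by linarith
      moreover have "M * w \<le> M * Y" using wY pos by (intro mult_left_mono) auto
      ultimately show ?thesis using H3 by (simp add: distrib_left)
    qed
    have MM: "M\<^sup>2 \<le> s\<^sup>2 * M\<^sup>2" "s * M\<^sup>2 \<le> s\<^sup>2 * M\<^sup>2" using s(1)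
      by (auto simp: mult_le_cancel_right1 power2_eq_square mult_right_mono intro!: mult_right_mono)
        (smt (verit) mult_le_cancel_right1)
    have "Y\<^sup>2 \<le> K2 * (s * (2 * M * Y + M\<^sup>2) + M\<^sup>2)"
      using Y1 k\<phi> s K2 by (smt (verit) mult_left_mono)
    also have "\<dots> \<le> K2 * (s * (2 * M * Y) + 2 * (s\<^sup>2 * M\<^sup>2))"
      using MM K2 by (intro mult_left_mono) (auto simp: distrib_left)
    also have "\<dots> = Y * (2 * K2 * s * M) + 2 * K2 * (s\<^sup>2 * M\<^sup>2)" by (simp add: algebra_simps)
    also have "\<dots> \<le> (1/2 * Y\<^sup>2 + (2 * K2 * s * M)\<^sup>2 / (4 * (1/2))) + 2 * K2 * (s\<^sup>2 * M\<^sup>2)"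
      by (intro add_right_mono absorb) simp
    finally have "Y\<^sup>2 \<le> K3 * (s * M)\<^sup>2"
      by (simp add: K3_def power_mult_distrib algebra_simps)
    then have YK: "Y \<le> sqrt K3 * (s * M)"
      using pos s real_le_rsqrt[of Y "K3 * (s * M)\<^sup>2"] by (simp add: real_sqrt_mult)
    have sM: "s * M \<ge> 0" using s pos by simp
    have "sqrt K3 \<le> K" "sqrt (2 * sqrt K3 + 1) \<le> K" using K3 by (auto simp: K_def)
    then have YK': "Y \<le> K * (s * M)" using YK sM by (smt (verit) mult_right_mono)
    have "sqrt J \<le> K * (s * M)"
    proof -
      have "J \<le> \<phi>" using H4 pos by (smt (verit) divide_nonneg_pos zero_le_power2)
      also have "\<phi> = (k * \<phi>) / k" using pos by simp
      also have "\<dots> \<le> (2 * M * Y + M\<^sup>2) / k" using k\<phi> pos by (intro divide_right_mono) auto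
      also have "\<dots> = (1 / k) * (2 * M * Y + M\<^sup>2)" by simp
      also have "\<dots> \<le> s * (2 * M * Y + M\<^sup>2)" using s pos Y0 by (intro mult_right_mono) auto
      also have "\<dots> \<le> s * (2 * M * (sqrt K3 * (s * M)) + s * M\<^sup>2)"
      proof (intro mult_left_mono add_mono)
        have "1 * M\<^sup>2 \<le> s * M\<^sup>2" using s by (intro mult_right_mono) auto
        then show "M\<^sup>2 \<le> s * M\<^sup>2" by simp
      qed (use pos s YK in auto)
      also have "\<dots> = (2 * sqrt K3 + 1) * (s * M)\<^sup>2" by (simp add: algebra_simps power2_eq_square)
      finally have "sqrt J \<le> sqrt (2 * sqrt K3 + 1) * (s * M)"
        using real_sqrt_le_mono sM by (fastforce simp: real_sqrt_mult)
      then show ?thesis using \<open>sqrt (2 * sqrt K3 + 1) \<le> K\<close> sM by (smt (verit) mult_right_mono)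
    qed
    then show "let b = K * ((1 + (1 + \<Lambda>) / k) * M) in w \<le> b \<and> g \<le> b \<and> r \<le> b \<and> q \<le> b \<and> sqrt J \<le> b"
      using YK' wY gY rY qY unfolding Let_def s_def[symmetric] by linarith
  qed
qed

section \<open>The data\<close>

lemma L2_fun_lebesgue_subset:
  fixes f :: "'a::euclidean_space \<Rightarrow> complex"
  assumes f: "L2_fun (lebesgue_on S) f" and AS: "A \<subseteq> S" and A: "A \<in> sets lebesgue" and S: "S \<in> sets lebesgue"
  shows "L2_fun (lebesgue_on A) f"
proof -
  have "f \<in> borel_measurable (lebesgue_on A)"
    using f measurable_restrict_mono[OF _ AS] by (auto simp: L2_fun_def)
  moreover have "integrable (lebesgue_on A) (\<lambda>x. (cmod (f x))\<^sup>2)"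
  proof -
    have "set_integrable lebesgue S (\<lambda>x. (cmod (f x))\<^sup>2)"
      using f S by (simp add: L2_fun_def set_integrable_def integrable_restrict_space)
    then have "set_integrable lebesgue A (\<lambda>x. (cmod (f x))\<^sup>2)" by (rule set_integrable_subset[OF _ A AS])
    then show ?thesis using A by (simp add: set_integrable_def integrable_restrict_space)
  qed
  ultimately show ?thesis by (simp add: L2_fun_def)
qed

lemma sum_L2_norm_disjoint_le:
  fixes f :: "'a::euclidean_space \<Rightarrow> complex"
  assumes f: "L2_fun (lebesgue_on S) f" and S: "S \<in> sets lebesgue" and fin: "finite I"
    and A: "\<And>i. i \<in> I \<Longrightarrow> A i \<in> sets lebesgue \<and> A i \<subseteq> S" and disj: "disjoint_family_on A I"
  shows "(\<Sum>i\<in>I. (L2_norm (lebesgue_on (A i)) f)\<^sup>2) \<le> (L2_norm (lebesgue_on S) f)\<^sup>2"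
proof -
  let ?F = "\<lambda>x. (cmod (f x))\<^sup>2"
  have L: "(L2_norm (lebesgue_on B) f)\<^sup>2 = (LINT x|lebesgue. indicator B x * ?F x)" if "B \<in> sets lebesgue" for B
    unfolding L2_norm_sq using that by (subst integral_restrict_space) auto
  have int: "integrable lebesgue (\<lambda>x. indicator B x * ?F x)" if "B \<in> sets lebesgue" "B \<subseteq> S" for B
    using L2_fun_lebesgue_subset[OF f that(2,1) S] that by (simp add: L2_fun_def integrable_restrict_space)
  have "(\<Sum>i\<in>I. (L2_norm (lebesgue_on (A i)) f)\<^sup>2) = (\<Sum>i\<in>I. LINT x|lebesgue. indicator (A i) x * ?F x)"
    using A L by simp
  also have "\<dots> = (LINT x|lebesgue. (\<Sum>i\<in>I. indicator (A i) x * ?F x))"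
    by (rule Bochner_Integration.integral_sum[symmetric]) (use A int in auto)
  also have "\<dots> \<le> (LINT x|lebesgue. indicator S x * ?F x)"
  proof (rule integral_mono)
    show "integrable lebesgue (\<lambda>x. \<Sum>i\<in>I. indicator (A i) x * ?F x)" using A int by auto
    show "integrable lebesgue (\<lambda>x. indicator S x * ?F x)" using int S by auto
    fix x
    have "(\<Sum>i\<in>I. indicator (A i) x) = (indicator (\<Union>i\<in>I. A i) x :: real)"
      by (rule indicator_UN_disjoint[OF fin disj, symmetric])
    also have "\<dots> \<le> indicator S x" using A by (auto simp: indicator_def)
    finally show "(\<Sum>i\<in>I. indicator (A i) x * ?F x) \<le> indicator S x * ?F x"
      unfolding sum_distrib_right[symmetric] by (intro mult_right_mono) auto
  qed
  also have "\<dots> = (L2_norm (lebesgue_on S) f)\<^sup>2" using L[OF S] by simp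
  finally show ?thesis .
qed

context simplicial_mesh
begin

lemma cell_interiors_disjoint:
  assumes K: "K \<in> \<T>" and K': "K' \<in> \<T>" and neq: "K \<noteq> K'"
  shows "interior K \<inter> interior K' = {}"
proof (rule ccontr)
  assume "interior K \<inter> interior K' \<noteq> {}"
  then have ne: "interior (K \<inter> K') \<noteq> {}" by simp
  have F1: "K \<inter> K' face_of K" and F2: "K \<inter> K' face_of K'"
    using tri K K' unfolding triangulation_def by (blast, metis Int_commute)
  have ad: "aff_dim (K \<inter> K') = int CARD('n)" using aff_dim_nonempty_interior[OF ne] by simp
  have "K \<inter> K' = K" "K \<inter> K' = K'"
    using face_of_aff_dim_lt[OF cell_compact_convex(2)[OF K] F1] face_of_aff_dim_lt[OF cell_compact_convex(2)[OF K'] F2]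
      ad aff_dim_cell K K' by force+
  then show False using neq by auto
qed

lemma facet_measure_facts:
  assumes K: "K \<in> \<T>" and e: "e facet_of K"
  shows "finite_measure (face_measure e)" "AE x in face_measure e. x \<in> e"
    "continuous_on UNIV f \<Longrightarrow> integrable (face_measure e) (f :: real^'n \<Rightarrow> 'b::euclidean_space)"
proof -
  note P = facet_normal_props[OF simplices[OF K] dim2 e]
  show "finite_measure (face_measure e)" by (rule face_measure_finite[OF P(1-3)])
  show "AE x in face_measure e. x \<in> e" by (rule face_measure_AE_in[OF P(1-3)])
  obtain C where "full_simplex C" and KC: "K = full_simplex.cell C"
    using full_simplex_ex[OF simplices[OF K] dim2] by metis
  interpret full_simplex C by fact
  obtain c where "c \<in> C" "e = opp_face c" using e facets_of_cell KC by blast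
  then show "continuous_on UNIV f \<Longrightarrow> integrable (face_measure e) f" using face_integrable by blast
qed

lemma facet_L2:
  fixes f :: "real^'n \<Rightarrow> complex"
  assumes "K \<in> \<T>" "e facet_of K" "continuous_on UNIV f"
  shows "L2_fun (face_measure e) f"
  unfolding L2_fun_def
proof
  show "f \<in> borel_measurable (face_measure e)" by (rule borel_measurable_integrable[OF facet_measure_facts(3)[OF assms]])
  show "integrable (face_measure e) (\<lambda>x. (cmod (f x))\<^sup>2)"
    by (intro facet_measure_facts(3)[OF assms(1,2)] continuous_intros assms)
qed

lemma cell_L2:
  fixes f :: "real^'n \<Rightarrow> complex"
  assumes "K \<in> \<T>" "continuous_on UNIV f"
  shows "L2_fun (lebesgue_on K) f"
  unfolding L2_fun_def
proof
  note i = integrable_on_compact[OF cell_compact_convex(1)[OF assms(1)]]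
  show "f \<in> borel_measurable (lebesgue_on K)" by (rule borel_measurable_integrable[OF i[OF assms(2)]])
  show "integrable (lebesgue_on K) (\<lambda>x. (cmod (f x))\<^sup>2)" by (intro i continuous_intros assms)
qed

end

context scattering_mesh
begin

lemma interior_cell_subset: "K \<in> \<T> \<Longrightarrow> interior K \<subseteq> \<Omega>\<^sub>1 - D"
  using interior_mono[of K "\<Union>\<T>"] interior_closure_domain cover by auto

text \<open>
  The boundaries of the cells are null sets. The interiors of the cells are disjoint and lie in the
  domain, on which \<open>f\<close> is square-integrable.
\<close>

lemma source_bound:
  fixes f :: "real^'n \<Rightarrow> complex"
  assumes f: "L2_fun (lebesgue_on (\<Omega>\<^sub>1 - D)) f" and v: "\<And>K. K \<in> \<T> \<Longrightarrow> continuous_on UNIV (v K)"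
  shows "cmod (cells_inner \<T> (\<lambda>_. f) v) \<le> L2_norm (lebesgue_on (\<Omega>\<^sub>1 - D)) f * sqrt (\<Sum>K\<in>\<T>. (L2_norm (lebesgue_on K) (v K))\<^sup>2)"
proof -
  have S: "\<Omega>\<^sub>1 - D \<in> sets lebesgue" using open_domain by auto
  have iK: "interior K \<in> sets lebesgue" for K :: "(real^'n) set" by auto
  have L2f: "L2_fun (lebesgue_on (interior K)) f" if "K \<in> \<T>" for K
    by (rule L2_fun_lebesgue_subset[OF f interior_cell_subset[OF that] iK S])
  have one: "cmod (L2_inner (lebesgue_on K) f (v K)) \<le> L2_norm (lebesgue_on (interior K)) f * L2_norm (lebesgue_on K) (v K)"
    if K: "K \<in> \<T>" for K
  proof (cases "integrable (lebesgue_on K) (\<lambda>x. f x * cnj (v K x))")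
    case False
    \<comment> \<open>the integral of a function that is not integrable is 0\<close>
    then have "L2_inner (lebesgue_on K) f (v K) = 0" unfolding L2_inner_def by (rule not_integrable_integral_eq)
    then show ?thesis by simp
  next
    case True
    have Kl: "K \<in> sets lebesgue" using cell_compact_convex(1)[OF K] by (simp add: borel_compact)
    have neg: "negligible (K - interior K)"
      using negligible_convex_frontier[OF cell_compact_convex(2)[OF K]] cell_compact_convex(1)[OF K]
      by (simp add: frontier_def compact_imp_closed)
    have L2v: "L2_fun (lebesgue_on (interior K)) (v K)"
      by (rule L2_fun_lebesgue_subset[OF cell_L2[OF K v[OF K]] interior_subset iK Kl])
    have spike: "(LINT x|lebesgue_on K. h x) = (LINT x|lebesgue_on (interior K). h x)"
      if "integrable (lebesgue_on K) h" "integrable (lebesgue_on (interior K)) h"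
      for h :: "real^'n \<Rightarrow> 'b::euclidean_space"
    proof -
      have "integral K h = integral (interior K) h"
        by (rule integral_spike_set; rule negligible_subset[OF neg]) (use interior_subset in auto)
      then show ?thesis using that by (simp add: lebesgue_integral_eq_integral Kl iK)
    qed
    have "L2_inner (lebesgue_on K) f (v K) = L2_inner (lebesgue_on (interior K)) f (v K)"
      unfolding L2_inner_def by (rule spike[OF True integrable_L2_product(1)[OF L2f[OF K] L2v]])
    moreover have "L2_norm (lebesgue_on K) (v K) = L2_norm (lebesgue_on (interior K)) (v K)"
      unfolding L2_norm_def using cell_L2[OF K v[OF K]] L2v by (subst spike) (auto simp: L2_fun_def)
    ultimately show ?thesis using L2_cauchy_schwarz[OF L2f[OF K] L2v] by simp
  qed
  have "cmod (cells_inner \<T> (\<lambda>_. f) v) \<le> (\<Sum>K\<in>\<T>. cmod (L2_inner (lebesgue_on K) f (v K)))"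
    unfolding cells_inner_def by (rule norm_sum)
  also have "\<dots> \<le> sqrt (\<Sum>K\<in>\<T>. (L2_norm (lebesgue_on (interior K)) f)\<^sup>2) * sqrt (\<Sum>K\<in>\<T>. (L2_norm (lebesgue_on K) (v K))\<^sup>2)"
    by (rule sum_le_sqrt_mult_sqrt) (use one in auto)
  also have "\<dots> \<le> L2_norm (lebesgue_on (\<Omega>\<^sub>1 - D)) f * sqrt (\<Sum>K\<in>\<T>. (L2_norm (lebesgue_on K) (v K))\<^sup>2)"
  proof (intro mult_right_mono real_le_lsqrt)
    show "(\<Sum>K\<in>\<T>. (L2_norm (lebesgue_on (interior K)) f)\<^sup>2) \<le> (L2_norm (lebesgue_on (\<Omega>\<^sub>1 - D)) f)\<^sup>2"
      by (rule sum_L2_norm_disjoint_le[OF f S finite_mesh])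
         (use interior_cell_subset cell_interiors_disjoint in \<open>auto simp: disjoint_family_on_def\<close>)
  qed (auto intro!: sum_nonneg)
  finally show ?thesis .
qed

end

section \<open>Normal and tangential components of a gradient\<close>

lemma orthonormal_frame_expand:
  fixes n :: "real^'n" and t :: "nat \<Rightarrow> real^'n"
  assumes n: "norm n = 1" and nt: "\<And>j. j \<in> {1..CARD('n)-1} \<Longrightarrow> n \<bullet> t j = 0"
    and tt: "\<And>i j. i \<in> {1..CARD('n)-1} \<Longrightarrow> j \<in> {1..CARD('n)-1} \<Longrightarrow> t i \<bullet> t j = (if i = j then 1 else 0)"
  shows "v = (v \<bullet> n) *\<^sub>R n + (\<Sum>j\<in>{1..CARD('n)-1}. (v \<bullet> t j) *\<^sub>R t j)"
proof -
  let ?J = "{1..CARD('n)-1}"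
  let ?B = "insert n (t ` ?J)"
  have inj: "inj_on t ?J" using tt by (intro inj_onI) (metis zero_neq_one)
  have norm: "norm i = 1" if "i \<in> ?B" for i using that n tt by (auto simp: norm_eq_1)
  have "n \<notin> t ` ?J" using nt n by (auto simp: norm_eq_1) 
  have orth: "pairwise orthogonal ?B"
    using nt tt by (auto simp: pairwise_def orthogonal_def inner_commute)
  have "0 \<notin> ?B" using norm by (metis norm_zero zero_neq_one)
  then have indep: "independent ?B" using orth pairwise_orthogonal_independent by blast
  have "card ?B = Suc (card (t ` ?J))" using \<open>n \<notin> t ` ?J\<close> by simp
  also have "\<dots> = DIM(real^'n)" using inj by (simp add: card_image Suc_leI)
  finally have card: "card ?B = DIM(real^'n)" .
  have "v \<in> span ?B"
    using card_ge_dim_independent[of ?B UNIV] indep card by auto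
  from orthonormal_basis_expand[OF orth norm this] have "v = (\<Sum>i\<in>?B. (v \<bullet> i) *\<^sub>R i)" by simp
  also have "\<dots> = (v \<bullet> n) *\<^sub>R n + (\<Sum>j\<in>?J. (v \<bullet> t j) *\<^sub>R t j)"
    using \<open>n \<notin> t ` ?J\<close> inj by (simp add: sum.reindex)
  finally show ?thesis .
qed

locale face_frame =
  fixes n :: "real^'n" and t :: "nat \<Rightarrow> real^'n" and J :: "nat set"
  assumes n: "norm n = 1" and nt: "\<And>j. j \<in> J \<Longrightarrow> n \<bullet> t j = 0"
    and tt: "\<And>i j. i \<in> J \<Longrightarrow> j \<in> J \<Longrightarrow> t i \<bullet> t j = (if i = j then 1 else 0)"
    and J: "J = {1..CARD('n)-1}"
begin

lemma frame_expand: "v = (v \<bullet> n) *\<^sub>R n + (\<Sum>j\<in>J. (v \<bullet> t j) *\<^sub>R t j)"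
  unfolding J by (rule orthonormal_frame_expand[OF n nt tt]) (simp_all only: J)

lemma finJ: "finite J" by (simp add: J)

definition tang :: "complex^'n \<Rightarrow> real" where "tang a = sqrt (\<Sum>j\<in>J. (cmod (cdot a (t j)))\<^sup>2)"

lemma tang_sq: "(tang a)\<^sup>2 = (\<Sum>j\<in>J. (cmod (cdot a (t j)))\<^sup>2)"
  by (simp add: tang_def sum_nonneg)

lemma tang_nonneg: "tang a \<ge> 0" by (simp add: tang_def sum_nonneg)

lemma cdot_le_tang: "j \<in> J \<Longrightarrow> cmod (cdot a (t j)) \<le> tang a"
  unfolding tang_def by (rule real_le_rsqrt) (rule member_le_sum, auto simp: finJ)

lemma frame_cdot: "cdot a v = of_real (v \<bullet> n) * cdot a n + (\<Sum>j\<in>J. of_real (v \<bullet> t j) * cdot a (t j))"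
  by (subst frame_expand[of v]) (simp only: cdot_linear cdot_sum)

lemma frame_norm: "(norm a)\<^sup>2 = (cmod (cdot a n))\<^sup>2 + (tang a)\<^sup>2"
proof -
  define r i :: "real^'n" where "r = (\<chi> l. Re (a $ l))" and "i = (\<chi> l. Im (a $ l))"
  have c: "(cmod (cdot a w))\<^sup>2 = (r \<bullet> w)\<^sup>2 + (i \<bullet> w)\<^sup>2" for w
    by (simp add: cmod_power2 cdot_def inner_vec_def r_def i_def)
  have p: "v \<bullet> v = (v \<bullet> n)\<^sup>2 + (\<Sum>j\<in>J. (v \<bullet> t j)\<^sup>2)" for v
  proof -
    have "v \<bullet> v = v \<bullet> ((v \<bullet> n) *\<^sub>R n + (\<Sum>j\<in>J. (v \<bullet> t j) *\<^sub>R t j))"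
      using frame_expand[of v] by simp
    then show ?thesis by (simp add: inner_add_right inner_sum_right power2_eq_square)
  qed
  have "(norm a)\<^sup>2 = (\<Sum>l\<in>UNIV. (cmod (a $ l))\<^sup>2)" by (simp add: norm_vec_def L2_set_def sum_nonneg)
  also have "\<dots> = r \<bullet> r + i \<bullet> i"
    by (simp add: inner_vec_def r_def i_def cmod_power2 sum.distrib) (simp add: power2_eq_square)
  finally show ?thesis by (simp add: p[of r] p[of i] tang_sq c sum.distrib)
qed

lemma normal_le: "cmod (cdot a n) \<le> norm a" and tang_le: "tang a \<le> norm a"
  by (rule power2_le_imp_le; simp add: frame_norm)+

lemma card_J: "real (card J) \<le> CARD('n)" by (simp add: J)

text \<open>
  By polarisation \<open>|p|\<^sup>2 - |m|\<^sup>2\<close> is twice the real part of mean times jump. If mean and jump are split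
  into normal and tangential components, the product of the two normal components occurs in both terms
  on the left and cancels. Each remaining product contains a tangential component of the jump.
\<close>

lemma jump_flux_bound:
  assumes w: "norm w \<le> R"
  shows "(w \<bullet> n) * ((norm p)\<^sup>2 - (norm m)\<^sup>2)
      - 2 * Re (cdot ((1/2) *\<^sub>R (p + m)) n * cnj (cdot (p - m) w))
    \<ge> - 4 * R * CARD('n) * (norm ((1/2) *\<^sub>R (p + m)) * tang (p - m))"
proof -
  let ?a = "(1/2) *\<^sub>R (p + m)" and ?b = "p - m"
  have half: "cdot ?a v = (cdot p v + cdot m v) / 2" for v
    by (simp add: cdot_def sum.distrib[symmetric] sum_divide_distrib scaleR_conv_of_real[where 'a=complex] algebra_simps add_divide_distrib)
  have sq: "(cmod (cdot p v))\<^sup>2 - (cmod (cdot m v))\<^sup>2 = 2 * Re (cdot ?a v * cnj (cdot ?b v))" for v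
    unfolding half cdot_linear by (simp add: cmod_power2) (simp add: algebra_simps power2_eq_square)
  have "R \<ge> 0" using w norm_ge_zero order.trans by blast
  have diff: "(norm p)\<^sup>2 - (norm m)\<^sup>2 = 2 * Re (cdot ?a n * cnj (cdot ?b n)) + (\<Sum>j\<in>J. 2 * Re (cdot ?a (t j) * cnj (cdot ?b (t j))))"
    unfolding frame_norm tang_sq sq[symmetric] by (simp add: sum_subtractf)
  have flux: "Re (cdot ?a n * cnj (cdot ?b w)) = (w \<bullet> n) * Re (cdot ?a n * cnj (cdot ?b n)) + (\<Sum>j\<in>J. (w \<bullet> t j) * Re (cdot ?a n * cnj (cdot ?b (t j))))"
  proof -
    have "cdot ?a n * cnj (cdot ?b w) = of_real (w \<bullet> n) * (cdot ?a n * cnj (cdot ?b n)) + (\<Sum>j\<in>J. of_real (w \<bullet> t j) * (cdot ?a n * cnj (cdot ?b (t j))))"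
      by (subst frame_cdot[of ?b w]) (simp add: distrib_left sum_distrib_left mult_ac)
    then show ?thesis by simp
  qed
  have "(w \<bullet> n) * ((norm p)\<^sup>2 - (norm m)\<^sup>2) - 2 * Re (cdot ?a n * cnj (cdot ?b w))
      = (\<Sum>j\<in>J. 2 * ((w \<bullet> n) * Re (cdot ?a (t j) * cnj (cdot ?b (t j)))) - 2 * ((w \<bullet> t j) * Re (cdot ?a n * cnj (cdot ?b (t j)))))"
    unfolding diff flux by (simp add: sum_subtractf sum_distrib_left distrib_left mult_ac)
  also have "\<dots> \<ge> (\<Sum>j\<in>J. - (4 * R * (norm ?a * tang ?b)))"
  proof (rule sum_mono)
    fix j assume j: "j \<in> J"
    have tj: "norm (t j) = 1" using tt[OF j j] by (simp add: norm_eq_1)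
    have b: "\<bar>(w \<bullet> s) * Re (cdot ?a s' * cnj (cdot ?b (t j)))\<bar> \<le> R * (norm ?a * tang ?b)"
      if "norm s = 1" "norm s' = 1" for s s'
    proof -
      have "\<bar>w \<bullet> s\<bar> \<le> R" using Cauchy_Schwarz_ineq2[of w s] that w by simp
      moreover have "\<bar>Re (cdot ?a s' * cnj (cdot ?b (t j)))\<bar> \<le> norm ?a * tang ?b"
      proof -
        have "\<bar>Re (cdot ?a s' * cnj (cdot ?b (t j)))\<bar> \<le> cmod (cdot ?a s' * cnj (cdot ?b (t j)))" by (rule abs_Re_le_cmod)
        also have "\<dots> = cmod (cdot ?a s') * cmod (cdot ?b (t j))" by (simp add: norm_mult)
        also have "\<dots> \<le> norm ?a * tang ?b"
          using norm_cdot_le[of ?a s'] cdot_le_tang[OF j, of ?b] that by (intro mult_mono) auto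
        finally show ?thesis .
      qed
      ultimately show ?thesis unfolding abs_mult using \<open>R \<ge> 0\<close> by (intro mult_mono) auto
    qed
    show "- (4 * R * (norm ?a * tang ?b)) \<le> 2 * ((w \<bullet> n) * Re (cdot ?a (t j) * cnj (cdot ?b (t j)))) - 2 * ((w \<bullet> t j) * Re (cdot ?a n * cnj (cdot ?b (t j))))"
      using b[OF n tj] b[OF tj n] by linarith
  qed
  also have "(\<Sum>j\<in>J. - (4 * R * (norm ?a * tang ?b))) = - (real (card J) * (4 * R * (norm ?a * tang ?b)))" by simp
  also have "\<dots> \<ge> - 4 * R * CARD('n) * (norm ?a * tang ?b)"
    using mult_right_mono[OF card_J, of "4 * R * (norm ?a * tang ?b)"] \<open>R \<ge> 0\<close> tang_nonneg[of ?b] by (simp add: mult_ac)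
  finally show ?thesis .
qed

text \<open>
  Here mean and jump are both the trace. The second term contains the square of the normal component
  with twice the weight of the first term, so the sign of the normal part is reversed, and up to
  tangential components the flux is bounded below by \<open>|a|\<^sup>2\<close> with a nonnegative factor.
\<close>

lemma wall_flux_bound:
  assumes w: "norm w \<le> R" and \<delta>: "w \<bullet> n \<le> 0"
  shows "(w \<bullet> n) * (norm a)\<^sup>2 - 2 * Re (cdot a n * cnj (cdot a w))
    \<ge> - (w \<bullet> n) * (norm a)\<^sup>2 - 4 * R * CARD('n) * (norm a * tang a)"
proof -
  have R: "R \<ge> 0" using w norm_ge_zero order.trans by blast
  have flux: "Re (cdot a n * cnj (cdot a w)) = (w \<bullet> n) * (cmod (cdot a n))\<^sup>2 + (\<Sum>j\<in>J. (w \<bullet> t j) * Re (cdot a n * cnj (cdot a (t j))))"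
  proof -
    have "cdot a n * cnj (cdot a w) = of_real (w \<bullet> n) * (cdot a n * cnj (cdot a n)) + (\<Sum>j\<in>J. of_real (w \<bullet> t j) * (cdot a n * cnj (cdot a (t j))))"
      by (subst frame_cdot[of a w]) (simp add: distrib_left sum_distrib_left mult_ac)
    moreover have "cdot a n * cnj (cdot a n) = of_real ((cmod (cdot a n))\<^sup>2)" by (rule complex_norm_square[symmetric])
    ultimately show ?thesis by (simp only: of_real_mult[symmetric] plus_complex.sel Re_complex_of_real Re_sum) (simp del: of_real_mult)
  qed
  have "(w \<bullet> n) * (norm a)\<^sup>2 - 2 * Re (cdot a n * cnj (cdot a w))
     = - (w \<bullet> n) * (norm a)\<^sup>2 + 2 * ((w \<bullet> n) * (tang a)\<^sup>2) - 2 * (\<Sum>j\<in>J. (w \<bullet> t j) * Re (cdot a n * cnj (cdot a (t j))))"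
    unfolding flux frame_norm by (simp add: algebra_simps)
  moreover have "(w \<bullet> n) * (tang a)\<^sup>2 \<ge> - (R * (norm a * tang a))"
  proof -
    have "- (w \<bullet> n) \<le> R" using Cauchy_Schwarz_ineq2[of w n] n w by simp
    moreover have "(tang a)\<^sup>2 \<le> norm a * tang a" unfolding power2_eq_square by (intro mult_right_mono tang_le tang_nonneg)
    ultimately have "- (w \<bullet> n) * (tang a)\<^sup>2 \<le> R * (norm a * tang a)" using R by (intro mult_mono) auto
    then show ?thesis by simp
  qed
  moreover have "(\<Sum>j\<in>J. (w \<bullet> t j) * Re (cdot a n * cnj (cdot a (t j)))) \<le> (real CARD('n) - 1) * (R * (norm a * tang a))"
  proof -
    have "(\<Sum>j\<in>J. (w \<bullet> t j) * Re (cdot a n * cnj (cdot a (t j)))) \<le> (\<Sum>j\<in>J. R * (norm a * tang a))"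
    proof (rule sum_mono)
      fix j assume j: "j \<in> J"
      have tj: "norm (t j) = 1" using tt[OF j j] by (simp add: norm_eq_1)
      have "\<bar>w \<bullet> t j\<bar> \<le> R" using Cauchy_Schwarz_ineq2[of w "t j"] tj w by simp
      moreover have "\<bar>Re (cdot a n * cnj (cdot a (t j)))\<bar> \<le> norm a * tang a"
      proof -
        have "\<bar>Re (cdot a n * cnj (cdot a (t j)))\<bar> \<le> cmod (cdot a n * cnj (cdot a (t j)))" by (rule abs_Re_le_cmod)
        also have "\<dots> = cmod (cdot a n) * cmod (cdot a (t j))" by (simp add: norm_mult)
        also have "\<dots> \<le> norm a * tang a" using normal_le cdot_le_tang[OF j] by (intro mult_mono) auto
        finally show ?thesis .
      qed
      ultimately have "\<bar>(w \<bullet> t j) * Re (cdot a n * cnj (cdot a (t j)))\<bar> \<le> R * (norm a * tang a)"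
        unfolding abs_mult using R by (intro mult_mono) auto
      then show "(w \<bullet> t j) * Re (cdot a n * cnj (cdot a (t j))) \<le> R * (norm a * tang a)" by linarith
    qed
    also have "\<dots> = (real CARD('n) - 1) * (R * (norm a * tang a))" by (simp add: J of_nat_diff Suc_leI)
    finally show ?thesis .
  qed
  moreover have "0 \<le> R * (norm a * tang a)" using R tang_nonneg by simp
  ultimately have "(w \<bullet> n) * (norm a)\<^sup>2 - 2 * Re (cdot a n * cnj (cdot a w))
     \<ge> - (w \<bullet> n) * (norm a)\<^sup>2 - 2 * (R * (norm a * tang a)) - 2 * ((real CARD('n) - 1) * (R * (norm a * tang a)))"
    by linarith
  also have "- (w \<bullet> n) * (norm a)\<^sup>2 - 2 * (R * (norm a * tang a)) - 2 * ((real CARD('n) - 1) * (R * (norm a * tang a)))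
     = - (w \<bullet> n) * (norm a)\<^sup>2 - 2 * (real CARD('n) * (R * (norm a * tang a)))" by (simp add: algebra_simps)
  also have "\<dots> \<ge> - (w \<bullet> n) * (norm a)\<^sup>2 - 4 * R * CARD('n) * (norm a * tang a)"
    using R tang_nonneg by (simp add: mult_ac mult_right_mono)
  finally show ?thesis by simp
qed

lemma radial_le:
  assumes w: "norm w \<le> R"
  shows "cmod (cdot a w) \<le> \<bar>w \<bullet> n\<bar> * cmod (cdot a n) + R * CARD('n) * tang a"
proof -
  have R: "R \<ge> 0" using w norm_ge_zero order.trans by blast
  have "cmod (cdot a w) \<le> cmod (of_real (w \<bullet> n) * cdot a n) + cmod (\<Sum>j\<in>J. of_real (w \<bullet> t j) * cdot a (t j))"
    unfolding frame_cdot[of a w] by (rule norm_triangle_ineq)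
  also have "\<dots> \<le> \<bar>w \<bullet> n\<bar> * cmod (cdot a n) + (\<Sum>j\<in>J. R * tang a)"
  proof (intro add_mono sum_norm_le)
    fix j assume j: "j \<in> J"
    have tj: "norm (t j) = 1" using tt[OF j j] by (simp add: norm_eq_1)
    have "\<bar>w \<bullet> t j\<bar> \<le> R" using Cauchy_Schwarz_ineq2[of w "t j"] tj w by simp
    then show "cmod (of_real (w \<bullet> t j) * cdot a (t j)) \<le> R * tang a"
      unfolding norm_mult norm_of_real using cdot_le_tang[OF j] R by (intro mult_mono) auto
  qed (simp add: norm_mult)
  also have "(\<Sum>j\<in>J. R * tang a) \<le> R * CARD('n) * tang a"
    using mult_right_mono[OF card_J, of "R * tang a"] R tang_nonneg[of a] by (simp add: mult_ac)
  finally show ?thesis by simp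
qed

end

section \<open>Penalties and traces\<close>

text \<open>
  In applications \<open>X\<close> is a trace and \<open>Y\<close> a penalised jump. The power of \<open>h\<close> that the trace inequality
  costs is the one that the penalty weight returns.
\<close>

lemma penalty_product:
  fixes X Y h \<gamma> A j Ct \<Lambda> :: real
  assumes "X \<ge> 0" "Y \<ge> 0" "h > 0" "\<gamma> > 0" "A \<ge> 0" "j \<ge> 0" "Ct \<ge> 0"
    and X: "X\<^sup>2 \<le> Ct / h * A" and Y: "Y\<^sup>2 = h / \<gamma> * j" and \<Lambda>: "1 / \<gamma> \<le> \<Lambda>"
  shows "X * Y \<le> sqrt (Ct * A) * sqrt (\<Lambda> * j)"
proof -
  have "(X * Y)\<^sup>2 \<le> (Ct / h * A) * (h / \<gamma> * j)"
    unfolding power_mult_distrib Y[symmetric] by (rule mult_right_mono[OF X]) simp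
  also have "\<dots> = (Ct * A) * ((1 / \<gamma>) * j)" using assms(3) by simp
  also have "\<dots> \<le> (Ct * A) * (\<Lambda> * j)" using assms by (intro mult_left_mono mult_right_mono) auto
  finally have "X * Y \<le> sqrt ((Ct * A) * (\<Lambda> * j))" by (rule real_le_rsqrt)
  then show ?thesis by (simp only: real_sqrt_mult)
qed

lemma weighted_product:
  fixes A \<kappa> c N z :: real
  assumes "A > 0" "\<kappa> > 0" "N \<ge> 0" "z \<ge> 0" and c: "sqrt (A / \<kappa>) \<le> c"
  shows "A * sqrt N * z \<le> c / 2 * (A * N + \<kappa> * z\<^sup>2)"
proof -
  define p q where "p = sqrt (A * N)" and "q = sqrt \<kappa> * z"
  have p2: "p\<^sup>2 = A * N" and q2: "q\<^sup>2 = \<kappa> * z\<^sup>2" using assms by (simp_all add: p_def q_def power_mult_distrib)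
  have "sqrt A * sqrt A = A" using assms by simp
  then have "A * sqrt N * z = sqrt (A / \<kappa>) * (p * q)"
    using assms by (simp add: p_def q_def real_sqrt_divide real_sqrt_mult)
  also have "\<dots> \<le> c * (p * q)" using assms c by (intro mult_right_mono) (auto simp: p_def q_def)
  also have "\<dots> \<le> c * ((p\<^sup>2 + q\<^sup>2) / 2)"
    using sum_squares_bound[of p q] order.trans[OF real_sqrt_ge_zero c] assms by (intro mult_left_mono) auto
  finally show ?thesis by (simp add: p2 q2)
qed

lemma L2_inner_self: "L2_inner M f f = of_real (LINT x|M. (cmod (f x))\<^sup>2)"
  unfolding L2_inner_def by (simp flip: integral_complex_of_real complex_norm_square)

lemma L2_inner_swap: "L2_inner M g f = cnj (L2_inner M f g)"
proof -
  have "cnj (L2_inner M f g) = (LINT x|M. cnj (f x * cnj (g x)))"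
    unfolding L2_inner_def by (rule Bochner_Integration.integral_cnj[symmetric])
  then show ?thesis unfolding L2_inner_def by (simp add: mult.commute)
qed

text \<open>
  The number \<open>\<Lambda>\<close> bounds the quotients of parameters that the face estimates produce, and \<open>R\<close> bounds the
  distance of the domain from the centre of the radial field.
\<close>

locale ipdg_mesh = scattering_mesh \<T> lab \<Omega>\<^sub>1 D x\<^sub>0 c\<^sub>\<Omega> c\<^sub>D
  for \<T> :: "(real^'n) set set" and lab \<Omega>\<^sub>1 D x\<^sub>0 c\<^sub>\<Omega> c\<^sub>D +
  fixes \<theta> R :: real and \<tau> :: "(real^'n) set \<Rightarrow> nat \<Rightarrow> real^'n" and \<gamma>0 \<gamma>1 \<beta>1 :: "(real^'n) set \<Rightarrow> real"
    and k \<Lambda> :: real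
  assumes ang: "\<And>K. K \<in> \<T> \<Longrightarrow> min_angle \<theta> K" and \<theta>: "0 < \<theta>" "\<theta> \<le> pi / 2"
    and R: "1 \<le> R" "\<And>x. x \<in> closure \<Omega>\<^sub>1 \<Longrightarrow> norm (x - x\<^sub>0) \<le> R"
    and frames: "\<And>e. e \<in> faces_ID \<T> (frontier D) \<Longrightarrow> tangent_frame e (\<tau> e)"
    and k: "k > 0"
    and \<gamma>0: "\<And>e. e \<in> faces_ID \<T> (frontier D) \<Longrightarrow> \<gamma>0 e > 0"
    and \<beta>1: "\<And>e. e \<in> faces_ID \<T> (frontier D) \<Longrightarrow> \<beta>1 e > 0"
    and \<gamma>1: "\<And>e. e \<in> interior_faces \<T> \<Longrightarrow> \<gamma>1 e > 0"
    and \<Lambda>: "0 \<le> \<Lambda>" "\<And>e. e \<in> faces_ID \<T> (frontier D) \<Longrightarrow> 1 / \<gamma>0 e \<le> \<Lambda>"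
      "\<And>e. e \<in> faces_ID \<T> (frontier D) \<Longrightarrow> sqrt (\<gamma>0 e / \<beta>1 e) \<le> \<Lambda>"
      "\<And>e. e \<in> faces_ID \<T> (frontier D) \<Longrightarrow> 1 / \<beta>1 e \<le> \<Lambda>"
      "\<And>e. e \<in> faces_on \<T> (frontier D) \<Longrightarrow> \<gamma>0 e / diameter e \<le> \<Lambda>"
      "\<And>e. e \<in> interior_faces \<T> \<Longrightarrow> k\<^sup>2 / \<gamma>0 e \<le> \<Lambda>"
      "\<And>e. e \<in> interior_faces \<T> \<Longrightarrow> 1 / diameter e * sqrt (\<gamma>0 e / \<gamma>1 e) \<le> \<Lambda>"
begin

abbreviation "ID \<equiv> faces_ID \<T> (frontier D)"
abbreviation hi where "hi e \<equiv> cell_hi \<T> lab e"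
abbreviation lo where "lo e \<equiv> cell_lo \<T> lab e"
abbreviation nu where "nu e \<equiv> face_normal \<T> lab e"

definition trace_const :: real where "trace_const = 4 * CARD('n) * (CARD('n) + 1) / (sin \<theta>)\<^sup>2"

definition face_area where "face_area e = (LINT x|face_measure e. 1::real)"
definition cell_vol where "cell_vol K = (LINT x|lebesgue_on K. 1::real)"
definition off where "off e = facet_offset (hi e) e x\<^sub>0"

lemma trace_const_nonneg [simp]: "trace_const \<ge> 0" by (simp add: trace_const_def)
lemma face_area_nonneg [simp]: "face_area e \<ge> 0" by (simp add: face_area_def)
lemma cell_vol_nonneg [simp]: "cell_vol K \<ge> 0" by (simp add: cell_vol_def)

lemma face_cells:
  assumes "e \<in> ID \<or> e \<in> \<R>"
  shows "hi e \<in> \<T>" "e facet_of hi e" "lo e \<in> \<T>" "e facet_of lo e"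
proof -
  have "cells_at e \<noteq> {}" using assms by (auto simp: faces_ID_def faces_on_def interior_faces_def cells_at_def)
  from cell_hi_lo_in(1,2)[OF this]
  show "hi e \<in> \<T>" "e facet_of hi e" "lo e \<in> \<T>" "e facet_of lo e" by (auto simp: cells_at_def)
qed

lemma ID_cases: "e \<in> ID \<longleftrightarrow> e \<in> \<I> \<or> e \<in> \<D>" by (auto simp: faces_ID_def)

lemma all_faces: "(\<Union>K\<in>\<T>. {e. e facet_of K}) = \<I> \<union> \<R> \<union> \<D>"
proof
  show "(\<Union>K\<in>\<T>. {e. e facet_of K}) \<subseteq> \<I> \<union> \<R> \<union> \<D>"
    using boundary_face_cases by blast
  show "\<I> \<union> \<R> \<union> \<D> \<subseteq> (\<Union>K\<in>\<T>. {e. e facet_of K})"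
    unfolding interior_faces_def faces_on_def by blast
qed

lemma finite_faces: "finite \<I>" "finite \<R>" "finite \<D>" "finite ID"
proof -
  have "finite (\<Union>K\<in>\<T>. {e. e facet_of K})"
    using finite_mesh card_facets_simplex(1)[OF simplices dim2] by blast
  then show "finite \<I>" "finite \<R>" "finite \<D>" "finite ID" unfolding all_faces by (auto simp: faces_ID_def)
qed

lemma faces_disjoint: "\<I> \<inter> \<R> = {}" "\<I> \<inter> \<D> = {}" "\<R> \<inter> \<D> = {}"
  using faces_on_boundary faces_R_D_disjoint by auto

lemma sum_facets_swap:
  "(\<Sum>K\<in>\<T>. \<Sum>e | e facet_of K. \<phi> K e) = (\<Sum>e\<in>\<I> \<union> \<R> \<union> \<D>. \<Sum>K\<in>cells_at e. \<phi> K e)"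
proof -
  let ?F = "\<I> \<union> \<R> \<union> \<D>"
  have "(\<Sum>K\<in>\<T>. \<Sum>e | e facet_of K. \<phi> K e) = (\<Sum>K\<in>\<T>. \<Sum>e | e \<in> ?F \<and> e facet_of K. \<phi> K e)"
    unfolding all_faces[symmetric] by (intro sum.cong refl) auto
  also have "\<dots> = (\<Sum>e\<in>?F. \<Sum>K | K \<in> \<T> \<and> e facet_of K. \<phi> K e)"
    by (rule sum.swap_restrict) (use finite_mesh finite_faces in auto)
  finally show ?thesis by (simp add: cells_at_def)
qed

lemma cells_at_boundary: "e \<in> \<R> \<or> e \<in> \<D> \<Longrightarrow> cells_at e = {hi e}"
  using boundary_face_cells(1)[OF faces_on_boundary face_cells(1,2)] by (auto simp: faces_ID_def)

lemma sum_facets: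
  fixes \<phi> :: "_ \<Rightarrow> _ \<Rightarrow> real"
  shows "(\<Sum>K\<in>\<T>. \<Sum>e | e facet_of K. \<phi> K e)
   = (\<Sum>e\<in>\<I>. \<phi> (hi e) e + \<phi> (lo e) e) + (\<Sum>e\<in>\<R>. \<phi> (hi e) e) + (\<Sum>e\<in>\<D>. \<phi> (hi e) e)"
proof -
  have "(\<I> \<union> \<R>) \<inter> \<D> = {}" using faces_disjoint by auto
  then have "(\<Sum>e\<in>\<I> \<union> \<R> \<union> \<D>. \<Sum>K\<in>cells_at e. \<phi> K e) = (\<Sum>e\<in>\<I>. \<Sum>K\<in>cells_at e. \<phi> K e)
     + (\<Sum>e\<in>\<R>. \<Sum>K\<in>cells_at e. \<phi> K e) + (\<Sum>e\<in>\<D>. \<Sum>K\<in>cells_at e. \<phi> K e)"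
    using faces_disjoint finite_faces by (simp add: sum.union_disjoint)
  moreover have "(\<Sum>K\<in>cells_at e. \<phi> K e) = \<phi> (hi e) e + \<phi> (lo e) e" if "e \<in> \<I>" for e
    using interior_face_cells(1,2)[OF that] by simp
  ultimately show ?thesis unfolding sum_facets_swap by (simp add: cells_at_boundary)
qed

text \<open>
  A cell is counted once for each of its facets.
\<close>

lemma sum_patches:
  fixes X :: "_ \<Rightarrow> real"
  assumes X: "\<And>K. K \<in> \<T> \<Longrightarrow> X K \<ge> 0"
  shows "(\<Sum>e\<in>ID. \<Sum>K\<in>cells_at e. X K) \<le> (CARD('n) + 1) * (\<Sum>K\<in>\<T>. X K)"
proof -
  have nn: "(\<Sum>K\<in>cells_at e. X K) \<ge> 0" for e using X by (intro sum_nonneg) (auto simp: cells_at_def)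
  have "(\<Sum>e\<in>ID. \<Sum>K\<in>cells_at e. X K) \<le> (\<Sum>e\<in>\<I> \<union> \<R> \<union> \<D>. \<Sum>K\<in>cells_at e. X K)"
    using finite_faces nn by (intro sum_mono2) (auto simp: faces_ID_def)
  also have "\<dots> = (\<Sum>K\<in>\<T>. real (card {e. e facet_of K}) * X K)"
    unfolding sum_facets_swap[symmetric] by simp
  also have "\<dots> \<le> (\<Sum>K\<in>\<T>. (CARD('n) + 1) * X K)"
  proof (intro sum_mono mult_right_mono X)
    fix K assume "K \<in> \<T>"
    from card_facets_simplex(2)[OF simplices[OF this] dim2]
    show "real (card {e. e facet_of K}) \<le> real (CARD('n) + 1)" by simp
  qed
  finally show ?thesis by (simp add: sum_distrib_left)
qed

lemma diameter_pos: "K \<in> \<T> \<Longrightarrow> e facet_of K \<Longrightarrow> diameter e > 0"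
  by (rule facet_trace(1)[OF dim simplices ang \<theta> _ P1_const[of 0]])

lemma trace:
  assumes "K \<in> \<T>" "e facet_of K" "p \<in> P1"
  shows "(LINT x|face_measure e. (cmod (p x))\<^sup>2) \<le> trace_const / diameter e * (LINT x|lebesgue_on K. (cmod (p x))\<^sup>2)"
  unfolding trace_const_def by (rule facet_trace(2)[OF dim simplices[OF assms(1)] ang[OF assms(1)] \<theta> assms(2,3)])

lemma area_trace: "K \<in> \<T> \<Longrightarrow> e facet_of K \<Longrightarrow> face_area e \<le> trace_const / diameter e * cell_vol K"
  using trace[OF _ _ P1_const[of 1]] by (simp add: face_area_def cell_vol_def)

lemma face_point:
  assumes e: "e \<in> ID \<or> e \<in> \<R>" and x: "x \<in> e"
  shows "norm (x - x\<^sub>0) \<le> R" "(x - x\<^sub>0) \<bullet> nu e = off e"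
proof -
  note c = face_cells[OF e]
  have "x \<in> \<Union>\<T>" using c x facet_of_imp_subset by blast
  then have "x \<in> closure \<Omega>\<^sub>1" unfolding cover using closure_mono[of "\<Omega>\<^sub>1 - D" \<Omega>\<^sub>1] by auto
  then show "norm (x - x\<^sub>0) \<le> R" by (rule R)
  show "(x - x\<^sub>0) \<bullet> nu e = off e"
    using facet_normal_props(6)[OF simplices[OF c(1)] dim2 c(2) x] by (simp add: off_def face_normal_def inner_commute)
qed

lemma nu_unit: "e \<in> ID \<or> e \<in> \<R> \<Longrightarrow> norm (nu e) = 1"
  unfolding face_normal_def using facet_normal_props(1)[OF simplices dim2] face_cells(1,2) by blast

lemma off_bound:
  assumes e: "e \<in> ID \<or> e \<in> \<R>" shows "\<bar>off e\<bar> \<le> R"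
proof -
  obtain x where x: "x \<in> e" using facet_normal_props(5)[OF simplices dim2] face_cells[OF e] by blast
  have "\<bar>(x - x\<^sub>0) \<bullet> nu e\<bar> \<le> norm (x - x\<^sub>0) * norm (nu e)" by (rule Cauchy_Schwarz_ineq2)
  then show ?thesis using face_point[OF e x] nu_unit[OF e] by simp
qed

lemma off_lo:
  assumes e: "e \<in> \<I>" shows "facet_offset (lo e) e x\<^sub>0 = - off e"
  unfolding facet_offset_def off_def interior_face_cells(3)[OF e] by simp

lemma off_R: "e \<in> \<R> \<Longrightarrow> off e \<ge> c\<^sub>\<Omega>" and off_D: "e \<in> \<D> \<Longrightarrow> - off e \<ge> c\<^sub>D"
  unfolding off_def by (rule outer_boundary_offset, assumption) (rule scatterer_offset)

lemma off_D_nonpos: "e \<in> \<D> \<Longrightarrow> off e \<le> 0"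
  using off_D dom by (force simp: scattering_domain_def)

lemma frame:
  assumes e: "e \<in> ID"
  shows "face_frame (nu e) (\<tau> e) {1..CARD('n)-1}"
proof
  note c = face_cells[OF disjI1[OF e]]
  note P = facet_normal_props[OF simplices[OF c(1)] dim2 c(2), folded face_normal_def]
  show "norm (nu e) = 1" by (rule P)
  have tf: "tangent_frame e (\<tau> e)" using frames e by blast
  fix j assume j: "j \<in> {1..CARD('n)-1}"
  obtain x where x: "x \<in> e" using P(5) by auto
  have "x + \<tau> e j \<in> affine hull e" using tf j x unfolding tangent_frame_def by blast
  moreover have "x \<in> affine hull e" using x hull_inc by fast
  ultimately show "nu e \<bullet> \<tau> e j = 0" unfolding P(2) by (simp add: inner_add_right)
  fix i assume "i \<in> {1..CARD('n)-1}"
  then show "\<tau> e i \<bullet> \<tau> e j = (if i = j then 1 else 0)" using tf j unfolding tangent_frame_def by blast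
qed simp

lemma face_integral_le:
  fixes f g :: "real^'n \<Rightarrow> real"
  assumes K: "K \<in> \<T>" "e facet_of K" and "continuous_on UNIV f" "continuous_on UNIV g"
    and le: "\<And>x. x \<in> e \<Longrightarrow> f x \<le> g x"
  shows "(LINT x|face_measure e. f x) \<le> (LINT x|face_measure e. g x)"
proof (rule integral_mono_AE)
  show "AE x in face_measure e. f x \<le> g x"
    using facet_measure_facts(2)[OF K] by eventually_elim (rule le)
qed (use facet_measure_facts(3)[OF K] assms in blast)+

lemma face_integral_const: "(LINT x|face_measure e. c) = c * face_area e" for c :: real
  by (simp add: face_area_def)

end

section \<open>The forms at the solution and at the radial test function\<close>

locale ipdg_function = ipdg_mesh \<T> lab \<Omega>\<^sub>1 D x\<^sub>0 c\<^sub>\<Omega> c\<^sub>D \<theta> R \<tau> \<gamma>0 \<gamma>1 \<beta>1 k \<Lambda>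
  for \<T> :: "(real^'n) set set" and lab \<Omega>\<^sub>1 D x\<^sub>0 c\<^sub>\<Omega> c\<^sub>D \<theta> R \<tau> \<gamma>0 \<gamma>1 \<beta>1 k \<Lambda> +
  fixes u :: "'n pw"
  assumes u: "u \<in> Vh \<T>"
begin

definition slope where "slope K = grad (u K) 0"
definition radial :: "'n pw" where "radial = (\<lambda>K x. u K x - u K x\<^sub>0)"
definition jslope where "jslope e = (if e \<in> \<I> then slope (hi e) - slope (lo e) else slope (hi e))"
definition aslope where "aslope e = (if e \<in> \<I> then (1/2) *\<^sub>R (slope (hi e) + slope (lo e)) else slope (hi e))"

lemma uP1: "K \<in> \<T> \<Longrightarrow> u K \<in> P1" using u by (simp add: Vh_def)

lemma radial_eq: "K \<in> \<T> \<Longrightarrow> radial K x = cdot (slope K) (x - x\<^sub>0)"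
  using P1_affine(1)[OF uP1, of K x x\<^sub>0] by (simp add: radial_def slope_def)

lemma radial_Vh: "radial \<in> Vh \<T>" unfolding Vh_def radial_def by (simp add: P1_radial(1)[OF uP1])

lemma grad_u: "K \<in> \<T> \<Longrightarrow> grad (u K) x = slope K" "K \<in> \<T> \<Longrightarrow> grad (radial K) x = slope K"
  unfolding slope_def radial_def by (rule P1_affine(2)[OF uP1], assumption) (rule P1_radial(2)[OF uP1])

lemma pw_deriv_u: "K \<in> \<T> \<Longrightarrow> pw_deriv z u K x = cdot (slope K) z" "K \<in> \<T> \<Longrightarrow> pw_deriv z radial K x = cdot (slope K) z"
  by (simp_all add: pw_deriv_def grad_u cdot_def)

lemma jump_deriv:
  assumes "e \<in> ID"
  shows "jump \<T> lab (pw_deriv z u) e = (\<lambda>x. cdot (jslope e) z)" "jump \<T> lab (pw_deriv z radial) e = (\<lambda>x. cdot (jslope e) z)"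
  using face_cells[OF disjI1[OF assms]] by (auto simp: jump_def jslope_def pw_deriv_u cdot_linear)

lemma avg_deriv:
  assumes "e \<in> ID"
  shows "avg \<T> lab (pw_deriv z u) e = (\<lambda>x. cdot (aslope e) z)" "avg \<T> lab (pw_deriv z radial) e = (\<lambda>x. cdot (aslope e) z)"
proof -
  have "cdot ((1/2) *\<^sub>R (p + m)) z = (cdot p z + cdot m z) / 2" for p m
    by (simp add: cdot_def sum.distrib[symmetric] sum_divide_distrib scaleR_conv_of_real[where 'a=complex] algebra_simps add_divide_distrib)
  then show "avg \<T> lab (pw_deriv z u) e = (\<lambda>x. cdot (aslope e) z)" "avg \<T> lab (pw_deriv z radial) e = (\<lambda>x. cdot (aslope e) z)"
    using face_cells[OF disjI1[OF assms]] by (auto simp: avg_def aslope_def pw_deriv_u)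
qed

lemma jump_radial:
  assumes "e \<in> ID" shows "jump \<T> lab radial e = (\<lambda>x. cdot (jslope e) (x - x\<^sub>0))"
  using face_cells[OF disjI1[OF assms]] by (auto simp: jump_def jslope_def radial_eq cdot_linear)

abbreviation ujump where "ujump e \<equiv> jump \<T> lab u e"

lemma cont_u: "K \<in> \<T> \<Longrightarrow> continuous_on A (u K)" using uP1 P1_continuous by blast

lemma cont_radial: "K \<in> \<T> \<Longrightarrow> continuous_on A (radial K)"
  unfolding radial_def by (intro continuous_intros cont_u)

lemma cont_ujump: "e \<in> ID \<Longrightarrow> continuous_on A (ujump e)"
  using face_cells[of e] by (auto simp: jump_def intro!: continuous_intros cont_u)

text \<open>
  The letters \<open>G\<close> and \<open>U\<close> refer to squared norms of the gradient and of the function on the cells, \<open>GR\<close>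
  and \<open>XR\<close> to those on the outer boundary. \<open>QG\<close> and \<open>QU\<close> are their counterparts on the scatterer, with
  the weight \<open>- off e\<close>, which is at least \<open>c\<^sub>D\<close> there. The three terms named \<open>_term\<close> are the
  contributions of a face to the form at the solution and the radial test function.
\<close>

definition GK where "GK K = (norm (slope K))\<^sup>2 * cell_vol K"
definition UK where "UK K = (LINT x|lebesgue_on K. (cmod (u K x))\<^sup>2)"
definition G where "G = (\<Sum>K\<in>\<T>. GK K)"
definition U where "U = (\<Sum>K\<in>\<T>. UK K)"
definition jump_sq where "jump_sq e = (LINT x|face_measure e. (cmod (ujump e x))\<^sup>2)"
definition pen0 where "pen0 e = \<gamma>0 e / diameter e * jump_sq e"
definition pen1 where "pen1 e = \<gamma>1 e * diameter e * (face_area e * (cmod (cdot (jslope e) (nu e)))\<^sup>2)"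
definition tang_jump where "tang_jump e = sqrt (\<Sum>j\<in>{1..CARD('n)-1}. (cmod (cdot (jslope e) (\<tau> e j)))\<^sup>2)"
definition pen_tan where "pen_tan e = \<beta>1 e / diameter e * (face_area e * (tang_jump e)\<^sup>2)"
definition Jt where "Jt = (\<Sum>e\<in>ID. pen0 e) + (\<Sum>e\<in>\<I>. pen1 e) + (\<Sum>e\<in>ID. pen_tan e)"
definition consistency_term where "consistency_term e = L2_inner (face_measure e) (\<lambda>x. cdot (aslope e) (nu e)) (ujump e)"
definition flux_term where "flux_term e = L2_inner (face_measure e) (\<lambda>x. cdot (aslope e) (nu e)) (\<lambda>x. cdot (jslope e) (x - x\<^sub>0))"
definition penalty_term where "penalty_term e = \<gamma>0 e / diameter e * Im (L2_inner (face_measure e) (ujump e) (\<lambda>x. cdot (jslope e) (x - x\<^sub>0)))"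
definition XR where "XR = (\<Sum>e\<in>\<R>. LINT x|face_measure e. (cmod (u (hi e) x))\<^sup>2)"
definition GR where "GR = (\<Sum>e\<in>\<R>. face_area e * (norm (slope (hi e)))\<^sup>2)"
definition YR where "YR = (\<Sum>e\<in>\<R>. Im (L2_inner (face_measure e) (u (hi e)) (radial (hi e))))"
definition QG where "QG = (\<Sum>e\<in>\<D>. - off e * (face_area e * (norm (slope (hi e)))\<^sup>2))"
definition QU where "QU = (\<Sum>e\<in>\<D>. - off e * (LINT x|face_measure e. (cmod (u (hi e) x))\<^sup>2))"

lemma L2_inner_const_self: "L2_inner (face_measure e) (\<lambda>x. c) (\<lambda>x. c) = of_real (face_area e * (cmod c)\<^sup>2)"
  unfolding L2_inner_self by (simp add: face_area_def mult.commute)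

lemma form_J0: "J0 \<T> lab (frontier D) \<gamma>0 u u = of_real (\<Sum>e\<in>ID. pen0 e)"
  unfolding J0_def L2_inner_self by (simp add: pen0_def jump_sq_def)

lemma form_J0_radial: "Im (J0 \<T> lab (frontier D) \<gamma>0 u radial) = (\<Sum>e\<in>ID. penalty_term e)"
  unfolding J0_def Im_sum by (rule sum.cong[OF refl]) (simp add: jump_radial penalty_term_def)

lemma form_J1: "J1 \<T> lab \<gamma>1 u u = of_real (\<Sum>e\<in>\<I>. pen1 e)" "J1 \<T> lab \<gamma>1 u radial = of_real (\<Sum>e\<in>\<I>. pen1 e)"
proof -
  have "e \<in> ID" if "e \<in> \<I>" for e using that by (simp add: faces_ID_def)
  then show "J1 \<T> lab \<gamma>1 u u = of_real (\<Sum>e\<in>\<I>. pen1 e)" "J1 \<T> lab \<gamma>1 u radial = of_real (\<Sum>e\<in>\<I>. pen1 e)"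
    unfolding J1_def of_real_sum by (auto intro!: sum.cong simp: jump_deriv L2_inner_const_self pen1_def)
qed

lemma form_L1: "L1 \<T> lab (frontier D) \<tau> \<beta>1 u u = of_real (\<Sum>e\<in>ID. pen_tan e)"
    "L1 \<T> lab (frontier D) \<tau> \<beta>1 u radial = of_real (\<Sum>e\<in>ID. pen_tan e)"
proof -
  have l: "pen_tan e = (\<Sum>j\<in>{1..CARD('n)-1}. \<beta>1 e / diameter e * (face_area e * (cmod (cdot (jslope e) (\<tau> e j)))\<^sup>2))" for e
    unfolding pen_tan_def tang_jump_def by (simp add: sum_nonneg sum_distrib_left)
  show "L1 \<T> lab (frontier D) \<tau> \<beta>1 u u = of_real (\<Sum>e\<in>ID. pen_tan e)"
    "L1 \<T> lab (frontier D) \<tau> \<beta>1 u radial = of_real (\<Sum>e\<in>ID. pen_tan e)"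
    unfolding L1_def l of_real_sum by (auto intro!: sum.cong simp: jump_deriv L2_inner_const_self)
qed

lemma form_grad:
  "(\<Sum>K\<in>\<T>. L2_inner_vec (lebesgue_on K) (grad (u K)) (grad (u K))) = of_real G"
  "(\<Sum>K\<in>\<T>. L2_inner_vec (lebesgue_on K) (grad (u K)) (grad (radial K))) = of_real G"
proof -
  have s: "(\<Sum>i\<in>UNIV. a $ i * cnj (a $ i)) = of_real ((norm a)\<^sup>2)" for a :: "complex^'n"
    by (simp add: norm_vec_def L2_set_def sum_nonneg flip: complex_norm_square)
  have c: "(LINT x|lebesgue_on K. r) = r * cell_vol K" for K :: "(real^'n) set" and r :: real
    by (simp add: cell_vol_def)
  show "(\<Sum>K\<in>\<T>. L2_inner_vec (lebesgue_on K) (grad (u K)) (grad (u K))) = of_real G"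
    "(\<Sum>K\<in>\<T>. L2_inner_vec (lebesgue_on K) (grad (u K)) (grad (radial K))) = of_real G"
    unfolding G_def of_real_sum L2_inner_vec_def by (auto intro!: sum.cong simp: grad_u s c GK_def simp del: of_real_mult of_real_power lebesgue_integral_const)
qed

lemma form_a_self:
  "a_h \<T> lab (frontier D) \<tau> \<gamma>0 \<gamma>1 \<beta>1 u u = of_real (G - 2 * (\<Sum>e\<in>ID. Re (consistency_term e))) + \<i> * of_real Jt"
proof -
  have "(\<Sum>e\<in>ID. L2_inner (face_measure e) (avg \<T> lab (pw_deriv (nu e) u) e) (jump \<T> lab u e)
        + L2_inner (face_measure e) (jump \<T> lab u e) (avg \<T> lab (pw_deriv (nu e) u) e))
      = (\<Sum>e\<in>ID. of_real (2 * Re (consistency_term e)))"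
  proof (rule sum.cong[OF refl])
    fix e assume e: "e \<in> ID"
    have "L2_inner (face_measure e) (ujump e) (\<lambda>x. cdot (aslope e) (nu e)) = cnj (consistency_term e)"
      unfolding consistency_term_def by (rule L2_inner_swap)
    then show "L2_inner (face_measure e) (avg \<T> lab (pw_deriv (nu e) u) e) (jump \<T> lab u e)
        + L2_inner (face_measure e) (jump \<T> lab u e) (avg \<T> lab (pw_deriv (nu e) u) e) = of_real (2 * Re (consistency_term e))"
      by (simp add: avg_deriv[OF e] consistency_term_def[symmetric] complex_add_cnj)
  qed
  then show ?thesis unfolding a_h_def form_J0 form_J1 form_L1 form_grad Jt_def
    by (simp add: sum_distrib_left)
qed

text \<open>
  The gradients of \<open>u\<close> and of \<open>radial\<close> agree. Hence \<open>J1\<close> and \<open>L1\<close> take the same real values as at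
  \<open>(u, u)\<close>, and their contribution to the form is imaginary.
\<close>

lemma form_a_radial:
  "Re (a_h \<T> lab (frontier D) \<tau> \<gamma>0 \<gamma>1 \<beta>1 u radial)
     = G - (\<Sum>e\<in>ID. Re (flux_term e)) - (\<Sum>e\<in>ID. Re (consistency_term e)) - (\<Sum>e\<in>ID. penalty_term e)"
proof -
  have "(\<Sum>e\<in>ID. L2_inner (face_measure e) (avg \<T> lab (pw_deriv (nu e) u) e) (jump \<T> lab radial e)
        + L2_inner (face_measure e) (jump \<T> lab u e) (avg \<T> lab (pw_deriv (nu e) radial) e))
      = (\<Sum>e\<in>ID. flux_term e + cnj (consistency_term e))"
  proof (rule sum.cong[OF refl])
    fix e assume e: "e \<in> ID"
    have "L2_inner (face_measure e) (ujump e) (\<lambda>x. cdot (aslope e) (nu e)) = cnj (consistency_term e)"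
      unfolding consistency_term_def by (rule L2_inner_swap)
    then show "L2_inner (face_measure e) (avg \<T> lab (pw_deriv (nu e) u) e) (jump \<T> lab radial e)
        + L2_inner (face_measure e) (jump \<T> lab u e) (avg \<T> lab (pw_deriv (nu e) radial) e) = flux_term e + cnj (consistency_term e)"
      by (simp add: avg_deriv[OF e] jump_radial[OF e] flux_term_def)
  qed
  then show ?thesis unfolding a_h_def form_J1 form_L1 form_grad
    by (simp add: sum.distrib form_J0_radial)
qed

lemma cells_self: "cells_inner \<T> u u = of_real U"
  unfolding cells_inner_def L2_inner_self by (simp add: U_def UK_def)

lemma bdry_self: "bdry_inner \<T> (frontier \<Omega>\<^sub>1) (bdry \<T> lab u) (bdry \<T> lab u) = of_real XR"
  unfolding bdry_inner_def L2_inner_self by (simp add: XR_def bdry_def)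

lemma bdry_radial: "Im (bdry_inner \<T> (frontier \<Omega>\<^sub>1) (bdry \<T> lab u) (bdry \<T> lab radial)) = YR"
  unfolding bdry_inner_def by (simp add: YR_def bdry_def)

text \<open>
  Both identities are instances of \<open>simplex_divergence\<close>, the second one for the constant function 1,
  multiplied by the squared norm of the constant gradient.
\<close>

lemma cell_rellich:
  assumes K: "K \<in> \<T>"
  shows "(\<Sum>e | e facet_of K. facet_offset K e x\<^sub>0 * (LINT x|face_measure e. (cmod (u K x))\<^sup>2))
     = CARD('n) * UK K + 2 * Re (L2_inner (lebesgue_on K) (u K) (radial K))"
    "(\<Sum>e | e facet_of K. facet_offset K e x\<^sub>0 * (face_area e * (norm (slope K))\<^sup>2)) = CARD('n) * GK K"
proof -
  have int: "integrable (lebesgue_on K) (\<lambda>x. (cmod (u K x))\<^sup>2)" "integrable (lebesgue_on K) (\<lambda>x. u K x * cnj (radial K x))"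
    by (intro integrable_on_compact cell_compact_convex(1)[OF K] continuous_intros cont_u[OF K] cont_radial[OF K])+
  have r: "Re (L2_inner (lebesgue_on K) (u K) (radial K)) = (LINT x|lebesgue_on K. Re (u K x * cnj (radial K x)))"
    unfolding L2_inner_def using int(2) by (rule integral_Re[symmetric])
  have ri: "integrable (lebesgue_on K) (\<lambda>x. Re (u K x * cnj (radial K x)))" using int(2) by (rule integrable_Re)
  have "(\<Sum>e | e facet_of K. facet_offset K e x\<^sub>0 * (LINT x|face_measure e. (cmod (u K x))\<^sup>2))
     = (LINT x|lebesgue_on K. CARD('n) * (cmod (u K x))\<^sup>2 + 2 * Re (cnj (u K x) * (u K x - u K x\<^sub>0)))"
    by (rule simplex_divergence[OF dim simplices[OF K] uP1[OF K]])
  also have "(\<lambda>x. CARD('n) * (cmod (u K x))\<^sup>2 + 2 * Re (cnj (u K x) * (u K x - u K x\<^sub>0)))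
     = (\<lambda>x. CARD('n) * (cmod (u K x))\<^sup>2 + 2 * Re (u K x * cnj (radial K x)))"
    by (simp add: radial_def algebra_simps)
  also have "(LINT x|lebesgue_on K. CARD('n) * (cmod (u K x))\<^sup>2 + 2 * Re (u K x * cnj (radial K x)))
     = CARD('n) * UK K + 2 * Re (L2_inner (lebesgue_on K) (u K) (radial K))"
    unfolding r UK_def by (subst Bochner_Integration.integral_add) (use int(1) ri in \<open>auto simp del: times_complex.sel\<close>)
  finally show "(\<Sum>e | e facet_of K. facet_offset K e x\<^sub>0 * (LINT x|face_measure e. (cmod (u K x))\<^sup>2))
     = CARD('n) * UK K + 2 * Re (L2_inner (lebesgue_on K) (u K) (radial K))" .
  have "(\<Sum>e | e facet_of K. facet_offset K e x\<^sub>0 * face_area e) = CARD('n) * cell_vol K"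
    using simplex_divergence[OF dim simplices[OF K] P1_const[of 1], of x\<^sub>0] by (simp add: face_area_def cell_vol_def mult.commute)
  then have "(norm (slope K))\<^sup>2 * (\<Sum>e | e facet_of K. facet_offset K e x\<^sub>0 * face_area e) = CARD('n) * GK K"
    by (simp add: GK_def)
  then show "(\<Sum>e | e facet_of K. facet_offset K e x\<^sub>0 * (face_area e * (norm (slope K))\<^sup>2)) = CARD('n) * GK K"
    by (simp add: sum_distrib_left mult_ac)
qed

end

section \<open>Face estimates\<close>

lemma half_sum_norm:
  fixes p m :: "'a::real_inner"
  shows "(norm ((1/2) *\<^sub>R (p + m)))\<^sup>2 \<le> (norm p)\<^sup>2 + (norm m)\<^sup>2"
proof -
  define P M S D where "P = (norm p)\<^sup>2" and "M = (norm m)\<^sup>2" and "S = (norm (p + m))\<^sup>2" and "D = (norm (p - m))\<^sup>2"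
  have "S + D = 2 * (P + M)" unfolding P_def M_def S_def D_def
    by (simp add: power2_norm_eq_inner inner_simps inner_commute)
  moreover have "(norm ((1/2) *\<^sub>R (p + m)))\<^sup>2 = S / 4" by (simp add: power_divide S_def)
  moreover have "D \<ge> 0" "P \<ge> 0" "M \<ge> 0" by (simp_all add: P_def M_def D_def)
  ultimately show ?thesis unfolding P_def[symmetric] M_def[symmetric] by (simp add: field_simps)
qed

context ipdg_function
begin

lemma tang_jump_eq: "e \<in> ID \<Longrightarrow> tang_jump e = face_frame.tang (\<tau> e) {1..CARD('n)-1} (jslope e)"
  unfolding tang_jump_def by (rule face_frame.tang_def[OF frame, symmetric])

lemma tang_jump_nonneg [simp]: "tang_jump e \<ge> 0" unfolding tang_jump_def by (simp add: sum_nonneg)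

lemma GK_nonneg [simp]: "GK K \<ge> 0" by (simp add: GK_def cell_vol_nonneg)
lemma UK_nonneg [simp]: "UK K \<ge> 0" by (simp add: UK_def)
lemma G_nonneg [simp]: "G \<ge> 0" unfolding G_def by (intro sum_nonneg GK_nonneg)
lemma U_nonneg [simp]: "U \<ge> 0" unfolding U_def by (intro sum_nonneg UK_nonneg)
lemma jump_sq_nonneg [simp]: "jump_sq e \<ge> 0" by (simp add: jump_sq_def)

lemma penalties_nonneg:
  assumes "e \<in> ID"
  shows "pen0 e \<ge> 0" "e \<in> \<I> \<Longrightarrow> pen1 e \<ge> 0" "pen_tan e \<ge> 0" "diameter e > 0"
proof -
  show d: "diameter e > 0" using diameter_pos face_cells(1,2) assms by blast
  show "pen0 e \<ge> 0" using \<gamma>0[OF assms] d jump_sq_nonneg by (simp add: pen0_def)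
  show "pen_tan e \<ge> 0" using \<beta>1[OF assms] d face_area_nonneg by (simp add: pen_tan_def)
  show "pen1 e \<ge> 0" if "e \<in> \<I>" using \<gamma>1[OF that] d face_area_nonneg by (simp add: pen1_def)
qed

lemma I_in_ID: "e \<in> \<I> \<Longrightarrow> e \<in> ID" and D_in_ID: "e \<in> \<D> \<Longrightarrow> e \<in> ID"
  by (auto simp: faces_ID_def)

lemma Jt_nonneg: "Jt \<ge> 0"
  unfolding Jt_def using penalties_nonneg I_in_ID by (intro add_nonneg_nonneg sum_nonneg) auto

lemma Jt_parts: "(\<Sum>e\<in>ID. pen0 e) \<le> Jt" "(\<Sum>e\<in>ID. pen_tan e) \<le> Jt"
proof -
  have "(\<Sum>e\<in>ID. pen0 e) \<ge> 0" "(\<Sum>e\<in>\<I>. pen1 e) \<ge> 0" "(\<Sum>e\<in>ID. pen_tan e) \<ge> 0"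
    using penalties_nonneg I_in_ID by (auto intro!: sum_nonneg)
  then show "(\<Sum>e\<in>ID. pen0 e) \<le> Jt" "(\<Sum>e\<in>ID. pen_tan e) \<le> Jt" unfolding Jt_def by linarith+
qed

lemma sum_ID: "(\<Sum>e\<in>ID. f e) = (\<Sum>e\<in>\<I>. f e) + (\<Sum>e\<in>\<D>. f e)" for f :: "_ \<Rightarrow> real"
  unfolding faces_ID_def by (rule sum.union_disjoint) (use finite_faces faces_disjoint in auto)

lemma patch_cases:
  shows "e \<in> \<I> \<Longrightarrow> (\<Sum>K\<in>cells_at e. X K) = X (hi e) + X (lo e)" "e \<in> \<D> \<Longrightarrow> (\<Sum>K\<in>cells_at e. X K) = (X (hi e) :: real)"
  using interior_face_cells(1,2)[of e] cells_at_boundary[of e] by auto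

lemma patch_nonneg: "(\<And>K. K \<in> \<T> \<Longrightarrow> X K \<ge> 0) \<Longrightarrow> (\<Sum>K\<in>cells_at e. X K) \<ge> (0::real)"
  by (intro sum_nonneg) (auto simp: cells_at_def)

lemma slope_trace: "K \<in> \<T> \<Longrightarrow> e facet_of K \<Longrightarrow> face_area e * (norm (slope K))\<^sup>2 \<le> trace_const / diameter e * GK K"
  using mult_right_mono[OF area_trace, of K e "(norm (slope K))\<^sup>2"] by (simp add: GK_def mult_ac)

lemma aslope_trace:
  assumes e: "e \<in> ID"
  shows "(sqrt (face_area e) * norm (aslope e))\<^sup>2 \<le> trace_const / diameter e * (\<Sum>K\<in>cells_at e. GK K)"
proof -
  note c = face_cells[OF disjI1[OF e]]
  have sq: "(sqrt (face_area e) * norm (aslope e))\<^sup>2 = face_area e * (norm (aslope e))\<^sup>2"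
    using face_area_nonneg by (simp add: power_mult_distrib)
  show ?thesis
  proof (cases "e \<in> \<I>")
    case True
    have "face_area e * (norm (aslope e))\<^sup>2 \<le> face_area e * ((norm (slope (hi e)))\<^sup>2 + (norm (slope (lo e)))\<^sup>2)"
    proof (rule mult_left_mono[OF _ face_area_nonneg])
      have v: "(norm ((1/2) *\<^sub>R (p + m)))\<^sup>2 \<le> (norm p)\<^sup>2 + (norm m)\<^sup>2" for p m :: "complex^'n"
        by (rule half_sum_norm)
      show "(norm (aslope e))\<^sup>2 \<le> (norm (slope (hi e)))\<^sup>2 + (norm (slope (lo e)))\<^sup>2"
        using True v by (simp only: aslope_def if_True)
    qed
    also have "\<dots> \<le> trace_const / diameter e * GK (hi e) + trace_const / diameter e * GK (lo e)"
      using slope_trace[OF c(1,2)] slope_trace[OF c(3,4)] by (simp add: distrib_left)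
    finally show ?thesis using True unfolding sq patch_cases(1)[OF True] by (simp add: distrib_left)
  next
    case False
    then have "e \<in> \<D>" using e ID_cases by blast
    then show ?thesis using False slope_trace[OF c(1,2)] unfolding sq by (simp add: aslope_def patch_cases)
  qed
qed

lemma jump_sq_eq: "e \<in> ID \<Longrightarrow> (sqrt (jump_sq e))\<^sup>2 = diameter e / \<gamma>0 e * pen0 e"
  using \<gamma>0[of e] penalties_nonneg(4)[of e] jump_sq_nonneg[of e] by (simp add: pen0_def)

lemma tang_jump_sq: "e \<in> ID \<Longrightarrow> (sqrt (face_area e) * tang_jump e)\<^sup>2 = diameter e / \<beta>1 e * pen_tan e"
  using \<beta>1[of e] penalties_nonneg(4)[of e] face_area_nonneg[of e] by (simp add: pen_tan_def power_mult_distrib)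

lemma L2_norm_ujump: "L2_norm (face_measure e) (ujump e) = sqrt (jump_sq e)"
  by (simp add: L2_norm_def jump_sq_def)

lemma L2_norm_face_const: "L2_norm (face_measure e) (\<lambda>x. c) = sqrt (face_area e) * norm c" for c :: complex
  by (simp add: L2_norm_def face_area_def real_sqrt_mult)

lemma const_L2: "e \<in> ID \<Longrightarrow> L2_fun (face_measure e) (\<lambda>x. c)"
  using facet_L2[OF face_cells(1,2)[OF disjI1]] continuous_on_const by blast

lemma ujump_L2: "e \<in> ID \<Longrightarrow> L2_fun (face_measure e) (ujump e)"
  using facet_L2[OF face_cells(1,2)[OF disjI1]] cont_ujump by blast

lemma radial_jump_L2: "e \<in> ID \<Longrightarrow> L2_fun (face_measure e) (\<lambda>x. cdot a (x - x\<^sub>0))"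
  by (rule facet_L2[OF face_cells(1,2)[OF disjI1]]) (auto intro!: continuous_intros)

lemma nu_cdot: "e \<in> ID \<Longrightarrow> cmod (cdot a (nu e)) \<le> norm a"
  using norm_cdot_le[of a "nu e"] nu_unit[of e] by simp

definition face_budget where "face_budget = sqrt (trace_const * ((CARD('n) + 1) * G)) * sqrt (\<Lambda> * Jt)"

lemma patch_sum_bound:
  fixes X j x :: "(real^'n) set \<Rightarrow> real"
  assumes X: "\<And>K. K \<in> \<T> \<Longrightarrow> X K \<ge> 0" and j: "\<And>e. e \<in> ID \<Longrightarrow> j e \<ge> 0" "(\<Sum>e\<in>ID. j e) \<le> Jt" and A: "A \<subseteq> ID"
    and x: "\<And>e. e \<in> A \<Longrightarrow> x e \<le> sqrt (trace_const * (\<Sum>K\<in>cells_at e. X K)) * sqrt (\<Lambda> * j e)"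
  shows "sum x A \<le> sqrt (trace_const * ((CARD('n) + 1) * (\<Sum>K\<in>\<T>. X K))) * sqrt (\<Lambda> * Jt)"
proof -
  let ?P = "\<lambda>e. trace_const * (\<Sum>K\<in>cells_at e. X K)"
  have "sum x A \<le> sqrt (\<Sum>e\<in>A. ?P e) * sqrt (\<Sum>e\<in>A. \<Lambda> * j e)"
    using x A j(1) \<Lambda>(1) trace_const_nonneg patch_nonneg[OF X] by (intro sum_le_sqrt_mult_sqrt) auto
  also have "\<dots> \<le> sqrt (\<Sum>e\<in>ID. ?P e) * sqrt (\<Sum>e\<in>ID. \<Lambda> * j e)"
  proof (intro mult_mono real_sqrt_le_mono sum_mono2 finite_faces A)
    fix e assume "e \<in> ID - A"
    then show "0 \<le> ?P e" "0 \<le> \<Lambda> * j e" using trace_const_nonneg patch_nonneg[OF X] \<Lambda>(1) j(1) by auto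
  qed (use A j(1) \<Lambda>(1) trace_const_nonneg patch_nonneg[OF X] in \<open>auto intro!: sum_nonneg\<close>)
  also have "\<dots> \<le> sqrt (trace_const * ((CARD('n) + 1) * (\<Sum>K\<in>\<T>. X K))) * sqrt (\<Lambda> * Jt)"
    unfolding sum_distrib_left[symmetric]
    using sum_patches[OF X] trace_const_nonneg \<Lambda>(1) j X
    by (intro mult_mono real_sqrt_le_mono mult_left_mono) (auto intro!: sum_nonneg mult_nonneg_nonneg)
  finally show ?thesis .
qed

lemma consistency_bound: "\<bar>\<Sum>e\<in>ID. Re (consistency_term e)\<bar> \<le> face_budget"
proof -
  have "\<bar>\<Sum>e\<in>ID. Re (consistency_term e)\<bar> \<le> (\<Sum>e\<in>ID. \<bar>Re (consistency_term e)\<bar>)" by (rule sum_abs)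
  also have "\<dots> \<le> face_budget"
    unfolding face_budget_def G_def
  proof (rule patch_sum_bound[where j = pen0])
    fix e assume e: "e \<in> ID"
    have "\<bar>Re (consistency_term e)\<bar> \<le> cmod (consistency_term e)" by (rule abs_Re_le_cmod)
    also have "\<dots> \<le> (sqrt (face_area e) * cmod (cdot (aslope e) (nu e))) * sqrt (jump_sq e)"
      unfolding consistency_term_def using L2_cauchy_schwarz[OF const_L2[OF e] ujump_L2[OF e]] by (simp add: L2_norm_ujump L2_norm_face_const)
    also have "\<dots> \<le> (sqrt (face_area e) * norm (aslope e)) * sqrt (jump_sq e)"
      using nu_cdot[OF e] face_area_nonneg jump_sq_nonneg by (intro mult_right_mono mult_left_mono) auto
    also have "\<dots> \<le> sqrt (trace_const * (\<Sum>K\<in>cells_at e. GK K)) * sqrt (\<Lambda> * pen0 e)"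
      by (rule penalty_product[OF _ _ penalties_nonneg(4)[OF e] \<gamma>0[OF e] patch_nonneg[OF GK_nonneg] penalties_nonneg(1)[OF e] trace_const_nonneg
            aslope_trace[OF e] jump_sq_eq[OF e] \<Lambda>(2)[OF e]]) (use face_area_nonneg jump_sq_nonneg in auto)
    finally show "\<bar>Re (consistency_term e)\<bar> \<le> sqrt (trace_const * (\<Sum>K\<in>cells_at e. GK K)) * sqrt (\<Lambda> * pen0 e)" .
  qed (use GK_nonneg penalties_nonneg Jt_parts in auto)
  finally show ?thesis .
qed

lemma flux_term_integral:
  assumes e: "e \<in> ID"
  shows "Re (flux_term e) = (LINT x|face_measure e. Re (cdot (aslope e) (nu e) * cnj (cdot (jslope e) (x - x\<^sub>0))))"
  unfolding flux_term_def L2_inner_def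
  by (rule integral_Re[symmetric]) (rule integrable_L2_product(1)[OF const_L2[OF e] radial_jump_L2[OF e]])

lemma flux_bound_integrated:
  assumes e: "e \<in> ID"
    and le: "\<And>x. x \<in> e \<Longrightarrow> c \<le> m - 2 * Re (cdot (aslope e) (nu e) * cnj (cdot (jslope e) (x - x\<^sub>0)))"
  shows "c * face_area e \<le> m * face_area e - 2 * Re (flux_term e)"
proof -
  note fc = face_cells(1,2)[OF disjI1[OF e]]
  let ?h = "\<lambda>x. Re (cdot (aslope e) (nu e) * cnj (cdot (jslope e) (x - x\<^sub>0)))"
  have cont: "continuous_on UNIV ?h" by (intro continuous_intros)
  have "c * face_area e = (LINT x|face_measure e. c)" by (rule face_integral_const[symmetric])
  also have "\<dots> \<le> (LINT x|face_measure e. m - 2 * ?h x)"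
    by (rule face_integral_le[OF fc]) (use le cont in \<open>auto intro!: continuous_intros simp del: times_complex.sel\<close>)
  also have "\<dots> = (LINT x|face_measure e. m) - (LINT x|face_measure e. 2 * ?h x)"
    by (rule Bochner_Integration.integral_diff) (rule facet_measure_facts(3)[OF fc], intro continuous_intros)+
  also have "\<dots> = m * face_area e - 2 * Re (flux_term e)"
    unfolding flux_term_integral[OF e] face_integral_const by (simp del: times_complex.sel)
  finally show ?thesis .
qed

definition flux where "flux e = (if e \<in> \<I> then off e * (face_area e * (norm (slope (hi e)))\<^sup>2) - off e * (face_area e * (norm (slope (lo e)))\<^sup>2)
   else off e * (face_area e * (norm (slope (hi e)))\<^sup>2)) - 2 * Re (flux_term e)"

lemma flux_lower:
  assumes e: "e \<in> ID"
  shows "flux e \<ge> (if e \<in> \<I> then 0 else - off e * (face_area e * (norm (slope (hi e)))\<^sup>2))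
     - 4 * R * CARD('n) * ((sqrt (face_area e) * norm (aslope e)) * (sqrt (face_area e) * tang_jump e))"
proof -
  interpret face_frame "nu e" "\<tau> e" "{1..CARD('n)-1}" by (rule frame[OF e])
  have sq: "(sqrt (face_area e) * norm (aslope e)) * (sqrt (face_area e) * tang_jump e) = face_area e * (norm (aslope e) * tang_jump e)"
    using face_area_nonneg by simp
  show ?thesis
  proof (cases "e \<in> \<I>")
    case True
    have "(- 4 * R * CARD('n) * (norm (aslope e) * tang_jump e)) * face_area e
       \<le> (off e * ((norm (slope (hi e)))\<^sup>2 - (norm (slope (lo e)))\<^sup>2)) * face_area e - 2 * Re (flux_term e)"
    proof (rule flux_bound_integrated[OF e])
      fix x assume x: "x \<in> e"
      from jump_flux_bound[OF face_point(1)[OF disjI1[OF e] x], of "slope (hi e)" "slope (lo e)"]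
      show "- 4 * R * CARD('n) * (norm (aslope e) * tang_jump e) \<le> off e * ((norm (slope (hi e)))\<^sup>2 - (norm (slope (lo e)))\<^sup>2)
          - 2 * Re (cdot (aslope e) (nu e) * cnj (cdot (jslope e) (x - x\<^sub>0)))"
        using True by (simp only: aslope_def jslope_def tang_jump_eq[OF e] face_point(2)[OF disjI1[OF e] x] if_True)
    qed
    then show ?thesis using True unfolding sq by (simp add: flux_def algebra_simps)
  next
    case False
    then have D: "e \<in> \<D>" using e ID_cases by blast
    have "(- off e * (norm (slope (hi e)))\<^sup>2 - 4 * R * CARD('n) * (norm (aslope e) * tang_jump e)) * face_area e
       \<le> (off e * (norm (slope (hi e)))\<^sup>2) * face_area e - 2 * Re (flux_term e)"
    proof (rule flux_bound_integrated[OF e])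
      fix x assume x: "x \<in> e"
      have "(x - x\<^sub>0) \<bullet> nu e \<le> 0" using off_D_nonpos[OF D] face_point(2)[OF disjI1[OF e] x] by simp
      from wall_flux_bound[OF face_point(1)[OF disjI1[OF e] x] this, of "slope (hi e)"]
      show "- off e * (norm (slope (hi e)))\<^sup>2 - 4 * R * CARD('n) * (norm (aslope e) * tang_jump e) \<le> off e * (norm (slope (hi e)))\<^sup>2
          - 2 * Re (cdot (aslope e) (nu e) * cnj (cdot (jslope e) (x - x\<^sub>0)))"
        using False by (simp only: aslope_def jslope_def tang_jump_eq[OF e] face_point(2)[OF disjI1[OF e] x] if_False)
    qed
    then show ?thesis using False unfolding sq by (simp add: flux_def algebra_simps)
  qed
qed

lemma flux_sum: "(\<Sum>e\<in>ID. flux e) \<ge> QG - 4 * R * CARD('n) * face_budget"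
proof -
  let ?x = "\<lambda>e. (sqrt (face_area e) * norm (aslope e)) * (sqrt (face_area e) * tang_jump e)"
  have "(\<Sum>e\<in>ID. ?x e) \<le> face_budget"
    unfolding face_budget_def G_def
  proof (rule patch_sum_bound[where j = pen_tan])
    fix e assume e: "e \<in> ID"
    show "?x e \<le> sqrt (trace_const * (\<Sum>K\<in>cells_at e. GK K)) * sqrt (\<Lambda> * pen_tan e)"
      by (rule penalty_product[OF _ _ penalties_nonneg(4)[OF e] \<beta>1[OF e] patch_nonneg[OF GK_nonneg] penalties_nonneg(3)[OF e] trace_const_nonneg
            aslope_trace[OF e] tang_jump_sq[OF e] \<Lambda>(4)[OF e]]) (use face_area_nonneg tang_jump_nonneg in auto)
  qed (use GK_nonneg penalties_nonneg Jt_parts in auto)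
  then have "4 * R * CARD('n) * (\<Sum>e\<in>ID. ?x e) \<le> 4 * R * CARD('n) * face_budget" using R(1) by (intro mult_left_mono) auto
  moreover have "(\<Sum>e\<in>ID. flux e) \<ge> (\<Sum>e\<in>ID. (if e \<in> \<I> then 0 else - off e * (face_area e * (norm (slope (hi e)))\<^sup>2)) - 4 * R * CARD('n) * ?x e)"
    by (rule sum_mono) (rule flux_lower)
  moreover have "(\<Sum>e\<in>ID. (if e \<in> \<I> then 0 else - off e * (face_area e * (norm (slope (hi e)))\<^sup>2)) - 4 * R * CARD('n) * ?x e)
     = QG - 4 * R * CARD('n) * (\<Sum>e\<in>ID. ?x e)"
  proof -
    have "(\<Sum>e\<in>ID. if e \<in> \<I> then 0 else - off e * (face_area e * (norm (slope (hi e)))\<^sup>2)) = QG"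
      unfolding sum_ID QG_def using faces_disjoint by (auto intro!: sum.cong)
    then show ?thesis by (simp add: sum_subtractf sum_distrib_left)
  qed
  ultimately show ?thesis by linarith
qed

definition volume_jump where "volume_jump e = off e * (LINT x|face_measure e. (cmod (u (hi e) x))\<^sup>2) - off e * (LINT x|face_measure e. (cmod (u (lo e) x))\<^sup>2)"

text \<open>
  The difference of the squares is twice mean times jump. Of the factor \<open>k\<^sup>2\<close> one half goes to the mean
  and the other half to the jump; this is where \<open>k\<^sup>2 / \<gamma>0\<close> arises.
\<close>

lemma volume_jump_sum:
  "k\<^sup>2 * \<bar>\<Sum>e\<in>\<I>. volume_jump e\<bar> \<le> 2 * R * (sqrt (trace_const * ((CARD('n) + 1) * (k\<^sup>2 * U))) * sqrt (\<Lambda> * Jt))"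
proof -
  define Na where "Na e = (LINT x|face_measure e. (cmod ((u (hi e) x + u (lo e) x) / 2))\<^sup>2)" for e
  have one: "\<bar>volume_jump e\<bar> \<le> 2 * R * (sqrt (Na e) * sqrt (jump_sq e))" and Na: "Na e \<le> trace_const / diameter e * (\<Sum>K\<in>cells_at e. UK K)"
    if e: "e \<in> \<I>" for e
  proof -
    note eID = I_in_ID[OF e]
    note c = face_cells[OF disjI1[OF eID]]
    let ?p = "u (hi e)" and ?m = "u (lo e)"
    let ?a = "\<lambda>x. (?p x + ?m x) / 2"
    note cu = cont_u[OF c(1)] cont_u[OF c(3)]
    note int = facet_measure_facts(3)[OF c(1,2)]
    have ca: "continuous_on UNIV ?a" by (intro continuous_intros cu) simp
    have jue: "ujump e = (\<lambda>x. ?p x - ?m x)" using e by (simp add: jump_def)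
    have La: "L2_fun (face_measure e) ?a" by (rule facet_L2[OF c(1,2) ca])
    have sq: "(cmod (?p x))\<^sup>2 - (cmod (?m x))\<^sup>2 = 2 * Re (?a x * cnj (ujump e x))" for x
      unfolding jue by (simp add: cmod_power2) (simp add: algebra_simps power2_eq_square)
    have "(LINT x|face_measure e. (cmod (?p x))\<^sup>2) - (LINT x|face_measure e. (cmod (?m x))\<^sup>2)
        = (LINT x|face_measure e. (cmod (?p x))\<^sup>2 - (cmod (?m x))\<^sup>2)"
      by (rule Bochner_Integration.integral_diff[symmetric]) (intro int continuous_intros cu)+
    also have "\<dots> = 2 * Re (L2_inner (face_measure e) ?a (ujump e))"
    proof -
      have "(LINT x|face_measure e. Re (?a x * cnj (ujump e x))) = Re (L2_inner (face_measure e) ?a (ujump e))"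
        unfolding L2_inner_def by (rule integral_Re[OF integrable_L2_product(1)[OF La ujump_L2[OF eID]]])
      then show ?thesis unfolding sq by (simp del: times_complex.sel)
    qed
    finally have vj: "volume_jump e = off e * (2 * Re (L2_inner (face_measure e) ?a (ujump e)))"
      by (simp add: volume_jump_def right_diff_distrib[symmetric])
    have "\<bar>Re (L2_inner (face_measure e) ?a (ujump e))\<bar> \<le> L2_norm (face_measure e) ?a * L2_norm (face_measure e) (ujump e)"
      using abs_Re_le_cmod L2_cauchy_schwarz[OF La ujump_L2[OF eID]] order.trans by blast
    also have "\<dots> = sqrt (Na e) * sqrt (jump_sq e)" unfolding L2_norm_ujump by (simp add: L2_norm_def Na_def)
    finally have "\<bar>off e\<bar> * (2 * \<bar>Re (L2_inner (face_measure e) ?a (ujump e))\<bar>) \<le> R * (2 * (sqrt (Na e) * sqrt (jump_sq e)))"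
      using off_bound[OF disjI1[OF eID]] R(1) by (intro mult_mono mult_left_mono) auto
    then show "\<bar>volume_jump e\<bar> \<le> 2 * R * (sqrt (Na e) * sqrt (jump_sq e))" unfolding vj by (simp add: abs_mult mult_ac)
    have "Na e \<le> (LINT x|face_measure e. (cmod (?p x))\<^sup>2 + (cmod (?m x))\<^sup>2)"
      unfolding Na_def
    proof (rule face_integral_le[OF c(1,2)])
      fix x
      have "(norm ((1/2) *\<^sub>R (?p x + ?m x)))\<^sup>2 \<le> (norm (?p x))\<^sup>2 + (norm (?m x))\<^sup>2" by (rule half_sum_norm)
      then show "(cmod (?a x))\<^sup>2 \<le> (cmod (?p x))\<^sup>2 + (cmod (?m x))\<^sup>2" by (simp add: scaleR_conv_of_real)
    qed (intro continuous_intros cu; simp)+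
    also have "\<dots> = (LINT x|face_measure e. (cmod (?p x))\<^sup>2) + (LINT x|face_measure e. (cmod (?m x))\<^sup>2)"
      by (rule Bochner_Integration.integral_add) (intro int continuous_intros cu)+
    also have "\<dots> \<le> trace_const / diameter e * UK (hi e) + trace_const / diameter e * UK (lo e)"
      unfolding UK_def by (intro add_mono trace c uP1)
    finally show "Na e \<le> trace_const / diameter e * (\<Sum>K\<in>cells_at e. UK K)" unfolding patch_cases(1)[OF e] by (simp add: distrib_left)
  qed
  have Na0: "Na e \<ge> 0" for e by (simp add: Na_def)
  have "k\<^sup>2 * \<bar>\<Sum>e\<in>\<I>. volume_jump e\<bar> \<le> k\<^sup>2 * (\<Sum>e\<in>\<I>. 2 * R * (sqrt (Na e) * sqrt (jump_sq e)))"
    by (intro mult_left_mono order.trans[OF sum_abs] sum_mono one) auto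
  also have "\<dots> = 2 * R * (\<Sum>e\<in>\<I>. (k * sqrt (Na e)) * (k * sqrt (jump_sq e)))"
    by (simp add: sum_distrib_left power2_eq_square mult_ac)
  also have "\<dots> \<le> 2 * R * (sqrt (trace_const * ((CARD('n) + 1) * (\<Sum>K\<in>\<T>. k\<^sup>2 * UK K))) * sqrt (\<Lambda> * Jt))"
  proof (intro mult_left_mono patch_sum_bound[where j = pen0])
    fix e assume e: "e \<in> \<I>"
    note eID = I_in_ID[OF e]
    have X: "(k * sqrt (Na e))\<^sup>2 \<le> trace_const / diameter e * (\<Sum>K\<in>cells_at e. k\<^sup>2 * UK K)"
      unfolding sum_distrib_left[symmetric]
      using mult_left_mono[OF Na[OF e], of "k\<^sup>2"] Na0[of e] by (simp add: power_mult_distrib mult_ac)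
    have Y: "(k * sqrt (jump_sq e))\<^sup>2 = diameter e / (\<gamma>0 e / k\<^sup>2) * pen0 e"
      unfolding power_mult_distrib jump_sq_eq[OF eID] by simp
    have L: "1 / (\<gamma>0 e / k\<^sup>2) \<le> \<Lambda>" using \<Lambda>(6)[OF e] by simp
    have g: "\<gamma>0 e / k\<^sup>2 > 0" using \<gamma>0[OF eID] k by simp
    have p: "0 \<le> (\<Sum>K\<in>cells_at e. k\<^sup>2 * UK K)" by (rule patch_nonneg) (simp add: UK_nonneg)
    show "(k * sqrt (Na e)) * (k * sqrt (jump_sq e)) \<le> sqrt (trace_const * (\<Sum>K\<in>cells_at e. k\<^sup>2 * UK K)) * sqrt (\<Lambda> * pen0 e)"
      by (rule penalty_product[OF _ _ penalties_nonneg(4)[OF eID] g p penalties_nonneg(1)[OF eID] trace_const_nonneg X Y L])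
         (use k Na0[of e] in auto)
  qed (use R(1) UK_nonneg penalties_nonneg Jt_parts I_in_ID in auto)
  finally show ?thesis by (simp add: U_def sum_distrib_left)
qed

lemma radial_jump_norm:
  assumes e: "e \<in> ID" and B: "\<And>x. x \<in> e \<Longrightarrow> cmod (cdot a (x - x\<^sub>0)) \<le> B" and B0: "B \<ge> 0"
  shows "L2_norm (face_measure e) (\<lambda>x. cdot a (x - x\<^sub>0)) \<le> sqrt (face_area e) * B"
proof -
  note fc = face_cells(1,2)[OF disjI1[OF e]]
  have "(LINT x|face_measure e. (cmod (cdot a (x - x\<^sub>0)))\<^sup>2) \<le> (LINT x|face_measure e. B\<^sup>2)"
    by (rule face_integral_le[OF fc]) (use B in \<open>auto intro!: continuous_intros power_mono\<close>)
  then have "L2_norm (face_measure e) (\<lambda>x. cdot a (x - x\<^sub>0)) \<le> sqrt (B\<^sup>2 * face_area e)"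
    unfolding L2_norm_def face_integral_const by (rule real_sqrt_le_mono)
  then show ?thesis using B0 by (simp add: real_sqrt_mult mult.commute)
qed

lemma penalty_term_bound:
  assumes e: "e \<in> ID"
  shows "\<bar>penalty_term e\<bar> \<le> \<gamma>0 e / diameter e * sqrt (jump_sq e) * (sqrt (face_area e) * (\<bar>off e\<bar> * cmod (cdot (jslope e) (nu e)) + R * CARD('n) * tang_jump e))"
proof -
  interpret face_frame "nu e" "\<tau> e" "{1..CARD('n)-1}" by (rule frame[OF e])
  let ?B = "\<bar>off e\<bar> * cmod (cdot (jslope e) (nu e)) + R * CARD('n) * tang_jump e"
  have B0: "?B \<ge> 0" using R(1) tang_jump_nonneg by simp
  have "L2_norm (face_measure e) (\<lambda>x. cdot (jslope e) (x - x\<^sub>0)) \<le> sqrt (face_area e) * ?B"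
  proof (rule radial_jump_norm[OF e _ B0])
    fix x assume x: "x \<in> e"
    from radial_le[OF face_point(1)[OF disjI1[OF e] x], of "jslope e"]
    show "cmod (cdot (jslope e) (x - x\<^sub>0)) \<le> ?B" by (simp only: tang_jump_eq[OF e] face_point(2)[OF disjI1[OF e] x])
  qed
  then have "\<bar>Im (L2_inner (face_measure e) (ujump e) (\<lambda>x. cdot (jslope e) (x - x\<^sub>0)))\<bar> \<le> sqrt (jump_sq e) * (sqrt (face_area e) * ?B)"
    using order.trans[OF abs_Im_le_cmod L2_cauchy_schwarz[OF ujump_L2[OF e] radial_jump_L2[OF e, of "jslope e"]]] jump_sq_nonneg[of e]
    unfolding L2_norm_ujump by (meson mult_left_mono order.trans real_sqrt_ge_zero)
  then have "\<gamma>0 e / diameter e * \<bar>Im (L2_inner (face_measure e) (ujump e) (\<lambda>x. cdot (jslope e) (x - x\<^sub>0)))\<bar>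
      \<le> \<gamma>0 e / diameter e * (sqrt (jump_sq e) * (sqrt (face_area e) * ?B))"
    using \<gamma>0[OF e] penalties_nonneg(4)[OF e] by (intro mult_left_mono) auto
  then show ?thesis using \<gamma>0[OF e] penalties_nonneg(4)[OF e] by (simp add: penalty_term_def abs_mult mult_ac)
qed

lemma tangential_penalty:
  assumes e: "e \<in> ID"
  shows "\<gamma>0 e / diameter e * sqrt (jump_sq e) * (sqrt (face_area e) * tang_jump e) \<le> \<Lambda> / 2 * (pen0 e + pen_tan e)"
proof -
  note d = penalties_nonneg(4)[OF e]
  have "sqrt ((\<gamma>0 e / diameter e) / (\<beta>1 e / diameter e)) \<le> \<Lambda>" using \<Lambda>(3)[OF e] d by simp
  from weighted_product[OF _ _ jump_sq_nonneg[of e] _ this, of "sqrt (face_area e) * tang_jump e"]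
  show ?thesis using \<gamma>0[OF e] \<beta>1[OF e] d tang_jump_nonneg face_area_nonneg
    by (simp add: pen0_def pen_tan_def power_mult_distrib)
qed

lemma normal_penalty:
  assumes e: "e \<in> \<I>"
  shows "\<gamma>0 e / diameter e * sqrt (jump_sq e) * (sqrt (face_area e) * cmod (cdot (jslope e) (nu e))) \<le> \<Lambda> / 2 * (pen0 e + pen1 e)"
proof -
  note d = penalties_nonneg(4)[OF I_in_ID[OF e]]
  have "sqrt ((\<gamma>0 e / diameter e) / (\<gamma>1 e * diameter e)) = 1 / diameter e * sqrt (\<gamma>0 e / \<gamma>1 e)"
    using d by (simp add: real_sqrt_divide real_sqrt_mult)
  then have "sqrt ((\<gamma>0 e / diameter e) / (\<gamma>1 e * diameter e)) \<le> \<Lambda>" using \<Lambda>(7)[OF e] by simp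
  from weighted_product[OF _ _ jump_sq_nonneg[of e] _ this, of "sqrt (face_area e) * cmod (cdot (jslope e) (nu e))"]
  show ?thesis using \<gamma>0[OF I_in_ID[OF e]] \<gamma>1[OF e] d face_area_nonneg
    by (simp add: pen0_def pen1_def power_mult_distrib)
qed

text \<open>
  On an interior face the normal derivative in \<open>J0\<close> is a jump, which \<open>J1\<close> controls. On the scatterer it
  is not penalised, but it carries the factor \<open>off e\<close>, and the term \<open>QG / 2\<close>, which has the same weight,
  absorbs it. This weight, rather than \<open>c\<^sub>D\<close>, is what makes the estimate uniform as \<open>c\<^sub>D\<close> tends to 0.
\<close>

lemma penalty_sum: "2 * \<bar>\<Sum>e\<in>ID. penalty_term e\<bar> \<le> QG / 2 + 4 * R * CARD('n) * \<Lambda> * Jt"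
proof -
  let ?d = "real CARD('n)"
  have d: "?d \<ge> 1" using dim by auto
  have Rd: "R \<le> R * ?d" "R \<ge> 0" using R(1) d by auto
  have sub: "\<bar>penalty_term e\<bar> \<le> \<bar>off e\<bar> * (\<gamma>0 e / diameter e * sqrt (jump_sq e) * (sqrt (face_area e) * cmod (cdot (jslope e) (nu e)))) + R * ?d * (\<Lambda> / 2 * (pen0 e + pen_tan e))"
    if e: "e \<in> ID" for e
  proof -
    have "\<bar>penalty_term e\<bar> \<le> \<bar>off e\<bar> * (\<gamma>0 e / diameter e * sqrt (jump_sq e) * (sqrt (face_area e) * cmod (cdot (jslope e) (nu e))))
       + R * ?d * (\<gamma>0 e / diameter e * sqrt (jump_sq e) * (sqrt (face_area e) * tang_jump e))"
      using penalty_term_bound[OF e] by (simp add: distrib_left mult_ac)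
    also have "R * ?d * (\<gamma>0 e / diameter e * sqrt (jump_sq e) * (sqrt (face_area e) * tang_jump e)) \<le> R * ?d * (\<Lambda> / 2 * (pen0 e + pen_tan e))"
      using tangential_penalty[OF e] Rd by (intro mult_left_mono) auto
    finally show ?thesis by simp
  qed
  have int: "2 * \<bar>penalty_term e\<bar> \<le> 4 * R * ?d * \<Lambda> * (pen0 e + pen1 e + pen_tan e)" if e: "e \<in> \<I>" for e
  proof -
    note p = penalties_nonneg[OF I_in_ID[OF e]]
    define N where "N = \<gamma>0 e / diameter e * sqrt (jump_sq e) * (sqrt (face_area e) * cmod (cdot (jslope e) (nu e)))"
    have N0: "N \<ge> 0" using \<gamma>0[OF I_in_ID[OF e]] p(4) by (simp add: N_def)
    have "\<bar>off e\<bar> * N \<le> (R * ?d) * (\<Lambda> / 2 * (pen0 e + pen1 e))"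
      using off_bound[OF disjI1[OF I_in_ID[OF e]]] Rd normal_penalty[OF e, folded N_def] N0
      by (intro mult_mono[of "\<bar>off e\<bar>" "R * ?d" N]) auto
    moreover have "\<bar>penalty_term e\<bar> \<le> \<bar>off e\<bar> * N + (R * ?d) * (\<Lambda> / 2 * (pen0 e + pen_tan e))"
      using sub[OF I_in_ID[OF e]] unfolding N_def .
    moreover have "2 * ((R * ?d) * (\<Lambda> / 2 * z)) = R * ?d * \<Lambda> * z" for z by simp
    ultimately have "2 * \<bar>penalty_term e\<bar> \<le> R * ?d * \<Lambda> * (pen0 e + pen1 e) + R * ?d * \<Lambda> * (pen0 e + pen_tan e)"
      by (smt (verit, best))
    also have "\<dots> = R * ?d * \<Lambda> * (2 * pen0 e + pen1 e + pen_tan e)" by (simp add: distrib_left)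
    also have "\<dots> \<le> R * ?d * \<Lambda> * (4 * (pen0 e + pen1 e + pen_tan e))"
      using p(1,3) p(2)[OF e] Rd \<Lambda>(1) by (intro mult_left_mono) auto
    also have "\<dots> = 4 * R * ?d * \<Lambda> * (pen0 e + pen1 e + pen_tan e)" by (simp only: mult_ac)
    finally show ?thesis .
  qed
  have wall: "2 * \<bar>penalty_term e\<bar> \<le> (- off e * (face_area e * (norm (slope (hi e)))\<^sup>2)) / 2 + 4 * R * ?d * \<Lambda> * (pen0 e + pen_tan e)" if e: "e \<in> \<D>" for e
  proof -
    note eID = D_in_ID[OF e]
    note p = penalties_nonneg[OF eID]
    have js: "jslope e = slope (hi e)" using e faces_disjoint by (auto simp: jslope_def)
    define x y where "x = sqrt (face_area e) * norm (slope (hi e))" and "y = \<gamma>0 e / diameter e * sqrt (jump_sq e)"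
    have x2: "x\<^sup>2 = face_area e * (norm (slope (hi e)))\<^sup>2" using face_area_nonneg by (simp add: x_def power_mult_distrib)
    have y0: "y \<ge> 0" using \<gamma>0[OF eID] p(4) jump_sq_nonneg by (simp add: y_def)
    have y2: "y\<^sup>2 \<le> \<Lambda> * pen0 e"
    proof -
      have "y\<^sup>2 = (\<gamma>0 e / diameter e) * pen0 e" using jump_sq_nonneg by (simp add: y_def pen0_def power_mult_distrib power2_eq_square)
      then show ?thesis using mult_right_mono[OF \<Lambda>(5)[OF e] p(1)] by simp
    qed
    have oR: "- off e \<le> R" "- off e \<ge> 0" using off_bound[OF disjI1[OF eID]] off_D_nonpos[OF e] by auto
    have "y * (sqrt (face_area e) * cmod (cdot (jslope e) (nu e))) \<le> y * x"
      unfolding x_def js using nu_cdot[OF eID] face_area_nonneg y0 by (intro mult_left_mono) auto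
    also have "\<dots> \<le> x\<^sup>2 / 4 + y\<^sup>2" using absorb[of "1/4" x y] by (simp add: mult.commute)
    finally have "- off e * (y * (sqrt (face_area e) * cmod (cdot (jslope e) (nu e)))) \<le> - off e * (x\<^sup>2 / 4 + y\<^sup>2)"
      using oR by (intro mult_left_mono) auto
    also have "\<dots> = - off e * x\<^sup>2 / 4 + - off e * y\<^sup>2" by (simp add: distrib_left)
    also have "- off e * y\<^sup>2 \<le> (R * ?d) * (\<Lambda> * pen0 e)" using oR Rd y2 by (intro mult_mono) auto
    finally have "- off e * (y * (sqrt (face_area e) * cmod (cdot (jslope e) (nu e)))) \<le> - off e * x\<^sup>2 / 4 + R * ?d * \<Lambda> * pen0 e" by simp
    moreover have "\<bar>off e\<bar> = - off e" using oR by simp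
    ultimately have m: "2 * \<bar>penalty_term e\<bar> \<le> - off e * x\<^sup>2 / 2 + (2 * (R * ?d * \<Lambda> * pen0 e) + R * ?d * \<Lambda> * (pen0 e + pen_tan e))"
      using sub[OF eID] unfolding y_def[symmetric] by simp
    have "2 * (R * ?d * \<Lambda> * pen0 e) + R * ?d * \<Lambda> * (pen0 e + pen_tan e) = R * ?d * \<Lambda> * (3 * pen0 e + pen_tan e)" by (simp add: distrib_left)
    also have "\<dots> \<le> R * ?d * \<Lambda> * (4 * (pen0 e + pen_tan e))"
      using p(1,3) Rd \<Lambda>(1) by (intro mult_left_mono) auto
    also have "\<dots> = 4 * R * ?d * \<Lambda> * (pen0 e + pen_tan e)" by (simp only: mult_ac)
    finally show ?thesis using m unfolding x2 by linarith
  qed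
  have "2 * \<bar>\<Sum>e\<in>ID. penalty_term e\<bar> \<le> (\<Sum>e\<in>ID. 2 * \<bar>penalty_term e\<bar>)" using sum_abs[of penalty_term ID] by (simp add: sum_distrib_left[symmetric])
  also have "\<dots> \<le> (\<Sum>e\<in>\<I>. 4 * R * ?d * \<Lambda> * (pen0 e + pen1 e + pen_tan e))
     + (\<Sum>e\<in>\<D>. (- off e * (face_area e * (norm (slope (hi e)))\<^sup>2)) / 2 + 4 * R * ?d * \<Lambda> * (pen0 e + pen_tan e))"
    unfolding sum_ID by (intro add_mono sum_mono int wall)
  also have "\<dots> = QG / 2 + 4 * R * ?d * \<Lambda> * Jt"
    unfolding Jt_def QG_def sum_ID by (simp add: sum.distrib sum_subtractf sum_negf sum_divide_distrib sum_distrib_left distrib_left)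
  finally show ?thesis by simp
qed

end

section \<open>The Rellich inequality\<close>

context ipdg_function
begin

definition load where "load f g v = cells_inner \<T> (\<lambda>_. f) v + bdry_inner \<T> (frontier \<Omega>\<^sub>1) (\<lambda>_. g) (bdry \<T> lab v)"

definition wall_trace where "wall_trace = (\<Sum>e\<in>\<R>. off e * (LINT x|face_measure e. (cmod (u (hi e) x))\<^sup>2))"
definition wall_flux where "wall_flux = (\<Sum>e\<in>\<R>. off e * (face_area e * (norm (slope (hi e)))\<^sup>2))"

text \<open>
  Over an interior face the two cells contribute with opposite offsets, so only the jump of \<open>|u|\<^sup>2\<close>
  remains.
\<close>

lemma radial_product_identity:
  "2 * Re (cells_inner \<T> u radial) = (\<Sum>e\<in>\<I>. volume_jump e) + wall_trace - QU - CARD('n) * U"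
proof -
  have "(\<Sum>K\<in>\<T>. CARD('n) * UK K + 2 * Re (L2_inner (lebesgue_on K) (u K) (radial K)))
      = (\<Sum>K\<in>\<T>. \<Sum>e | e facet_of K. facet_offset K e x\<^sub>0 * (LINT x|face_measure e. (cmod (u K x))\<^sup>2))"
    using cell_rellich(1) by simp
  also have "\<dots> = (\<Sum>e\<in>\<I>. volume_jump e) + wall_trace - QU"
    unfolding sum_facets volume_jump_def wall_trace_def QU_def
    by (simp add: off_lo off_def[symmetric] sum_negf)
  finally show ?thesis
    by (simp add: sum.distrib sum_distrib_left[symmetric] cells_inner_def U_def)
qed

lemma gradient_identity:
  "CARD('n) * G - 2 * (\<Sum>e\<in>ID. Re (flux_term e)) = (\<Sum>e\<in>ID. flux e) + wall_flux"
proof -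
  have "CARD('n) * G = (\<Sum>K\<in>\<T>. \<Sum>e | e facet_of K. facet_offset K e x\<^sub>0 * (face_area e * (norm (slope K))\<^sup>2))"
    using cell_rellich(2) by (simp add: G_def sum_distrib_left)
  also have "\<dots> = (\<Sum>e\<in>\<I>. off e * (face_area e * (norm (slope (hi e)))\<^sup>2) - off e * (face_area e * (norm (slope (lo e)))\<^sup>2))
      + wall_flux + (\<Sum>e\<in>\<D>. off e * (face_area e * (norm (slope (hi e)))\<^sup>2))"
    unfolding sum_facets wall_flux_def by (simp add: off_lo off_def[symmetric])
  also have "(\<Sum>e\<in>\<I>. off e * (face_area e * (norm (slope (hi e)))\<^sup>2) - off e * (face_area e * (norm (slope (lo e)))\<^sup>2))
      = (\<Sum>e\<in>\<I>. flux e + 2 * Re (flux_term e))"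
    by (rule sum.cong) (simp_all add: flux_def)
  also have "(\<Sum>e\<in>\<D>. off e * (face_area e * (norm (slope (hi e)))\<^sup>2)) = (\<Sum>e\<in>\<D>. flux e + 2 * Re (flux_term e))"
    using faces_disjoint(2) by (intro sum.cong) (auto simp: flux_def)
  finally show ?thesis unfolding sum_ID by (simp add: sum.distrib sum_distrib_left[symmetric])
qed

lemma radial_norm_cells: "(\<Sum>K\<in>\<T>. (L2_norm (lebesgue_on K) (radial K))\<^sup>2) \<le> R\<^sup>2 * G"
  unfolding G_def sum_distrib_left
proof (rule sum_mono)
  fix K assume K: "K \<in> \<T>"
  note int = integrable_on_compact[OF cell_compact_convex(1)[OF K]]
  have "(L2_norm (lebesgue_on K) (radial K))\<^sup>2 = (LINT x|lebesgue_on K. (cmod (radial K x))\<^sup>2)" by (rule L2_norm_sq)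
  also have "\<dots> \<le> (LINT x|lebesgue_on K. (norm (slope K) * R)\<^sup>2)"
  proof (rule integral_mono)
    show "integrable (lebesgue_on K) (\<lambda>x. (cmod (radial K x))\<^sup>2)" by (intro int continuous_intros cont_radial[OF K])
    show "integrable (lebesgue_on K) (\<lambda>x. (norm (slope K) * R)\<^sup>2)" by (intro int continuous_intros)
    fix x assume "x \<in> space (lebesgue_on K)"
    then have "x \<in> \<Union>\<T>" using K by auto
    then have "x \<in> closure \<Omega>\<^sub>1" unfolding cover using closure_mono[of "\<Omega>\<^sub>1 - D" \<Omega>\<^sub>1] by auto
    then have "norm (x - x\<^sub>0) \<le> R" by (rule R)
    then have "cmod (radial K x) \<le> norm (slope K) * R"
      unfolding radial_eq[OF K] by (rule order.trans[OF norm_cdot_le mult_left_mono]) simp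
    then show "(cmod (radial K x))\<^sup>2 \<le> (norm (slope K) * R)\<^sup>2" by (rule power_mono) simp
  qed
  also have "\<dots> = R\<^sup>2 * GK K" by (simp add: GK_def cell_vol_def power_mult_distrib)
  finally show "(L2_norm (lebesgue_on K) (radial K))\<^sup>2 \<le> R\<^sup>2 * GK K" .
qed

lemma radial_norm_wall:
  assumes e: "e \<in> \<R>"
  shows "(L2_norm (face_measure e) (radial (hi e)))\<^sup>2 \<le> R\<^sup>2 * (face_area e * (norm (slope (hi e)))\<^sup>2)"
proof -
  note fc = face_cells(1,2)[OF disjI2[OF e]]
  have "(L2_norm (face_measure e) (radial (hi e)))\<^sup>2 = (LINT x|face_measure e. (cmod (radial (hi e) x))\<^sup>2)" by (rule L2_norm_sq)
  also have "\<dots> \<le> (LINT x|face_measure e. (norm (slope (hi e)) * R)\<^sup>2)"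
  proof (rule face_integral_le[OF fc])
    fix x assume x: "x \<in> e"
    have "cmod (radial (hi e) x) \<le> norm (slope (hi e)) * R"
      unfolding radial_eq[OF fc(1)] using face_point(1)[OF disjI2[OF e] x]
      by (rule order.trans[OF norm_cdot_le mult_left_mono]) simp
    then show "(cmod (radial (hi e) x))\<^sup>2 \<le> (norm (slope (hi e)) * R)\<^sup>2" by (rule power_mono) simp
  qed (intro continuous_intros cont_radial[OF fc(1)])+
  also have "\<dots> = R\<^sup>2 * (face_area e * (norm (slope (hi e)))\<^sup>2)"
    unfolding face_integral_const by (simp add: power_mult_distrib)
  finally show ?thesis .
qed

lemma wall_L2: "e \<in> \<R> \<Longrightarrow> L2_fun (face_measure e) (u (hi e))" "e \<in> \<R> \<Longrightarrow> L2_fun (face_measure e) (radial (hi e))"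
  using facet_L2 face_cells(1,2) cont_u cont_radial by blast+

lemma YR_bound: "\<bar>YR\<bar> \<le> R * (sqrt XR * sqrt GR)"
proof -
  have "\<bar>YR\<bar> \<le> (\<Sum>e\<in>\<R>. \<bar>Im (L2_inner (face_measure e) (u (hi e)) (radial (hi e)))\<bar>)"
    unfolding YR_def by (rule sum_abs)
  also have "\<dots> \<le> sqrt XR * sqrt (\<Sum>e\<in>\<R>. R\<^sup>2 * (face_area e * (norm (slope (hi e)))\<^sup>2))"
    unfolding XR_def
  proof (rule sum_le_sqrt_mult_sqrt)
    fix e assume e: "e \<in> \<R>"
    have "\<bar>Im (L2_inner (face_measure e) (u (hi e)) (radial (hi e)))\<bar> \<le> L2_norm (face_measure e) (u (hi e)) * L2_norm (face_measure e) (radial (hi e))"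
      using abs_Im_le_cmod L2_cauchy_schwarz[OF wall_L2[OF e]] order.trans by blast
    also have "\<dots> \<le> L2_norm (face_measure e) (u (hi e)) * sqrt (R\<^sup>2 * (face_area e * (norm (slope (hi e)))\<^sup>2))"
      by (intro mult_left_mono real_le_rsqrt radial_norm_wall e) simp
    finally show "\<bar>Im (L2_inner (face_measure e) (u (hi e)) (radial (hi e)))\<bar>
       \<le> sqrt (LINT x|face_measure e. (cmod (u (hi e) x))\<^sup>2) * sqrt (R\<^sup>2 * (face_area e * (norm (slope (hi e)))\<^sup>2))"
      by (simp only: L2_norm_def)
  qed auto
  also have "\<dots> = R * (sqrt XR * sqrt GR)"
    unfolding sum_distrib_left[symmetric] GR_def[symmetric] using R(1) by (simp add: real_sqrt_mult)
  finally show ?thesis .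
qed

lemma wall_signs: "wall_flux \<ge> c\<^sub>\<Omega> * GR" "wall_trace \<le> R * XR" "XR \<ge> 0" "GR \<ge> 0"
proof -
  show "wall_flux \<ge> c\<^sub>\<Omega> * GR" unfolding wall_flux_def GR_def sum_distrib_left
    by (intro sum_mono mult_right_mono off_R) auto
  have "off e \<le> R" if "e \<in> \<R>" for e using off_bound[OF disjI2[OF that]] by simp
  then show "wall_trace \<le> R * XR" unfolding wall_trace_def XR_def sum_distrib_left
    by (intro sum_mono mult_right_mono) auto
qed (auto simp: XR_def GR_def intro!: sum_nonneg)

lemma load_bound:
  assumes f: "L2_fun (lebesgue_on (\<Omega>\<^sub>1 - D)) f" and g: "bdry_L2 \<T> (frontier \<Omega>\<^sub>1) g"
    and v: "\<And>K. K \<in> \<T> \<Longrightarrow> continuous_on UNIV (v K)"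
    and A: "(\<Sum>K\<in>\<T>. (L2_norm (lebesgue_on K) (v K))\<^sup>2) \<le> A\<^sup>2" "A \<ge> 0"
    and B: "(\<Sum>e\<in>\<R>. (L2_norm (face_measure e) (v (hi e)))\<^sup>2) \<le> B\<^sup>2" "B \<ge> 0"
  shows "cmod (load f g v) \<le> (L2_norm (lebesgue_on (\<Omega>\<^sub>1 - D)) f + bdry_norm \<T> (frontier \<Omega>\<^sub>1) g) * (A + B)"
proof -
  let ?F = "L2_norm (lebesgue_on (\<Omega>\<^sub>1 - D)) f" and ?G = "bdry_norm \<T> (frontier \<Omega>\<^sub>1) g"
  have G0: "?G \<ge> 0" by (simp add: bdry_norm_def sum_nonneg)
  have "cmod (cells_inner \<T> (\<lambda>_. f) v) \<le> ?F * sqrt (\<Sum>K\<in>\<T>. (L2_norm (lebesgue_on K) (v K))\<^sup>2)"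
    by (rule source_bound[OF f v])
  also have "\<dots> \<le> ?F * A" by (intro mult_left_mono real_le_lsqrt A) (auto intro!: sum_nonneg)
  finally have 1: "cmod (cells_inner \<T> (\<lambda>_. f) v) \<le> ?F * A" .
  have "cmod (bdry_inner \<T> (frontier \<Omega>\<^sub>1) (\<lambda>_. g) (bdry \<T> lab v)) \<le> (\<Sum>e\<in>\<R>. cmod (L2_inner (face_measure e) g (v (hi e))))"
    unfolding bdry_inner_def bdry_def by (rule norm_sum)
  also have "\<dots> \<le> sqrt (\<Sum>e\<in>\<R>. (L2_norm (face_measure e) g)\<^sup>2) * sqrt (\<Sum>e\<in>\<R>. (L2_norm (face_measure e) (v (hi e)))\<^sup>2)"
  proof (rule sum_le_sqrt_mult_sqrt)
    fix e assume e: "e \<in> \<R>"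
    have "L2_fun (face_measure e) (v (hi e))" using facet_L2 face_cells(1,2) v e by blast
    moreover have "L2_fun (face_measure e) g" using g e by (simp add: bdry_L2_def)
    ultimately show "cmod (L2_inner (face_measure e) g (v (hi e))) \<le> sqrt ((L2_norm (face_measure e) g)\<^sup>2) * sqrt ((L2_norm (face_measure e) (v (hi e)))\<^sup>2)"
      using L2_cauchy_schwarz by simp
  qed auto
  also have "\<dots> \<le> ?G * B" unfolding bdry_norm_def
    by (intro mult_left_mono real_le_lsqrt B) (auto intro!: sum_nonneg)
  finally have 2: "cmod (bdry_inner \<T> (frontier \<Omega>\<^sub>1) (\<lambda>_. g) (bdry \<T> lab v)) \<le> ?G * B" .
  have "cmod (load f g v) \<le> ?F * A + ?G * B" unfolding load_def using 1 2 norm_triangle_le add_mono by blast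
  also have "\<dots> \<le> (?F + ?G) * (A + B)" using A(2) B(2) G0 by (simp add: distrib_left distrib_right)
  finally show ?thesis .
qed

context
  fixes f g :: "real^'n \<Rightarrow> complex"
  assumes sol: "ipdg_solution \<T> lab (frontier \<Omega>\<^sub>1) (frontier D) \<tau> \<gamma>0 \<gamma>1 \<beta>1 k f g u"
begin

lemma scheme:
  assumes "v \<in> Vh \<T>"
  shows "a_h \<T> lab (frontier D) \<tau> \<gamma>0 \<gamma>1 \<beta>1 u v - of_real (k\<^sup>2) * cells_inner \<T> u v
          + \<i> * of_real k * bdry_inner \<T> (frontier \<Omega>\<^sub>1) (bdry \<T> lab u) (bdry \<T> lab v) = load f g v"
  using sol assms unfolding ipdg_solution_def load_def by blast

lemma energy_identities:
  "Jt + k * XR = Im (load f g u)" "G - 2 * (\<Sum>e\<in>ID. Re (consistency_term e)) - k\<^sup>2 * U = Re (load f g u)"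
proof -
  have "of_real (G - 2 * (\<Sum>e\<in>ID. Re (consistency_term e))) + \<i> * of_real Jt - of_real (k\<^sup>2) * of_real U + \<i> * of_real k * of_real XR = load f g u"
    using scheme[OF u] unfolding form_a_self cells_self bdry_self .
  then have "Im (of_real (G - 2 * (\<Sum>e\<in>ID. Re (consistency_term e))) + \<i> * of_real Jt - of_real (k\<^sup>2) * of_real U + \<i> * of_real k * of_real XR) = Im (load f g u)"
    "Re (of_real (G - 2 * (\<Sum>e\<in>ID. Re (consistency_term e))) + \<i> * of_real Jt - of_real (k\<^sup>2) * of_real U + \<i> * of_real k * of_real XR) = Re (load f g u)"
    by simp_all
  then show "Jt + k * XR = Im (load f g u)" "G - 2 * (\<Sum>e\<in>ID. Re (consistency_term e)) - k\<^sup>2 * U = Re (load f g u)"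
    by (simp_all del: of_real_power of_real_diff of_real_mult of_real_sum)
qed

lemma rellich_test:
  "G - (\<Sum>e\<in>ID. Re (flux_term e)) - (\<Sum>e\<in>ID. Re (consistency_term e)) - (\<Sum>e\<in>ID. penalty_term e) - k\<^sup>2 * Re (cells_inner \<T> u radial) - k * YR = Re (load f g radial)"
proof -
  have "Re (of_real r * z) = r * Re z" "Re (\<i> * of_real r * z) = - r * Im z" for r z by simp_all
  then have "Re (a_h \<T> lab (frontier D) \<tau> \<gamma>0 \<gamma>1 \<beta>1 u radial) - k\<^sup>2 * Re (cells_inner \<T> u radial)
     + - k * Im (bdry_inner \<T> (frontier \<Omega>\<^sub>1) (bdry \<T> lab u) (bdry \<T> lab radial)) = Re (load f g radial)"
    unfolding scheme[OF radial_Vh, symmetric] by (simp only: plus_complex.sel minus_complex.sel)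
  then show ?thesis unfolding form_a_radial bdry_radial by simp
qed

text \<open>
  The radial test function produces \<open>(2 - d) G + d k\<^sup>2 U\<close> from the volume terms. Replacing \<open>G\<close> in
  \<open>(2 - d) G\<close> by means of the energy identity turns this into \<open>2 k\<^sup>2 U\<close>, independently of the
  dimension. The face terms either have a sign or are products of traces and penalised jumps.
\<close>

lemma rellich_inequality:
  "2 * (k\<^sup>2 * U) + c\<^sub>\<Omega> * GR + (QG / 2 + k\<^sup>2 * QU)
    \<le> 2 * cmod (load f g radial) + CARD('n) * (2 * face_budget + cmod (load f g u)) + 4 * R * CARD('n) * face_budget + 2 * face_budget
      + 4 * R * CARD('n) * \<Lambda> * Jt + 2 * R * (sqrt (trace_const * ((CARD('n) + 1) * (k\<^sup>2 * U))) * sqrt (\<Lambda> * Jt))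
      + R * (k\<^sup>2 * XR) + 2 * R * (k * sqrt XR * sqrt GR)"
proof -
  let ?d = "real CARD('n)"
  define S Z I V where "S = (\<Sum>e\<in>ID. Re (flux_term e))" and "Z = (\<Sum>e\<in>ID. Re (consistency_term e))" and "I = (\<Sum>e\<in>ID. penalty_term e)"
    and "V = (\<Sum>e\<in>\<I>. volume_jump e)"
  define \<phi> where "\<phi> = Re (load f g u)"
  have d2: "?d \<ge> 2" using dim by auto
  have e2: "G = k\<^sup>2 * U + 2 * Z + \<phi>" using energy_identities(2) unfolding Z_def \<phi>_def by linarith
  have e3: "2 * G - 2 * S - 2 * Z - 2 * I - k\<^sup>2 * (V + wall_trace - QU - ?d * U) - 2 * (k * YR) = 2 * Re (load f g radial)"
  proof -
    have W: "V + wall_trace - QU - ?d * U = 2 * Re (cells_inner \<T> u radial)"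
      using radial_product_identity unfolding V_def by simp
    have "k\<^sup>2 * (2 * Re (cells_inner \<T> u radial)) = 2 * (k\<^sup>2 * Re (cells_inner \<T> u radial))" by simp
    then show ?thesis unfolding W S_def Z_def I_def using rellich_test by linarith
  qed
  have e5: "?d * G - 2 * S = (\<Sum>e\<in>ID. flux e) + wall_flux" using gradient_identity unfolding S_def .
  have dG: "?d * G = ?d * (k\<^sup>2 * U) + ?d * (2 * Z + \<phi>)" unfolding e2 by (simp add: algebra_simps)
  have e3': "2 * G - 2 * S - 2 * Z - 2 * I - k\<^sup>2 * V - k\<^sup>2 * wall_trace + k\<^sup>2 * QU + ?d * (k\<^sup>2 * U) - 2 * (k * YR) = 2 * Re (load f g radial)"
    using e3 by (simp add: algebra_simps)
  have main: "2 * (k\<^sup>2 * U) + (2 * (2 * Z + \<phi>) - ?d * (2 * Z + \<phi>)) + (\<Sum>e\<in>ID. flux e) + wall_flux - 2 * Z - 2 * I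
      - k\<^sup>2 * V - k\<^sup>2 * wall_trace + k\<^sup>2 * QU - 2 * (k * YR) = 2 * Re (load f g radial)"
  proof -
    define P Q where "P = ?d * (2 * Z + \<phi>)" and "Q = ?d * (k\<^sup>2 * U)"
    show ?thesis
      using e3' e5 dG e2 unfolding P_def[symmetric] Q_def[symmetric] by argo
  qed
  have Zb: "\<bar>Z\<bar> \<le> face_budget" unfolding Z_def by (rule consistency_bound)
  have \<phi>b: "\<bar>\<phi>\<bar> \<le> cmod (load f g u)" unfolding \<phi>_def by (rule abs_Re_le_cmod)
  have b1: "?d * (2 * Z + \<phi>) - 2 * (2 * Z + \<phi>) \<le> ?d * (2 * face_budget + cmod (load f g u))"
  proof -
    have "(?d - 2) * (2 * Z + \<phi>) \<le> (?d - 2) * (2 * face_budget + cmod (load f g u))"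
      using Zb \<phi>b d2 by (intro mult_left_mono) auto
    also have "\<dots> \<le> ?d * (2 * face_budget + cmod (load f g u))" using Zb \<phi>b by (intro mult_right_mono) auto
    finally show ?thesis by (simp add: left_diff_distrib)
  qed
  have b2: "(\<Sum>e\<in>ID. flux e) \<ge> QG - 4 * R * ?d * face_budget" by (rule flux_sum)
  have b3: "2 * \<bar>I\<bar> \<le> QG / 2 + 4 * R * ?d * \<Lambda> * Jt" unfolding I_def by (rule penalty_sum)
  have b4: "k\<^sup>2 * V \<le> 2 * R * (sqrt (trace_const * ((CARD('n) + 1) * (k\<^sup>2 * U))) * sqrt (\<Lambda> * Jt))"
    unfolding V_def by (rule order.trans[OF mult_left_mono[OF abs_ge_self] volume_jump_sum]) simp
  have b5: "k\<^sup>2 * wall_trace \<le> R * (k\<^sup>2 * XR)"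
    using mult_left_mono[OF wall_signs(2), of "k\<^sup>2"] by (simp add: mult_ac)
  have b6: "2 * (k * YR) \<le> 2 * R * (k * sqrt XR * sqrt GR)"
  proof -
    have "k * YR \<le> k * (R * (sqrt XR * sqrt GR))" using YR_bound k by (intro mult_left_mono) auto
    then show ?thesis by (simp add: mult_ac)
  qed
  have b7: "Re (load f g radial) \<le> cmod (load f g radial)" by (rule complex_Re_le_cmod)
  show ?thesis using main Zb b1 b2 b3 b4 b5 b6 b7 wall_signs(1) abs_le_D1[OF order_refl, of I] abs_le_D1[OF Zb] by linarith
qed

section \<open>Stability\<close>

lemma stability:
  assumes f: "L2_fun (lebesgue_on (\<Omega>\<^sub>1 - D)) f" and g: "bdry_L2 \<T> (frontier \<Omega>\<^sub>1) g"
    and E: "energy_bound c\<^sub>\<Omega> (10 * R * CARD('n) * (sqrt (trace_const * (CARD('n) + 1)) + 1)) E" and E0: "E > 0"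
  shows "cells_norm \<T> u + 1 / k * norm_1h \<T> lab (frontier D) \<tau> \<gamma>0 \<gamma>1 \<beta>1 u
      + 1 / k * sqrt (\<Sum>e\<in>\<R>. (L2_norm (face_measure e) (grad (bdry \<T> lab u e)))\<^sup>2)
      + 1 / k * sqrt (\<Sum>e\<in>\<D>. c\<^sub>D * (k\<^sup>2 * (L2_norm (face_measure e) (bdry \<T> lab u e))\<^sup>2
             + (L2_norm (face_measure e) (grad (bdry \<T> lab u e)))\<^sup>2))
    \<le> 6 * E * (1 / k * (1 + (1 + \<Lambda>) / k)) * (L2_norm (lebesgue_on (\<Omega>\<^sub>1 - D)) f + bdry_norm \<T> (frontier \<Omega>\<^sub>1) g)"
proof -
  let ?d = "real CARD('n)"
  define M where "M = L2_norm (lebesgue_on (\<Omega>\<^sub>1 - D)) f + bdry_norm \<T> (frontier \<Omega>\<^sub>1) g"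
  define c1 where "c1 = sqrt (trace_const * (?d + 1))"
  define w gr r q j \<mu> \<phi> where "w = k * sqrt U" and "gr = sqrt G" and "r = sqrt GR"
    and "q = sqrt (QG / 2 + k\<^sup>2 * QU)" and "j = sqrt (\<Lambda> * Jt)" and "\<mu> = k * sqrt XR" and "\<phi> = cmod (load f g u)"
  \<comment> \<open>large enough for every coefficient in \<open>rellich_inequality\<close> and in the energy identity\<close>
  define C where "C = 10 * R * ?d * (c1 + 1)"
  have d2: "?d \<ge> 2" using dim by auto
  have QG0: "QG \<ge> 0" unfolding QG_def using off_D_nonpos by (intro sum_nonneg mult_nonneg_nonneg) auto
  have QU0: "QU \<ge> 0" unfolding QU_def using off_D_nonpos by (intro sum_nonneg mult_nonneg_nonneg) auto
  have c10: "c1 \<ge> 0" by (simp add: c1_def)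
  have M0: "M \<ge> 0" by (simp add: M_def bdry_norm_def sum_nonneg)
  have pos: "w \<ge> 0" "gr \<ge> 0" "r \<ge> 0" "q \<ge> 0" "j \<ge> 0" "\<mu> \<ge> 0" "\<phi> \<ge> 0"
    using k wall_signs QG0 QU0 \<Lambda>(1) Jt_nonneg by (auto simp: w_def gr_def r_def q_def j_def \<mu>_def \<phi>_def)
  have sq: "w\<^sup>2 = k\<^sup>2 * U" "gr\<^sup>2 = G" "r\<^sup>2 = GR" "q\<^sup>2 = QG / 2 + k\<^sup>2 * QU" "j\<^sup>2 = \<Lambda> * Jt" "\<mu>\<^sup>2 = k\<^sup>2 * XR"
    using wall_signs(3,4) QG0 QU0 \<Lambda>(1) Jt_nonneg
    by (simp_all add: w_def gr_def r_def q_def j_def \<mu>_def power_mult_distrib)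
  have PTe: "face_budget = c1 * (gr * j)" unfolding face_budget_def c1_def gr_def j_def
    by (simp add: real_sqrt_mult add.commute mult.assoc)
  have Fw: "cmod (load f g radial) \<le> R * (M * (gr + r))"
  proof -
    have "cmod (load f g radial) \<le> M * (R * gr + R * r)"
      unfolding M_def
    proof (rule load_bound[OF f g])
      show "(\<Sum>K\<in>\<T>. (L2_norm (lebesgue_on K) (radial K))\<^sup>2) \<le> (R * gr)\<^sup>2"
        using radial_norm_cells by (simp add: power_mult_distrib sq)
      have "(\<Sum>e\<in>\<R>. (L2_norm (face_measure e) (radial (hi e)))\<^sup>2) \<le> R\<^sup>2 * GR"
        unfolding GR_def sum_distrib_left by (intro sum_mono radial_norm_wall)
      then show "(\<Sum>e\<in>\<R>. (L2_norm (face_measure e) (radial (hi e)))\<^sup>2) \<le> (R * r)\<^sup>2"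
        by (simp add: power_mult_distrib sq)
    qed (use R(1) pos cont_radial in auto)
    then show ?thesis by (simp add: distrib_left mult_ac)
  qed
  have Fu: "k * \<phi> \<le> M * (w + \<mu>)"
  proof -
    have "\<phi> \<le> M * (sqrt U + sqrt XR)"
      unfolding M_def \<phi>_def
    proof (rule load_bound[OF f g])
      show "(\<Sum>K\<in>\<T>. (L2_norm (lebesgue_on K) (u K))\<^sup>2) \<le> (sqrt U)\<^sup>2"
        by (simp add: L2_norm_sq U_def[unfolded UK_def, symmetric])
      show "(\<Sum>e\<in>\<R>. (L2_norm (face_measure e) (u (hi e)))\<^sup>2) \<le> (sqrt XR)\<^sup>2"
        using wall_signs(3) by (simp add: L2_norm_sq XR_def)
    qed (use wall_signs(3) cont_u in auto)
    then have "k * \<phi> \<le> k * (M * (sqrt U + sqrt XR))" using k by (intro mult_left_mono) auto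
    then show ?thesis by (simp add: w_def \<mu>_def distrib_left mult_ac)
  qed
  have Rd: "R \<ge> 1" "R * ?d \<ge> 2 * R" "R * ?d \<ge> ?d"
    using R(1) d2 mult_left_mono[OF d2, of R] mult_right_mono[OF R(1), of ?d] by auto
  have C: "20 * R \<le> C" "10 * (R * ?d) \<le> C" "10 * (R * ?d) * c1 \<le> C"
  proof -
    have "C = 10 * (R * ?d) * c1 + 10 * (R * ?d)" by (simp add: C_def distrib_left)
    moreover have "10 * (R * ?d) * c1 \<ge> 0" using Rd c10 by simp
    ultimately show "20 * R \<le> C" "10 * (R * ?d) \<le> C" "10 * (R * ?d) * c1 \<le> C" using Rd by linarith+
  qed
  have C1: "C \<ge> 1" using C(1) Rd(1) by linarith
  have H1: "2 * w\<^sup>2 + c\<^sub>\<Omega> * r\<^sup>2 + q\<^sup>2 \<le> C * (gr * j + w * j + j\<^sup>2 + \<mu>\<^sup>2 + \<mu> * r + \<phi> + M * (gr + r))"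
  proof -
    have t1: "sqrt (trace_const * (real (CARD('n) + 1) * (k\<^sup>2 * U))) * sqrt (\<Lambda> * Jt) = c1 * (w * j)"
      using k by (simp add: c1_def w_def j_def real_sqrt_mult add.commute mult.assoc)
    have t2: "2 * R * (k * sqrt XR * sqrt GR) = 2 * R * (\<mu> * r)" by (simp add: \<mu>_def r_def)
    have "2 * w\<^sup>2 + c\<^sub>\<Omega> * r\<^sup>2 + q\<^sup>2 \<le> 2 * cmod (load f g radial) + ?d * (2 * (c1 * (gr * j)) + \<phi>) + 4 * R * ?d * (c1 * (gr * j)) + 2 * (c1 * (gr * j))
      + 4 * R * ?d * \<Lambda> * Jt + 2 * R * (c1 * (w * j)) + R * \<mu>\<^sup>2 + 2 * R * (\<mu> * r)"
      using rellich_inequality unfolding sq \<phi>_def[symmetric] PTe t1 t2 .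
    also have "4 * R * ?d * \<Lambda> * Jt = 4 * (R * ?d) * j\<^sup>2" by (simp add: sq)
    also have "2 * cmod (load f g radial) + ?d * (2 * (c1 * (gr * j)) + \<phi>) + 4 * R * ?d * (c1 * (gr * j)) + 2 * (c1 * (gr * j))
      + 4 * (R * ?d) * j\<^sup>2 + 2 * R * (c1 * (w * j)) + R * \<mu>\<^sup>2 + 2 * R * (\<mu> * r)
      \<le> C * (M * (gr + r)) + (C * (gr * j) + C * \<phi>) + C * j\<^sup>2 + C * (w * j) + C * \<mu>\<^sup>2 + C * (\<mu> * r)"
    proof -
      have a: "2 * cmod (load f g radial) \<le> C * (M * (gr + r))"
      proof -
        have "2 * cmod (load f g radial) \<le> (2 * R) * (M * (gr + r))" using Fw by simp
        also have "\<dots> \<le> C * (M * (gr + r))" using C(1) Rd(1) M0 pos by (intro mult_right_mono) auto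
        finally show ?thesis .
      qed
      have b: "?d * (2 * (c1 * (gr * j)) + \<phi>) + 4 * R * ?d * (c1 * (gr * j)) + 2 * (c1 * (gr * j)) \<le> C * (gr * j) + C * \<phi>"
      proof -
        have "(2 * ?d + 4 * (R * ?d) + 2) * c1 \<le> (10 * (R * ?d)) * c1" using Rd d2 c10 by (intro mult_right_mono) linarith+
        then have "(2 * ?d + 4 * (R * ?d) + 2) * c1 \<le> C" using C(3) by linarith
        then have "(2 * ?d + 4 * (R * ?d) + 2) * c1 * (gr * j) \<le> C * (gr * j)" by (rule mult_right_mono) (use pos in simp)
        moreover have "?d * \<phi> \<le> C * \<phi>" using C(2) Rd d2 pos by (intro mult_right_mono) linarith+
        ultimately show ?thesis by (simp add: distrib_left distrib_right mult_ac)
      qed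
      have c: "4 * (R * ?d) * j\<^sup>2 \<le> C * j\<^sup>2"
      proof (rule mult_right_mono)
        show "4 * (R * ?d) \<le> C" using C(2) Rd d2 by linarith
      qed simp
      have d: "2 * R * (c1 * (w * j)) \<le> C * (w * j)"
      proof -
        have "(2 * R) * c1 \<le> (10 * (R * ?d)) * c1" using Rd d2 c10 by (intro mult_right_mono) linarith+
        then have "(2 * R) * c1 \<le> C" using C(3) by linarith
        then have "(2 * R) * c1 * (w * j) \<le> C * (w * j)" by (rule mult_right_mono) (use pos in simp)
        then show ?thesis by (simp add: mult_ac)
      qed
      have e: "R * \<mu>\<^sup>2 \<le> C * \<mu>\<^sup>2" using C(1) Rd by (intro mult_right_mono) auto
      have f: "2 * R * (\<mu> * r) \<le> C * (\<mu> * r)" using C(1) Rd pos by (intro mult_right_mono) auto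
      show ?thesis using a b c d e f by linarith
    qed
    finally show ?thesis by (simp add: distrib_left add_ac)
  qed
  have H2: "gr\<^sup>2 \<le> w\<^sup>2 + C * (gr * j + \<phi>)"
  proof -
    have "G = k\<^sup>2 * U + 2 * (\<Sum>e\<in>ID. Re (consistency_term e)) + Re (load f g u)" using energy_identities(2) by linarith
    moreover have "(\<Sum>e\<in>ID. Re (consistency_term e)) \<le> c1 * (gr * j)" using consistency_bound PTe by simp
    moreover have "Re (load f g u) \<le> \<phi>" unfolding \<phi>_def by (rule complex_Re_le_cmod)
    ultimately have 1: "gr\<^sup>2 \<le> w\<^sup>2 + 2 * c1 * (gr * j) + \<phi>" unfolding sq by linarith
    have "2 * c1 \<le> 10 * (R * ?d) * c1" using Rd d2 c10 by (intro mult_right_mono) linarith+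
    then have "2 * c1 \<le> C" using C(3) by linarith
        then have "2 * c1 * (gr * j) \<le> C * (gr * j)" by (rule mult_right_mono) (use pos in simp)
    moreover have "1 * \<phi> \<le> C * \<phi>" using C1 pos by (intro mult_right_mono) auto
    ultimately show ?thesis using 1 by (simp add: distrib_left)
  qed
  have H4: "Jt + \<mu>\<^sup>2 / k \<le> \<phi>"
  proof -
    have "\<mu>\<^sup>2 / k = k * XR" unfolding sq using k by (simp add: power2_eq_square)
    then show ?thesis using energy_identities(1) abs_Im_le_cmod[of "load f g u"] unfolding \<phi>_def by linarith
  qed
  define b where "b = E * ((1 + (1 + \<Lambda>) / k) * M)"
  have "let b = E * ((1 + (1 + \<Lambda>) / k) * M) in w \<le> b \<and> gr \<le> b \<and> r \<le> b \<and> q \<le> b \<and> sqrt Jt \<le> b"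
  proof -
    have EC: "energy_bound c\<^sub>\<Omega> C E" using E unfolding C_def c1_def by (simp add: add.commute)
    show ?thesis
      by (rule EC[unfolded energy_bound_def, rule_format, of w gr r q j Jt \<mu> M \<phi> \<Lambda> k])
        (use pos M0 Jt_nonneg \<Lambda>(1) k H1 H2 Fu H4 sq(5) in blast)
  qed
  then have bb: "w \<le> b" "gr \<le> b" "r \<le> b" "q \<le> b" "sqrt Jt \<le> b" unfolding Let_def b_def by auto
  have n1: "cells_norm \<T> u \<le> 1 / k * b"
  proof -
    have "cells_norm \<T> u = sqrt U" by (simp add: cells_norm_def L2_norm_sq U_def UK_def)
    also have "\<dots> = 1 / k * w" using k by (simp add: w_def)
    finally show ?thesis using bb(1) k by (simp add: divide_right_mono)
  qed
  have n2: "norm_1h \<T> lab (frontier D) \<tau> \<gamma>0 \<gamma>1 \<beta>1 u \<le> 2 * b"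
  proof -
    have "(\<Sum>K\<in>\<T>. (L2_norm (lebesgue_on K) (grad (u K)))\<^sup>2) = G"
      unfolding G_def by (rule sum.cong) (simp_all add: L2_norm_sq grad_u GK_def cell_vol_def)
    then have "norm_1h \<T> lab (frontier D) \<tau> \<gamma>0 \<gamma>1 \<beta>1 u = sqrt (G + Jt)"
      unfolding norm_1h_def form_J0 form_J1 form_L1 Jt_def by (simp add: add_ac)
    also have "\<dots> \<le> sqrt G + sqrt Jt" by (rule sqrt_add_le_add_sqrt) (use Jt_nonneg in auto)
    finally show ?thesis using bb(2,5) by (simp add: gr_def)
  qed
  have grad_face: "(L2_norm (face_measure e) (grad (bdry \<T> lab u e)))\<^sup>2 = face_area e * (norm (slope (hi e)))\<^sup>2" if "e \<in> \<R> \<or> e \<in> \<D>" for e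
    using face_cells(1)[of e] that D_in_ID[of e] by (auto simp: L2_norm_sq bdry_def grad_u face_area_def)
  have n3: "sqrt (\<Sum>e\<in>\<R>. (L2_norm (face_measure e) (grad (bdry \<T> lab u e)))\<^sup>2) \<le> b"
    using bb(3) by (simp add: grad_face r_def GR_def)
  have n4: "sqrt (\<Sum>e\<in>\<D>. c\<^sub>D * (k\<^sup>2 * (L2_norm (face_measure e) (bdry \<T> lab u e))\<^sup>2
             + (L2_norm (face_measure e) (grad (bdry \<T> lab u e)))\<^sup>2)) \<le> 2 * b"
  proof -
    have "(\<Sum>e\<in>\<D>. c\<^sub>D * (k\<^sup>2 * (L2_norm (face_measure e) (bdry \<T> lab u e))\<^sup>2
             + (L2_norm (face_measure e) (grad (bdry \<T> lab u e)))\<^sup>2))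
       \<le> (\<Sum>e\<in>\<D>. - off e * (k\<^sup>2 * (LINT x|face_measure e. (cmod (u (hi e) x))\<^sup>2) + face_area e * (norm (slope (hi e)))\<^sup>2))"
    proof (rule sum_mono)
      fix e assume e: "e \<in> \<D>"
      have "(L2_norm (face_measure e) (bdry \<T> lab u e))\<^sup>2 = (LINT x|face_measure e. (cmod (u (hi e) x))\<^sup>2)"
        by (simp add: L2_norm_sq bdry_def)
      moreover have "c\<^sub>D * (k\<^sup>2 * (LINT x|face_measure e. (cmod (u (hi e) x))\<^sup>2) + face_area e * (norm (slope (hi e)))\<^sup>2)
        \<le> - off e * (k\<^sup>2 * (LINT x|face_measure e. (cmod (u (hi e) x))\<^sup>2) + face_area e * (norm (slope (hi e)))\<^sup>2)"
        by (rule mult_right_mono[OF off_D[OF e]]) simp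
      ultimately show "c\<^sub>D * (k\<^sup>2 * (L2_norm (face_measure e) (bdry \<T> lab u e))\<^sup>2 + (L2_norm (face_measure e) (grad (bdry \<T> lab u e)))\<^sup>2)
        \<le> - off e * (k\<^sup>2 * (LINT x|face_measure e. (cmod (u (hi e) x))\<^sup>2) + face_area e * (norm (slope (hi e)))\<^sup>2)"
        using grad_face[of e] e by simp
    qed
    also have "\<dots> = k\<^sup>2 * QU + QG" unfolding QU_def QG_def
      by (simp add: distrib_left sum.distrib sum_distrib_left sum_subtractf sum_negf mult_ac)
    also have "\<dots> \<le> (2 * q)\<^sup>2" using QG0 QU0 by (simp add: power_mult_distrib sq)
    finally have "sqrt (\<Sum>e\<in>\<D>. c\<^sub>D * (k\<^sup>2 * (L2_norm (face_measure e) (bdry \<T> lab u e))\<^sup>2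
             + (L2_norm (face_measure e) (grad (bdry \<T> lab u e)))\<^sup>2)) \<le> 2 * q"
      using pos(4) by (intro real_le_lsqrt) auto
    then show ?thesis using bb(4) by linarith
  qed
  have m1: "1 / k * norm_1h \<T> lab (frontier D) \<tau> \<gamma>0 \<gamma>1 \<beta>1 u \<le> 1 / k * (2 * b)"
    using n2 k by (intro mult_left_mono) auto
  have m2: "1 / k * sqrt (\<Sum>e\<in>\<R>. (L2_norm (face_measure e) (grad (bdry \<T> lab u e)))\<^sup>2) \<le> 1 / k * b"
    using n3 k by (intro mult_left_mono) auto
  have m3: "1 / k * sqrt (\<Sum>e\<in>\<D>. c\<^sub>D * (k\<^sup>2 * (L2_norm (face_measure e) (bdry \<T> lab u e))\<^sup>2
             + (L2_norm (face_measure e) (grad (bdry \<T> lab u e)))\<^sup>2)) \<le> 1 / k * (2 * b)"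
    using n4 k by (intro mult_left_mono) auto
  have eq: "1 / k * b + 1 / k * (2 * b) + 1 / k * b + 1 / k * (2 * b)
      = 6 * E * (1 / k * (1 + (1 + \<Lambda>) / k)) * M"
  proof -
    have "1 / k * b + 1 / k * (2 * b) + 1 / k * b + 1 / k * (2 * b) = 6 * (1 / k * b)" by simp
    also have "\<dots> = 6 * E * (1 / k * (1 + (1 + \<Lambda>) / k)) * M" unfolding b_def by (simp only: mult_ac)
    finally show ?thesis .
  qed
  show ?thesis unfolding M_def[symmetric] eq[symmetric] by (intro add_mono n1 m1 m2 m3)
qed

end

end

lemma max_over_ge: "finite A \<Longrightarrow> e \<in> A \<Longrightarrow> F e \<le> max_over A F"
  by (auto simp: max_over_def)

theorem theorem4p3:
  fixes \<Omega>\<^sub>1 D :: "(real^'n) set" and x\<^sub>0 :: "real^'n" and c\<^sub>\<Omega> c\<^sub>D \<theta> :: real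
  assumes "CARD('n) = 2 \<or> CARD('n) = 3"
    and "scattering_domain \<Omega>\<^sub>1 D x\<^sub>0 c\<^sub>\<Omega> c\<^sub>D"
    and "\<theta> > 0"
  shows "\<exists>C>0. \<forall>\<T> (lab :: (real^'n) set \<Rightarrow> nat) \<tau> (\<gamma>0 :: (real^'n) set \<Rightarrow> real) \<gamma>1 \<beta>1 (k::real).
    mesh \<T> (\<Omega>\<^sub>1 - D) \<and> (\<forall>K\<in>\<T>. min_angle \<theta> K) \<and> inj_on lab \<T> \<and>
    (\<forall>e\<in>faces_ID \<T> (frontier D). tangent_frame e (\<tau> e)) \<and> k > 0 \<and>
    (\<forall>e\<in>faces_ID \<T> (frontier D). \<gamma>0 e > 0 \<and> \<beta>1 e > 0) \<and>
    (\<forall>e\<in>interior_faces \<T>. \<gamma>1 e > 0)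
    \<longrightarrow> (\<exists>Csta>0.
      Csta \<le> 1 / k + 1 / k\<^sup>2
        + 1 / k\<^sup>2 * max_over (faces_on \<T> (frontier D))
            (\<lambda>e. 1 / \<gamma>0 e + \<gamma>0 e / diameter e + sqrt (\<gamma>0 e / \<beta>1 e) + 1 / \<beta>1 e)
        + 1 / k\<^sup>2 * max_over (interior_faces \<T>)
            (\<lambda>e. (k\<^sup>2 + 1) / \<gamma>0 e + 1 / diameter e * sqrt (\<gamma>0 e / \<gamma>1 e)
              + sqrt (\<gamma>0 e / \<beta>1 e) + 1 / \<beta>1 e) \<and>
      (\<forall>f g u.
        L2_fun (lebesgue_on (\<Omega>\<^sub>1 - D)) f \<and> bdry_L2 \<T> (frontier \<Omega>\<^sub>1) g \<and>
        ipdg_solution \<T> lab (frontier \<Omega>\<^sub>1) (frontier D) \<tau> \<gamma>0 \<gamma>1 \<beta>1 k f g u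
        \<longrightarrow>
        cells_norm \<T> u
          + 1 / k * norm_1h \<T> lab (frontier D) \<tau> \<gamma>0 \<gamma>1 \<beta>1 u
          + 1 / k * sqrt (\<Sum>e\<in>faces_on \<T> (frontier \<Omega>\<^sub>1).
              (L2_norm (face_measure e) (grad (bdry \<T> lab u e)))\<^sup>2)
          + 1 / k * sqrt (\<Sum>e\<in>faces_on \<T> (frontier D).
              c\<^sub>D * (k\<^sup>2 * (L2_norm (face_measure e) (bdry \<T> lab u e))\<^sup>2
                 + (L2_norm (face_measure e) (grad (bdry \<T> lab u e)))\<^sup>2))
        \<le> C * Csta * (L2_norm (lebesgue_on (\<Omega>\<^sub>1 - D)) f + bdry_norm \<T> (frontier \<Omega>\<^sub>1) g)))"
proof -
  \<comment> \<open>the sine of the angle enters the constant and has to be positive\<close>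
  define \<theta>' where "\<theta>' = min \<theta> (pi / 2)"
  have \<theta>': "0 < \<theta>'" "\<theta>' \<le> pi / 2" "\<theta>' \<le> \<theta>" using assms(3) by (auto simp: \<theta>'_def)
  have c\<Omega>: "c\<^sub>\<Omega> > 0" and bnd: "bounded (closure \<Omega>\<^sub>1)"
    using assms(2) by (auto simp: scattering_domain_def polyhedral_domain_def)
  obtain R\<^sub>0 where R0: "\<And>x. x \<in> closure \<Omega>\<^sub>1 \<Longrightarrow> norm (x - x\<^sub>0) \<le> R\<^sub>0"
    using bounded_translation_minus[OF bnd, of x\<^sub>0] unfolding bounded_iff by auto
  define R where "R = max 1 R\<^sub>0"
  have R: "1 \<le> R" "\<And>x. x \<in> closure \<Omega>\<^sub>1 \<Longrightarrow> norm (x - x\<^sub>0) \<le> R"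
    using R0 by (auto simp: R_def intro: max.coboundedI2)
  define C where "C = 10 * R * CARD('n) * (sqrt (4 * CARD('n) * (CARD('n) + 1) / (sin \<theta>')\<^sup>2 * (CARD('n) + 1)) + 1)"
  have "C \<ge> 1"
  proof -
    have "1 * 1 * 1 \<le> (10 * R) * CARD('n) * (sqrt (4 * CARD('n) * (CARD('n) + 1) / (sin \<theta>')\<^sup>2 * (CARD('n) + 1)) + 1)"
      using R(1) by (intro mult_mono) (auto simp: Suc_leI)
    then show ?thesis by (simp add: C_def)
  qed
  then obtain E where E: "E > 0" "energy_bound c\<^sub>\<Omega> C E" using energy_closure[OF c\<Omega>] by blast
  show ?thesis
  proof (rule exI[of _ "6 * E"], intro conjI allI impI)
    show "0 < 6 * E" using E by simp
    fix \<T> and lab :: "(real^'n) set \<Rightarrow> nat" and \<tau> and \<gamma>0 :: "(real^'n) set \<Rightarrow> real" and \<gamma>1 \<beta>1 :: "(real^'n) set \<Rightarrow> real" and k :: real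
    assume "mesh \<T> (\<Omega>\<^sub>1 - D) \<and> (\<forall>K\<in>\<T>. min_angle \<theta> K) \<and> inj_on lab \<T> \<and>
    (\<forall>e\<in>faces_ID \<T> (frontier D). tangent_frame e (\<tau> e)) \<and> k > 0 \<and>
    (\<forall>e\<in>faces_ID \<T> (frontier D). \<gamma>0 e > 0 \<and> \<beta>1 e > 0) \<and>
    (\<forall>e\<in>interior_faces \<T>. \<gamma>1 e > 0)"
    then have H: "mesh \<T> (\<Omega>\<^sub>1 - D)" "\<And>K. K \<in> \<T> \<Longrightarrow> min_angle \<theta> K" "inj_on lab \<T>"
      "\<And>e. e \<in> faces_ID \<T> (frontier D) \<Longrightarrow> tangent_frame e (\<tau> e)" "k > 0"
      "\<And>e. e \<in> faces_ID \<T> (frontier D) \<Longrightarrow> \<gamma>0 e > 0" "\<And>e. e \<in> faces_ID \<T> (frontier D) \<Longrightarrow> \<beta>1 e > 0"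
      "\<And>e. e \<in> interior_faces \<T> \<Longrightarrow> \<gamma>1 e > 0" by auto
    have ma: "min_angle \<theta>' K" if "K \<in> \<T>" for K
      using H(2)[OF that] \<theta>'(3) unfolding min_angle_def by (meson order.trans)
    interpret scattering_mesh \<T> lab \<Omega>\<^sub>1 D x\<^sub>0 c\<^sub>\<Omega> c\<^sub>D
      using H(1,3) assms(1,2) unfolding mesh_def by unfold_locales auto
    have fin: "finite \<I>" "finite \<D>"
    proof -
      have "finite (\<Union>K\<in>\<T>. {e. e facet_of K})"
        using finite_mesh card_facets_simplex(1)[OF simplices dim2] by blast
      then show "finite \<I>" "finite \<D>"
        by (rule finite_subset[rotated]; force simp: interior_faces_def faces_on_def)+
    qed
    let ?FD = "\<lambda>e. 1 / \<gamma>0 e + \<gamma>0 e / diameter e + sqrt (\<gamma>0 e / \<beta>1 e) + 1 / \<beta>1 e"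
    let ?FI = "\<lambda>e. (k\<^sup>2 + 1) / \<gamma>0 e + 1 / diameter e * sqrt (\<gamma>0 e / \<gamma>1 e) + sqrt (\<gamma>0 e / \<beta>1 e) + 1 / \<beta>1 e"
    define \<Lambda> where "\<Lambda> = max_over \<D> ?FD + max_over \<I> ?FI"
    have face: "diameter e \<ge> 0 \<and> \<gamma>0 e > 0 \<and> \<beta>1 e > 0" if e: "e \<in> \<I> \<or> e \<in> \<D>" for e
    proof -
      obtain K where "K \<in> \<T>" "e facet_of K" using e by (auto simp: interior_faces_def faces_on_def)
      then have "bounded e" using facet_normal_props(3)[OF simplices dim2] compact_imp_bounded by blast
      then show ?thesis using e H(6,7) diameter_ge_0 by (auto simp: faces_ID_def)
    qed
    have partsD: "0 \<le> 1 / \<gamma>0 e" "0 \<le> \<gamma>0 e / diameter e" "0 \<le> sqrt (\<gamma>0 e / \<beta>1 e)" "0 \<le> 1 / \<beta>1 e" if "e \<in> \<D>" for e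
      using face[of e] that by auto
    have partsI: "0 \<le> 1 / \<gamma>0 e" "0 \<le> k\<^sup>2 / \<gamma>0 e" "0 \<le> 1 / diameter e * sqrt (\<gamma>0 e / \<gamma>1 e)" "0 \<le> sqrt (\<gamma>0 e / \<beta>1 e)" "0 \<le> 1 / \<beta>1 e"
      if "e \<in> \<I>" for e
      using face[of e] H(8)[of e] that by auto
    have split: "(k\<^sup>2 + 1) / \<gamma>0 e = k\<^sup>2 / \<gamma>0 e + 1 / \<gamma>0 e" for e by (rule add_divide_distrib)
    have FD0: "?FD e \<ge> 0" if "e \<in> \<D>" for e using partsD[OF that] by linarith
    have FI0: "?FI e \<ge> 0" if "e \<in> \<I>" for e using partsI[OF that] split[of e] by linarith
    have max0: "max_over A F \<ge> 0" if "finite A" "\<And>e. e \<in> A \<Longrightarrow> F e \<ge> 0" for A and F :: "(real^'n) set \<Rightarrow> real"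
    proof (cases "A = {}")
      case False
      then obtain e where "e \<in> A" by auto
      then show ?thesis using max_over_ge[OF that(1), of e F] that(2)[of e] by linarith
    qed (simp add: max_over_def)
    have mD: "max_over \<D> ?FD \<ge> 0" by (rule max0[OF fin(2) FD0])
    have mI: "max_over \<I> ?FI \<ge> 0" by (rule max0[OF fin(1) FI0])
    have \<Lambda>D: "?FD e \<le> \<Lambda>" if "e \<in> \<D>" for e using max_over_ge[OF fin(2) that, of ?FD] mI unfolding \<Lambda>_def by linarith
    have \<Lambda>I: "?FI e \<le> \<Lambda>" if "e \<in> \<I>" for e using max_over_ge[OF fin(1) that, of ?FI] mD unfolding \<Lambda>_def by linarith
    have \<Lambda>0: "0 \<le> \<Lambda>" using mD mI by (simp add: \<Lambda>_def)
    have bD: "1 / \<gamma>0 e \<le> \<Lambda>" "sqrt (\<gamma>0 e / \<beta>1 e) \<le> \<Lambda>" "1 / \<beta>1 e \<le> \<Lambda>" "\<gamma>0 e / diameter e \<le> \<Lambda>" if "e \<in> \<D>" for e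
      using \<Lambda>D[OF that] partsD[OF that] by linarith+
    have bI: "1 / \<gamma>0 e \<le> \<Lambda>" "sqrt (\<gamma>0 e / \<beta>1 e) \<le> \<Lambda>" "1 / \<beta>1 e \<le> \<Lambda>"
      "k\<^sup>2 / \<gamma>0 e \<le> \<Lambda>" "1 / diameter e * sqrt (\<gamma>0 e / \<gamma>1 e) \<le> \<Lambda>" if "e \<in> \<I>" for e
      using \<Lambda>I[OF that] partsI[OF that] split[of e] by linarith+
    have bID: "1 / \<gamma>0 e \<le> \<Lambda>" "sqrt (\<gamma>0 e / \<beta>1 e) \<le> \<Lambda>" "1 / \<beta>1 e \<le> \<Lambda>" if "e \<in> faces_ID \<T> (frontier D)" for e
      using that bD(1-3)[of e] bI(1-3)[of e] unfolding faces_ID_def by blast+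
    interpret ipdg_mesh \<T> lab \<Omega>\<^sub>1 D x\<^sub>0 c\<^sub>\<Omega> c\<^sub>D \<theta>' R \<tau> \<gamma>0 \<gamma>1 \<beta>1 k \<Lambda>
      by unfold_locales (fact ma \<theta>' R H \<Lambda>0 bID bD bI)+
    define Csta where "Csta = 1 / k * (1 + (1 + \<Lambda>) / k)"
    show "\<exists>Csta>0.
      Csta \<le> 1 / k + 1 / k\<^sup>2
        + 1 / k\<^sup>2 * max_over (faces_on \<T> (frontier D))
            (\<lambda>e. 1 / \<gamma>0 e + \<gamma>0 e / diameter e + sqrt (\<gamma>0 e / \<beta>1 e) + 1 / \<beta>1 e)
        + 1 / k\<^sup>2 * max_over (interior_faces \<T>)
            (\<lambda>e. (k\<^sup>2 + 1) / \<gamma>0 e + 1 / diameter e * sqrt (\<gamma>0 e / \<gamma>1 e)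
              + sqrt (\<gamma>0 e / \<beta>1 e) + 1 / \<beta>1 e) \<and>
      (\<forall>f g u.
        L2_fun (lebesgue_on (\<Omega>\<^sub>1 - D)) f \<and> bdry_L2 \<T> (frontier \<Omega>\<^sub>1) g \<and>
        ipdg_solution \<T> lab (frontier \<Omega>\<^sub>1) (frontier D) \<tau> \<gamma>0 \<gamma>1 \<beta>1 k f g u
        \<longrightarrow>
        cells_norm \<T> u
          + 1 / k * norm_1h \<T> lab (frontier D) \<tau> \<gamma>0 \<gamma>1 \<beta>1 u
          + 1 / k * sqrt (\<Sum>e\<in>faces_on \<T> (frontier \<Omega>\<^sub>1).
              (L2_norm (face_measure e) (grad (bdry \<T> lab u e)))\<^sup>2)
          + 1 / k * sqrt (\<Sum>e\<in>faces_on \<T> (frontier D).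
              c\<^sub>D * (k\<^sup>2 * (L2_norm (face_measure e) (bdry \<T> lab u e))\<^sup>2
                 + (L2_norm (face_measure e) (grad (bdry \<T> lab u e)))\<^sup>2))
        \<le> 6 * E * Csta * (L2_norm (lebesgue_on (\<Omega>\<^sub>1 - D)) f + bdry_norm \<T> (frontier \<Omega>\<^sub>1) g))"
    proof (rule exI[of _ Csta], intro conjI allI impI)
      show "0 < Csta" using H(5) \<Lambda>0 by (simp add: Csta_def add_pos_nonneg)
      show "Csta \<le> 1 / k + 1 / k\<^sup>2 + 1 / k\<^sup>2 * max_over \<D> ?FD + 1 / k\<^sup>2 * max_over \<I> ?FI"
        unfolding Csta_def \<Lambda>_def using H(5) by (simp add: field_simps power2_eq_square)
      fix f g :: "real^'n \<Rightarrow> complex" and u :: "'n pw"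
      assume "L2_fun (lebesgue_on (\<Omega>\<^sub>1 - D)) f \<and> bdry_L2 \<T> (frontier \<Omega>\<^sub>1) g \<and>
        ipdg_solution \<T> lab (frontier \<Omega>\<^sub>1) (frontier D) \<tau> \<gamma>0 \<gamma>1 \<beta>1 k f g u"
      then have f: "L2_fun (lebesgue_on (\<Omega>\<^sub>1 - D)) f" and g: "bdry_L2 \<T> (frontier \<Omega>\<^sub>1) g"
        and sol: "ipdg_solution \<T> lab (frontier \<Omega>\<^sub>1) (frontier D) \<tau> \<gamma>0 \<gamma>1 \<beta>1 k f g u" by auto
      interpret ipdg_function \<T> lab \<Omega>\<^sub>1 D x\<^sub>0 c\<^sub>\<Omega> c\<^sub>D \<theta>' R \<tau> \<gamma>0 \<gamma>1 \<beta>1 k \<Lambda> u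
        by unfold_locales (use sol in \<open>simp add: ipdg_solution_def\<close>)
      have "energy_bound c\<^sub>\<Omega> (10 * R * CARD('n) * (sqrt (trace_const * (CARD('n) + 1)) + 1)) E"
        using E(2) unfolding C_def trace_const_def .
      from stability[OF sol f g this E(1), folded Csta_def]
      show "cells_norm \<T> u
          + 1 / k * norm_1h \<T> lab (frontier D) \<tau> \<gamma>0 \<gamma>1 \<beta>1 u
          + 1 / k * sqrt (\<Sum>e\<in>faces_on \<T> (frontier \<Omega>\<^sub>1).
              (L2_norm (face_measure e) (grad (bdry \<T> lab u e)))\<^sup>2)
          + 1 / k * sqrt (\<Sum>e\<in>faces_on \<T> (frontier D).
              c\<^sub>D * (k\<^sup>2 * (L2_norm (face_measure e) (bdry \<T> lab u e))\<^sup>2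
                 + (L2_norm (face_measure e) (grad (bdry \<T> lab u e)))\<^sup>2))
        \<le> 6 * E * Csta * (L2_norm (lebesgue_on (\<Omega>\<^sub>1 - D)) f + bdry_norm \<T> (frontier \<Omega>\<^sub>1) g)" .
    qed
  qed
qed

end
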